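(* For Lebesgue-almost every $\alpha>0$ the following holds: for every $\varepsilon>0$ there is a constant $C=C(\alpha,\varepsilon)>0$ such that $\delta_{\min}^{(\alpha)}(N)\le C\,N^{-1+\varepsilon}$ for all integers $N\ge 2$.
   Context: For irrational $\alpha>0$, the numbers $\alpha m^2+n^2$ with integers $m,n\ge 1$ are pairwise distinct; list them in increasing order as $0<\lambda_1<\lambda_2<\cdots$. For $N\ge 2$ define the minimal gap $\delta_{\min}^{(\alpha)}(N)=\min\{\lambda_{i+1}-\lambda_i : 1\le i<N\}$. (Almost every $\alpha$ is irrational, so this is defined for almost every $\alpha$.) *)

theory Defs
  imports "HOL-Analysis.Analysis"
begin

definition spec_set :: "real \<Rightarrow> real set" where
  "spec_set \<alpha> = {\<alpha> * (real m)\<^sup>2 + (real n)\<^sup>2 | m n :: nat. m \<ge> 1 \<and> n \<ge> 1}"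

text \<open>The k-th smallest element (1-indexed): the element having exactly k-1 smaller
  elements of the set below it. For irrational alpha > 0 the elements are pairwise distinct
  and every initial segment is finite, so this is the usual increasing enumeration.\<close>
definition spec_lambda :: "real \<Rightarrow> nat \<Rightarrow> real" where
  "spec_lambda \<alpha> k = (THE x. x \<in> spec_set \<alpha> \<and> card {y \<in> spec_set \<alpha>. y < x} = k - 1)"

definition delta_min :: "real \<Rightarrow> nat \<Rightarrow> real" where
  "delta_min \<alpha> N = Min ((\<lambda>i. spec_lambda \<alpha> (i + 1) - spec_lambda \<alpha> i) ` {1..<N})"

end

theory Submission
  imports Defs "HOL-Probability.Probability" "HOL-Computational_Algebra.Primes"
begin

text \<open>
  Since \<open>4 a b = (a + b)\<^sup>2 - (a - b)\<^sup>2\<close>, it suffices to find, for almost every \<open>\<alpha>\<close> and every large \<open>M\<close>,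
  positive integers \<open>a, b, c, d\<close> of size \<open>O(M)\<close> with \<open>\<bar>\<alpha> a b - c d\<bar> = O(M powr (-2 + \<epsilon>))\<close>.
  Consider the numbers \<open>ln (c d u / (a b N))\<close> with \<open>a, b, c, d\<close> in \<open>(T, 2T]\<close>, where the amplifier
  \<open>u = N + x\<^sub>1 + \<dots> + x\<^sub>J\<close> has the size of a small power of \<open>T\<close>. Smooth their distribution by Gaussians of
  widths \<open>\<delta> = 1 / T\<^sup>4\<close> and \<open>\<Delta>\<close>, a small negative power of \<open>T\<close>. The wide smoothing is bounded below, the
  narrow one is negligible at every \<open>ln \<alpha>\<close> that is badly approximable, and by Plancherel their
  difference is small in mean square: at low frequencies the two Gaussians agree, at middle
  frequencies the sum of \<open>n\<close> to the power \<open>i t\<close> over \<open>(T, 2T]\<close> is small, and at high frequencies Weyl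
  differencing gives a power saving in the sum over \<open>u\<close>, while the eighth moment of the sum over
  \<open>(T, 2T]\<close> is bounded, up to the divisor bound, by its diagonal. Hence the exceptional sets have
  measure at most a negative power of \<open>T\<close>, and the Borel--Cantelli lemma applies.
\<close>

section \<open>Weyl sums\<close>

text \<open>Why an amplifier: a resolution of \<open>1 / T^4\<close> forces frequencies up to about
  \<open>T^4\<close> into Plancherel, and there the normalised eighth moment is only bounded by a
  power of the divisor function, whereas it has to be small. The sum over \<open>u\<close> supplies
  a saving \<open>k powr (- g)\<close>, where \<open>T = 10 * k ^ K\<close> and \<open>g\<close>
  depends only on \<open>K\<close>; the exponent in the divisor bound is chosen afterwards, small
  against \<open>g / K\<close>. The price is a factor \<open>k^19\<close> in the final error
  relative to \<open>M powr (-2)\<close>. As \<open>M\<close> is about \<open>k^(K+6)\<close>, this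
  is at most \<open>M powr \<epsilon>\<close> once \<open>K\<close> is large in terms of \<epsilon>.
  The other parameters are \<open>N = k^6\<close>, \<open>H = k^4\<close> (the range of each summand
  of \<open>u\<close>) and \<open>J = 5 * K\<close>. Since \<open>H / N = k^-2\<close>, differencing
  of order \<open>j + 1\<close> handles \<open>k^(2j+3) <= |t| <= k^(2j+5)\<close>, and
  \<open>J\<close> orders reach far beyond \<open>T^4\<close>. Only ln \<alpha> in
  \<open>[0, 1/10]\<close> is treated analytically, so that the last of the four variables can be
  solved for inside its range; rational factors reach all other \<alpha>.\<close>

primrec fdiff :: "nat \<Rightarrow> (nat \<Rightarrow> real) \<Rightarrow> nat \<Rightarrow> real" where
  "fdiff 0 f x = f x"
| "fdiff (Suc j) f x = fdiff j f (Suc x) - fdiff j f x"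

text \<open>The sum of \<open>cis (f (y1 + ... + yj))\<close> over independent
  \<open>y1, ..., yj\<close> in \<open>{1..H}\<close>. Because the shifts are separate variables,
  Cauchy-Schwarz doubles one of them over its full range, and differencing produces no truncated
  intervals. Phases carry no factor 2 pi, hence the threshold 1 for increments below.\<close>

primrec wsum :: "nat \<Rightarrow> nat \<Rightarrow> (nat \<Rightarrow> real) \<Rightarrow> complex" where
  "wsum 0 H f = cis (f 0)"
| "wsum (Suc j) H f = (\<Sum>y\<in>{1..H}. wsum j H (\<lambda>x. f (x + y)))"

lemma norm_wsum_le: "cmod (wsum j H f) \<le> real H ^ j"
proof (induction j arbitrary: f)
  case (Suc j)
  have "cmod (wsum (Suc j) H f) \<le> (\<Sum>y\<in>{1..H}. cmod (wsum j H (\<lambda>x. f (x + y))))"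
    by (simp add: norm_sum)
  also have "\<dots> \<le> (\<Sum>y\<in>{1..H}. real H ^ j)" by (intro sum_mono Suc)
  finally show ?case by simp
qed simp

lemma wsum_uminus: "wsum j H (\<lambda>x. - f x) = cnj (wsum j H f)"
  by (induction j arbitrary: f) (simp_all add: cis_cnj)

lemma fdiff_shift: "fdiff j (\<lambda>x. f (x + y)) x = fdiff j f (x + y)"
  by (induction j arbitrary: x) simp_all

lemma fdiff_diff: "fdiff j (\<lambda>x. f x - g x) x = fdiff j f x - fdiff j g x"
  by (induction j arbitrary: x) simp_all

lemma fdiff_telescope:
  assumes "y' \<le> y"
  shows "fdiff j f (x + y) - fdiff j f (x + y') = (\<Sum>v\<in>{y'..<y}. fdiff (Suc j) f (x + v))"
  using assms by (induction y rule: dec_induct) simp_all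

lemma norm_sum_cis_sq:
  assumes "finite A"
  shows "complex_of_real ((cmod (\<Sum>a\<in>A. cis (f a)))\<^sup>2) = (\<Sum>a\<in>A. \<Sum>b\<in>A. cis (f a - f b))"
proof -
  have "complex_of_real ((cmod (\<Sum>a\<in>A. cis (f a)))\<^sup>2) = (\<Sum>a\<in>A. cis (f a)) * cnj (\<Sum>a\<in>A. cis (f a))"
    by (rule complex_norm_square)
  also have "\<dots> = (\<Sum>a\<in>A. \<Sum>b\<in>A. cis (f a - f b))"
    by (simp add: sum_product cis_cnj cis_mult)
  finally show ?thesis .
qed

text \<open>Cauchy-Schwarz over the \<open>j\<close> inner variables, which all the
  \<open>g a\<close> share; only the index \<open>a\<close> is doubled. With
  \<open>g a x = f (x + a)\<close> this is one step of Weyl differencing. Keeping a real part on the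
  right makes the base case an identity and lets the bound be summed over one more variable.\<close>

lemma norm_sum_wsum_sq_le:
  assumes "finite A"
  shows "(cmod (\<Sum>a\<in>A. wsum j H (g a)))\<^sup>2
    \<le> real H ^ j * Re (\<Sum>a\<in>A. \<Sum>b\<in>A. wsum j H (\<lambda>x. g a x - g b x))"
proof (induction j arbitrary: g)
  case 0
  show ?case
    using arg_cong[OF norm_sum_cis_sq[OF assms, of "\<lambda>a. g a 0"], of Re] by simp
next
  case (Suc j)
  let ?S = "\<lambda>v. \<Sum>a\<in>A. wsum j H (\<lambda>x. g a (x + v))"
  have "cmod (\<Sum>a\<in>A. wsum (Suc j) H (g a)) = cmod (\<Sum>v\<in>{1..H}. ?S v)"
    by (subst sum.swap) simp
  also have "\<dots> \<le> (\<Sum>v\<in>{1..H}. 1 * cmod (?S v))" by (simp add: norm_sum)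
  finally have "(cmod (\<Sum>a\<in>A. wsum (Suc j) H (g a)))\<^sup>2 \<le> (\<Sum>v\<in>{1..H}. 1 * cmod (?S v))\<^sup>2"
    by (intro power_mono) auto
  also have "\<dots> \<le> (\<Sum>v\<in>{1..H}. 1\<^sup>2) * (\<Sum>v\<in>{1..H}. (cmod (?S v))\<^sup>2)"
    by (rule Cauchy_Schwarz_ineq_sum)
  also have "\<dots> = real H * (\<Sum>v\<in>{1..H}. (cmod (?S v))\<^sup>2)" by simp
  also have "\<dots> \<le> real H * (\<Sum>v\<in>{1..H}. real H ^ j * Re (\<Sum>a\<in>A. \<Sum>b\<in>A. wsum j H (\<lambda>x. g a (x+v) - g b (x+v))))"
    by (intro mult_left_mono sum_mono Suc) auto
  also have "\<dots> = real H ^ Suc j * Re (\<Sum>v\<in>{1..H}. \<Sum>a\<in>A. \<Sum>b\<in>A. wsum j H (\<lambda>x. g a (x+v) - g b (x+v)))"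
    by (simp add: sum_distrib_left mult.assoc)
  also have "(\<Sum>v\<in>{1..H}. \<Sum>a\<in>A. \<Sum>b\<in>A. wsum j H (\<lambda>x. g a (x+v) - g b (x+v)))
     = (\<Sum>a\<in>A. \<Sum>v\<in>{1..H}. \<Sum>b\<in>A. wsum j H (\<lambda>x. g a (x+v) - g b (x+v)))"
    by (rule sum.swap)
  also have "\<dots> = (\<Sum>a\<in>A. \<Sum>b\<in>A. wsum (Suc j) H (\<lambda>x. g a x - g b x))"
    by (rule sum.cong[OF refl], subst sum.swap) simp
  finally show ?case .
qed

section \<open>Sums with slowly varying increments\<close>

lemma norm_cis_minus_one_ge:
  assumes "0 \<le> \<theta>" "\<theta> \<le> 1"
  shows "\<theta> / 2 \<le> cmod (cis \<theta> - 1)"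
proof -
  have "\<theta> / 2 \<le> sin \<theta>"
  proof -
    have "(\<lambda>x::real. sin x - x / 2) 0 \<le> sin \<theta> - \<theta> / 2"
    proof (rule DERIV_nonneg_imp_nondecreasing[OF assms(1)])
      fix x :: real assume x: "0 \<le> x" "x \<le> \<theta>"
      \<comment> \<open>As \<open>x <= 1 < pi/3\<close>, the derivative \<open>cos x - 1/2\<close>
        is nonnegative.\<close>
      have "cos (pi/3) \<le> cos x" using x assms pi_gt3 by (intro cos_monotone_0_pi_le) auto
      thus "\<exists>y. ((\<lambda>x. sin x - x / 2) has_real_derivative y) (at x) \<and> 0 \<le> y"
        by (intro exI[of _ "cos x - 1 / 2"]) (auto intro!: derivative_eq_intros simp: cos_60)
    qed
    thus ?thesis by simp
  qed
  also have "\<dots> = Im (cis \<theta> - 1)" by simp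
  also have "\<dots> \<le> cmod (cis \<theta> - 1)" using abs_Im_le_cmod abs_le_D1 by blast
  finally show ?thesis .
qed

lemma norm_inverse_cis_diff_le:
  assumes "0 < l" "l \<le> a" "a \<le> 1" "l \<le> b" "b \<le> 1"
  shows "cmod (1 / (cis a - 1) - 1 / (cis b - 1)) \<le> 4 * \<bar>a - b\<bar> / l\<^sup>2"
proof -
  have A: "l / 2 \<le> cmod (cis a - 1)" using norm_cis_minus_one_ge[of a] assms by simp
  have B: "l / 2 \<le> cmod (cis b - 1)" using norm_cis_minus_one_ge[of b] assms by simp
  have nz: "cis a - 1 \<noteq> 0" "cis b - 1 \<noteq> 0" using A B assms(1) by auto
  have "1 / (cis a - 1) - 1 / (cis b - 1) = (cis b - cis a) / ((cis a - 1) * (cis b - 1))"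
    using nz by (simp add: diff_frac_eq)
  hence "cmod (1 / (cis a - 1) - 1 / (cis b - 1)) = cmod (cis b - cis a) / (cmod (cis a - 1) * cmod (cis b - 1))"
    by (simp add: norm_divide norm_mult)
  also have "\<dots> \<le> \<bar>a - b\<bar> / ((l / 2) * (l / 2))"
  proof (rule frac_le)
    have "cis b - cis a = cis a * (cis (b - a) - 1)" by (simp add: algebra_simps cis_mult)
    hence "cmod (cis b - cis a) = 2 * \<bar>sin ((b - a) / 2)\<bar>"
      using dist_exp_i_1[of "b - a"] by (simp add: norm_mult cis_conv_exp)
    also have "\<dots> \<le> 2 * \<bar>(b - a) / 2\<bar>" by (intro mult_left_mono abs_sin_x_le_abs_x) auto
    finally show "cmod (cis b - cis a) \<le> \<bar>a - b\<bar>" by simp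
    show "l / 2 * (l / 2) \<le> cmod (cis a - 1) * cmod (cis b - 1)"
      using A B assms(1) by (intro mult_mono) auto
  qed (use assms(1) in auto)
  also have "\<dots> = 4 * \<bar>a - b\<bar> / l\<^sup>2" by (simp add: power2_eq_square)
  finally show ?thesis .
qed

text \<open>A discrete form of the Kusmin--Landau inequality: \<open>cis (f x)\<close> is the difference
  \<open>cis (f (x + 1)) - cis (f x)\<close> divided by the slowly varying \<open>cis (f (x + 1) - f x) - 1\<close>,
  so partial summation applies.\<close>
lemma norm_sum_cis_le:
  fixes f :: "nat \<Rightarrow> real"
  assumes l: "0 < l" and "0 \<le> \<kappa>"
    and 1: "\<And>x. x \<in> {m..m+n} \<Longrightarrow> l \<le> f (Suc x) - f x \<and> f (Suc x) - f x \<le> 1"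
    and 2: "\<And>x. x \<in> {m..<m+n} \<Longrightarrow> \<bar>(f (Suc (Suc x)) - f (Suc x)) - (f (Suc x) - f x)\<bar> \<le> \<kappa>"
  shows "cmod (\<Sum>x\<in>{m..m+n}. cis (f x)) \<le> 4 / l + n * (4 * \<kappa> / l\<^sup>2)"
proof -
  define c where "c x = 1 / (cis (f (Suc x) - f x) - 1)" for x
  have cn: "cmod (c x) \<le> 2 / l" if "x \<in> {m..m+n}" for x
  proof -
    have "l / 2 \<le> cmod (cis (f (Suc x) - f x) - 1)"
      using norm_cis_minus_one_ge[of "f (Suc x) - f x"] 1[OF that] l by simp
    hence "1 / cmod (cis (f (Suc x) - f x) - 1) \<le> 1 / (l / 2)" using l by (intro frac_le) auto
    thus ?thesis by (simp add: c_def norm_divide)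
  qed
  \<comment> \<open>Summation by parts: the two boundary terms will contribute \<open>4 / l\<close>,
    and the remaining sum only involves differences of consecutive coefficients
    \<open>c\<close>.\<close>
  have *: "i \<le> n \<Longrightarrow> (\<Sum>x\<in>{m..m+i}. cis (f x)) = c (m+i) * cis (f (Suc (m+i))) - c m * cis (f m)
      - (\<Sum>x\<in>{m..<m+i}. (c (Suc x) - c x) * cis (f (Suc x)))" for i
  proof -
    have e: "cis (f x) = c x * (cis (f (Suc x)) - cis (f x))" if "x \<in> {m..m+n}" for x
    proof -
      have "l / 2 \<le> cmod (cis (f (Suc x) - f x) - 1)"
        using norm_cis_minus_one_ge[of "f (Suc x) - f x"] 1[OF that] l by simp
      hence nz: "cis (f (Suc x) - f x) - 1 \<noteq> 0" using l by auto
      have "cis (f (Suc x)) - cis (f x) = cis (f x) * (cis (f (Suc x) - f x) - 1)"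
        by (simp add: algebra_simps cis_mult)
      thus ?thesis using nz by (simp add: c_def)
    qed
    assume "i \<le> n" thus ?thesis
    proof (induction i)
      case 0 thus ?case using e[of m] by (simp add: algebra_simps)
    next
      case (Suc i)
      have e': "c (Suc (m+i)) * cis (f (Suc (Suc (m+i)))) = cis (f (Suc (m+i))) + c (Suc (m+i)) * cis (f (Suc (m+i)))"
        using e[of "Suc (m+i)"] Suc.prems by (simp add: algebra_simps)
      show ?case using Suc by (simp add: ring_distribs e')
    qed
  qed
  have "cmod (\<Sum>x\<in>{m..m+n}. cis (f x)) \<le> cmod (c (m+n)) + cmod (c m)
      + cmod (\<Sum>x\<in>{m..<m+n}. (c (Suc x) - c x) * cis (f (Suc x)))"
    unfolding *[OF order_refl]
    by (intro order_trans[OF norm_triangle_ineq4] add_mono) (simp_all add: norm_mult)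
  also have "cmod (\<Sum>x\<in>{m..<m+n}. (c (Suc x) - c x) * cis (f (Suc x))) \<le> (\<Sum>x\<in>{m..<m+n}. 4 * \<kappa> / l\<^sup>2)"
  proof (rule order_trans[OF norm_sum], rule sum_mono)
    fix x assume x: "x \<in> {m..<m+n}"
    have "cmod (c (Suc x) - c x) \<le> 4 * \<bar>(f (Suc (Suc x)) - f (Suc x)) - (f (Suc x) - f x)\<bar> / l\<^sup>2"
      unfolding c_def using 1[of x] 1[of "Suc x"] x l by (intro norm_inverse_cis_diff_le) auto
    also have "\<dots> \<le> 4 * \<kappa> / l\<^sup>2" using 2[OF x] by (intro divide_right_mono) auto
    finally show "cmod ((c (Suc x) - c x) * cis (f (Suc x))) \<le> 4 * \<kappa> / l\<^sup>2" by (simp add: norm_mult)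
  qed
  also have "cmod (c (m+n)) + cmod (c m) \<le> 2 / l + 2 / l" by (intro add_mono cn) auto
  finally show ?thesis by simp
qed

lemma card_close_pairs_le:
  fixes H :: nat and r :: real
  assumes "1 \<le> r"
  shows "real (card {(a,b). a \<in> {1..H} \<and> b \<in> {1..H} \<and> \<bar>real a - real b\<bar> < r}) \<le> 3 * r * H"
proof -
  have sub: "{(a,b). a \<in> {1..H} \<and> b \<in> {1..H} \<and> \<bar>real a - real b\<bar> < r}
     \<subseteq> (SIGMA a:{1..H}. {a - nat \<lfloor>r\<rfloor>..a + nat \<lfloor>r\<rfloor>})"
  proof -
    have "a \<le> b + nat \<lfloor>r\<rfloor>" "b \<le> a + nat \<lfloor>r\<rfloor>" if "\<bar>real a - real b\<bar> < r" for a b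
      using that assms by linarith+
    thus ?thesis by fastforce
  qed
  have "card {(a,b). a \<in> {1..H} \<and> b \<in> {1..H} \<and> \<bar>real a - real b\<bar> < r}
     \<le> card (SIGMA a:{1..H}. {a - nat \<lfloor>r\<rfloor>..a + nat \<lfloor>r\<rfloor>})"
    by (rule card_mono[OF _ sub]) auto
  also have "\<dots> = (\<Sum>a\<in>{1..H}. card {a - nat \<lfloor>r\<rfloor>..a + nat \<lfloor>r\<rfloor>})" by simp
  also have "\<dots> \<le> (\<Sum>a\<in>{1..H}. 2 * nat \<lfloor>r\<rfloor> + 1)" by (intro sum_mono) auto
  also have "\<dots> = H * (2 * nat \<lfloor>r\<rfloor> + 1)" by simp
  finally have "real (card {(a,b). a \<in> {1..H} \<and> b \<in> {1..H} \<and> \<bar>real a - real b\<bar> < r})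
      \<le> real (H * (2 * nat \<lfloor>r\<rfloor> + 1))" by (simp only: of_nat_le_iff)
  also have "\<dots> \<le> real H * (3 * r)"
  proof -
    have "real (nat \<lfloor>r\<rfloor>) \<le> r" using assms by linarith
    hence "real (2 * nat \<lfloor>r\<rfloor> + 1) \<le> 3 * r" using assms by linarith
    thus ?thesis unfolding of_nat_mult by (intro mult_left_mono) auto
  qed
  finally show ?thesis by (simp add: mult_ac)
qed

lemma norm_wsum_diff_commute:
  "cmod (wsum j H (\<lambda>x. g x - f x)) = cmod (wsum j H (\<lambda>x. f x - g x))"
  using wsum_uminus[of j H "\<lambda>x. f x - g x"] by simp

text \<open>A difference of order \<open>j + 1\<close> of \<open>f (x + y) - f (x + y')\<close> is a
  sum of \<open>y - y'\<close> differences of \<open>f\<close> of order \<open>j + 2\<close>. Hence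
  \<open>l\<close>, \<open>L\<close> and \<open>l / H\<close> all scale by \<open>y - y'\<close>,
  and \<open>y - y' <= H\<close> turns assumption \<open>3\<close> into the same condition one order
  lower. The hypothesis of the coming induction enters as \<open>IH\<close>.\<close>

lemma norm_wsum_shift_diff_le:
  assumes H: "H \<ge> 1" and l: "0 < l" and yy: "y' < y" "y \<le> H"
    and 1: "\<And>x. x \<le> Suc (Suc j) * H \<Longrightarrow> l \<le> fdiff (Suc (Suc j)) f x \<and> fdiff (Suc (Suc j)) f x \<le> L"
    and 2: "\<And>x. x \<le> Suc (Suc j) * H \<Longrightarrow> \<bar>fdiff (Suc (Suc (Suc j))) f x\<bar> \<le> l / H"
    and 3: "L * real H ^ Suc j \<le> 1"
    and IH: "\<And>f l L. 0 < l \<Longrightarrow> (\<And>x. x \<le> Suc j * H \<Longrightarrow> l \<le> fdiff (Suc j) f x \<and> fdiff (Suc j) f x \<le> L) \<Longrightarrow>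
       (\<And>x. x \<le> Suc j * H \<Longrightarrow> \<bar>fdiff (Suc (Suc j)) f x\<bar> \<le> l / H) \<Longrightarrow> L * real H ^ j \<le> 1 \<Longrightarrow>
       cmod (wsum (Suc j) H f) \<le> 8 * real H ^ Suc j * (l * real H ^ Suc j) powr (- g)"
  shows "cmod (wsum (Suc j) H (\<lambda>x. f (x + y) - f (x + y')))
     \<le> 8 * real H ^ Suc j * (real (y - y') * l * real H ^ Suc j) powr (- g)"
proof (rule IH[of "real (y - y') * l" _ "real (y - y') * L"])
  show "0 < real (y - y') * l" using yy l by simp
  have fd: "fdiff i (\<lambda>x. f (x + y) - f (x + y')) x = (\<Sum>v\<in>{y'..<y}. fdiff (Suc i) f (x + v))" for i x
    using fdiff_telescope[of y' y i f x] yy by (simp add: fdiff_diff fdiff_shift)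
  {
    fix x assume x: "x \<le> Suc j * H"
    have r: "x + v \<le> Suc (Suc j) * H" if "v \<in> {y'..<y}" for v using x that yy by auto
    have "(\<Sum>v\<in>{y'..<y}. l) \<le> (\<Sum>v\<in>{y'..<y}. fdiff (Suc (Suc j)) f (x + v))"
      by (rule sum_mono) (use 1 r in blast)
    moreover have "(\<Sum>v\<in>{y'..<y}. fdiff (Suc (Suc j)) f (x + v)) \<le> (\<Sum>v\<in>{y'..<y}. L)"
      by (rule sum_mono) (use 1 r in blast)
    ultimately show "real (y - y') * l \<le> fdiff (Suc j) (\<lambda>x. f (x + y) - f (x + y')) x \<and>
       fdiff (Suc j) (\<lambda>x. f (x + y) - f (x + y')) x \<le> real (y - y') * L"
      unfolding fd by simp
    have "\<bar>\<Sum>v\<in>{y'..<y}. fdiff (Suc (Suc (Suc j))) f (x + v)\<bar> \<le> (\<Sum>v\<in>{y'..<y}. l / H)"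
      by (rule order_trans[OF sum_abs], rule sum_mono) (use 2 r in blast)
    thus "\<bar>fdiff (Suc (Suc j)) (\<lambda>x. f (x + y) - f (x + y')) x\<bar> \<le> real (y - y') * l / real H"
      unfolding fd by simp
  }
  have L: "0 \<le> L" using 1[of 0] l by linarith
  have "real (y - y') * L * real H ^ j \<le> real H * L * real H ^ j"
    using yy L by (intro mult_right_mono) auto
  also have "\<dots> \<le> 1" using 3 by (simp add: mult_ac)
  finally show "real (y - y') * L * real H ^ j \<le> 1" .
qed

text \<open>Weyl differencing: each step passes from \<open>f\<close> to \<open>f (x + y) - f (x + y')\<close>, whose
  \<open>j\<close>-th differences are about \<open>y - y'\<close> times the \<open>(j+1)\<close>-st differences of \<open>f\<close>;
  pairs with \<open>\<bar>y - y'\<bar>\<close> small are few and estimated trivially.\<close>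
lemma norm_wsum_weyl:
  assumes H: "H \<ge> 1" and l: "0 < l"
    and 1: "\<And>x. x \<le> Suc j * H \<Longrightarrow> l \<le> fdiff (Suc j) f x \<and> fdiff (Suc j) f x \<le> L"
    and 2: "\<And>x. x \<le> Suc j * H \<Longrightarrow> \<bar>fdiff (Suc (Suc j)) f x\<bar> \<le> l / H"
    and 3: "L * real H ^ j \<le> 1"
  shows "cmod (wsum (Suc j) H f) \<le> 8 * real H ^ Suc j * (l * real H ^ Suc j) powr (- (1 / 4 ^ j))"
  using l 1 2 3
proof (induction j arbitrary: f l L)
  case 0
  have "cmod (\<Sum>x\<in>{1..1+(H-1)}. cis (f x)) \<le> 4 / l + real (H-1) * (4 * (l / H) / l\<^sup>2)"
  proof (rule norm_sum_cis_le)
    fix x assume x: "x \<in> {1..1 + (H - 1)}"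
    hence "l \<le> f (Suc x) - f x \<and> f (Suc x) - f x \<le> L" using 0(2)[of x] H by auto
    thus "l \<le> f (Suc x) - f x \<and> f (Suc x) - f x \<le> 1" using 0(4) by auto
  next
    fix x assume "x \<in> {1..<1 + (H - 1)}"
    thus "\<bar>f (Suc (Suc x)) - f (Suc x) - (f (Suc x) - f x)\<bar> \<le> l / real H"
      using 0(3)[of x] H by auto
  qed (use 0(1) H in auto)
  also have "real (H-1) * (4 * (l / H) / l\<^sup>2) \<le> real H * (4 * (l / H) / l\<^sup>2)"
    using 0(1) by (intro mult_right_mono) auto
  also have "4 / l + real H * (4 * (l / H) / l\<^sup>2) = 8 / l" using 0(1) H by (simp add: field_simps power2_eq_square)
  also have "\<dots> = 8 * real H * (l * real H) powr (-1)" using 0(1) H by (simp add: powr_minus_divide)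
  finally show ?case using H by simp
next
  case (Suc j)
  define g :: real where "g = 1 / 4 ^ j"
  define h where "h = real H"
  define X where "X = l * h ^ Suc (Suc j)"
  have h1: "1 \<le> h" and X0: "0 < X" using H Suc(2) by (auto simp: h_def X_def)
  have g: "0 < g" "g \<le> 1" by (auto simp: g_def)
  have goal_eq: "1 / 4 ^ Suc j = g / 4" by (simp add: g_def)
  show ?case
  proof (cases "X \<le> 1")
    case True
    have "1 \<le> X powr (- (g/4))"
      using True X0 g powr_mono2'[of "-(g/4)" X 1] by simp
    hence "h ^ Suc (Suc j) * 1 \<le> h ^ Suc (Suc j) * (8 * X powr (- (g/4)))"
      using h1 by (intro mult_left_mono) auto
    thus ?thesis using norm_wsum_le[of "Suc (Suc j)" H f] unfolding goal_eq h_def X_def by (simp only: mult_ac mult_1_right)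
  next
    case False
    hence X1: "1 < X" by simp
    \<comment> \<open>This yields \<open>\<theta> * h >= 1\<close> below, the range in which close
      pairs can be counted.\<close>
    have XH: "X \<le> h"
    proof -
      have "X \<le> L * h ^ Suc (Suc j)" unfolding X_def
        using Suc(3)[of 0] h1 by (intro mult_right_mono) auto
      also have "\<dots> = (L * h ^ Suc j) * h" by simp
      also have "\<dots> \<le> 1 * h" using Suc(5) h1 by (intro mult_right_mono) (auto simp: h_def)
      finally show ?thesis by simp
    qed
    \<comment> \<open>With cutoff \<open>\<theta> * h\<close>, close pairs are a proportion
      O(\<open>X powr (-1/2)\<close>) and far pairs save
      \<open>(\<theta> * X) powr (- g) = X powr (- g/2)\<close>. As \<open>g <= 1\<close>, both are
      O(\<open>X powr (- g/2)\<close>); the square root at the end leaves \<open>g / 4\<close>,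
      hence the exponent \<open>1 / 4 ^ j\<close>.\<close>
    define \<theta> where "\<theta> = X powr (-1/2)"
    have th0: "0 < \<theta>" using X0 by (simp add: \<theta>_def)
    have th: "1 \<le> \<theta> * h"
    proof -
      have "X powr (1/2) \<le> X powr 1" using X1 by (intro powr_mono) auto
      hence "X powr (1/2) \<le> h" using XH X0 by simp
      hence "X powr (-1/2) * X powr (1/2) \<le> \<theta> * h" unfolding \<theta>_def using X0 by (intro mult_left_mono) auto
      thus ?thesis using X0 by (simp flip: powr_add)
    qed
    define B where "B = 8 * h ^ Suc j * X powr (- (g/2))"
    define P where "P = {(a,b). a \<in> {1..H} \<and> b \<in> {1..H} \<and> \<bar>real a - real b\<bar> < \<theta> * h}"
    have finP: "finite P" unfolding P_def by (rule finite_subset[of _ "{1..H} \<times> {1..H}"]) auto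
    have B0: "0 \<le> B" using h1 by (simp add: B_def)
    define w where "w a b = cmod (wsum (Suc j) H (\<lambda>x. f (x + a) - f (x + b)))" for a b
    have far1: "w a b \<le> B" if "b < a" "a \<le> H" "\<theta> * h \<le> real a - real b" for a b
    proof -
      have "w a b \<le> 8 * real H ^ Suc j * (real (a - b) * l * real H ^ Suc j) powr (- g)"
        unfolding w_def g_def by (rule norm_wsum_shift_diff_le[OF H Suc(2) that(1,2) Suc(3-5)])
           (assumption | rule Suc.IH)+
      also have "(real (a - b) * l * real H ^ Suc j) powr (- g) \<le> (\<theta> * X) powr (- g)"
      proof (rule powr_mono2')
        have "\<theta> * X = (\<theta> * h) * l * h ^ Suc j" by (simp add: X_def)
        also have "\<dots> \<le> real (a - b) * l * h ^ Suc j"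
          using that Suc(2) h1 by (intro mult_right_mono) auto
        finally show "\<theta> * X \<le> real (a - b) * l * real H ^ Suc j" by (simp add: h_def)
      qed (use g th0 X0 in auto)
      also have "\<theta> * X = X powr (1/2)" using X0 unfolding \<theta>_def
        by (simp add: powr_mult_base mult.commute)
      also have "(X powr (1/2)) powr (- g) = X powr (-(g/2))" by (simp add: powr_powr)
      finally show ?thesis using h1 by (simp add: B_def h_def)
    qed
    have far: "w a b \<le> B" if "a \<in> {1..H}" "b \<in> {1..H}" "\<theta> * h \<le> \<bar>real a - real b\<bar>" for a b
    proof (cases "b < a")
      case True thus ?thesis using far1[of b a] that by auto
    next
      case False
      moreover have "a \<noteq> b" using that th by auto
      ultimately have "w b a \<le> B" using far1[of a b] that by auto
      thus ?thesis unfolding w_def by (subst norm_wsum_diff_commute)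
    qed
    have "(cmod (wsum (Suc (Suc j)) H f))\<^sup>2 = (cmod (\<Sum>a\<in>{1..H}. wsum (Suc j) H (\<lambda>x. f (x + a))))\<^sup>2"
      by simp
    also have "\<dots> \<le> h ^ Suc j * Re (\<Sum>a\<in>{1..H}. \<Sum>b\<in>{1..H}. wsum (Suc j) H (\<lambda>x. f (x + a) - f (x + b)))"
      unfolding h_def by (rule norm_sum_wsum_sq_le) simp
    also have "\<dots> \<le> h ^ Suc j * (\<Sum>a\<in>{1..H}. \<Sum>b\<in>{1..H}. w a b)"
    proof (intro mult_left_mono)
      show "Re (\<Sum>a\<in>{1..H}. \<Sum>b\<in>{1..H}. wsum (Suc j) H (\<lambda>x. f (x + a) - f (x + b))) \<le> (\<Sum>a\<in>{1..H}. \<Sum>b\<in>{1..H}. w a b)"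
        unfolding Re_sum w_def by (intro sum_mono complex_Re_le_cmod)
    qed (use h1 in auto)
    also have "(\<Sum>a\<in>{1..H}. \<Sum>b\<in>{1..H}. w a b) = (\<Sum>(a,b)\<in>{1..H}\<times>{1..H}. w a b)"
      by (rule sum.cartesian_product)
    also have "\<dots> \<le> (\<Sum>(a,b)\<in>{1..H}\<times>{1..H}. B + (if (a,b) \<in> P then h ^ Suc j else 0))"
    proof (intro sum_mono, clarsimp simp del: power_Suc)
      fix a b :: nat assume ab: "Suc 0 \<le> a" "a \<le> H" "Suc 0 \<le> b" "b \<le> H"
      have "w a b \<le> h ^ Suc j" unfolding w_def h_def by (rule norm_wsum_le)
      thus "((a, b) \<in> P \<longrightarrow> w a b \<le> B + h ^ Suc j) \<and> ((a, b) \<notin> P \<longrightarrow> w a b \<le> B)"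
        using far[of a b] ab B0 by (auto simp: P_def)
    qed
    also have "\<dots> = h\<^sup>2 * B + real (card P) * h ^ Suc j"
    proof -
      have "P \<subseteq> {1..H} \<times> {1..H}" by (auto simp: P_def)
      hence "{1..H} \<times> {1..H} \<inter> P = P" by blast
      moreover have "(\<Sum>p\<in>{1..H}\<times>{1..H}. (if p \<in> P then h ^ Suc j else 0)) = real (card ({1..H} \<times> {1..H} \<inter> P)) * h ^ Suc j"
        by (simp add: sum.If_cases del: power_Suc)
      ultimately show ?thesis
        by (simp add: split_def sum.distrib power2_eq_square h_def del: power_Suc)
    qed
    also have "\<dots> \<le> h\<^sup>2 * B + (3 * (\<theta> * h) * h) * h ^ Suc j"
      using card_close_pairs_le[OF th, of H, folded P_def, folded h_def] h1
      by (intro add_left_mono mult_right_mono) auto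
    also have "\<dots> = h ^ 2 * h ^ Suc j * (8 * X powr (-(g/2)) + 3 * X powr (-1/2))"
      by (simp add: B_def \<theta>_def algebra_simps power2_eq_square)
    also have "\<dots> \<le> h ^ 2 * h ^ Suc j * (11 * X powr (-(g/2)))"
    proof (intro mult_left_mono)
      have "X powr (-1/2) \<le> X powr (-(g/2))" using X1 g by (intro powr_mono) auto
      thus "8 * X powr (-(g/2)) + 3 * X powr (-1/2) \<le> 11 * X powr (-(g/2))" by simp
    qed (use h1 in auto)
    finally have "(cmod (wsum (Suc (Suc j)) H f))\<^sup>2 \<le> h ^ Suc j * (h ^ 2 * h ^ Suc j * (11 * X powr (-(g/2))))"
      using h1 by (simp add: mult_left_mono del: power_Suc wsum.simps)
    \<comment> \<open>Enlarging 11 to \<open>64 = 8^2\<close> reproduces the constant 8 after the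
      square root and closes the induction.\<close>
    also have "\<dots> \<le> h ^ Suc j * (h ^ 2 * h ^ Suc j * (64 * X powr (-(g/2))))"
      using h1 by (intro mult_left_mono) auto
    also have "\<dots> = (8 * h ^ Suc (Suc j) * X powr (-(g/4)))\<^sup>2"
      by (simp add: power_mult_distrib power2_eq_square mult_ac flip: powr_add)
    finally have "cmod (wsum (Suc (Suc j)) H f) \<le> 8 * h ^ Suc (Suc j) * X powr (-(g/4))"
      by (rule power2_le_imp_le) (use h1 in auto)
    thus ?thesis unfolding goal_eq h_def X_def .
  qed
qed

section \<open>Finite differences of the logarithm and the amplifier sum\<close>

lemma fdiff_Suc': "fdiff (Suc j) f x = fdiff j (\<lambda>n. f (Suc n) - f n) x"
  using fdiff_diff[of j "\<lambda>n. f (n + 1)" f x] fdiff_shift[of j f 1 x] by simp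

text \<open>One application of the mean value theorem per difference. The induction carries the
  whole chain of derivatives and replaces \<open>F i\<close> by
  \<open>G i y = F i (y + 1) - F i y\<close>.\<close>

lemma fdiff_mean_value:
  fixes F :: "nat \<Rightarrow> real \<Rightarrow> real"
  assumes "\<And>i y. 0 \<le> y \<Longrightarrow> (F i has_real_derivative F (Suc i) y) (at y)"
  shows "\<exists>\<xi>. real x \<le> \<xi> \<and> \<xi> \<le> real (x + j) \<and> fdiff j (\<lambda>n. F 0 (real n)) x = F j \<xi>"
  using assms
proof (induction j arbitrary: F)
  case 0
  thus ?case by auto
next
  case (Suc j)
  define G where "G i y = F i (y + 1) - F i y" for i y
  have "(G i has_real_derivative G (Suc i) y) (at y)" if "0 \<le> y" for i y
  proof -
    have "(F i has_real_derivative F (Suc i) (y + 1)) (at (y + 1))" using that by (intro Suc.prems) auto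
    hence "((\<lambda>y. F i (y + 1)) has_real_derivative F (Suc i) (y + 1)) (at y)" by (simp add: DERIV_shift)
    thus ?thesis unfolding G_def using that by (intro DERIV_diff Suc.prems) auto
  qed
  from Suc.IH[of G, OF this] obtain \<xi> where \<xi>: "real x \<le> \<xi>" "\<xi> \<le> real (x + j)"
    "fdiff j (\<lambda>n. G 0 (real n)) x = G j \<xi>" by blast
  have "\<exists>z>\<xi>. z < \<xi> + 1 \<and> F j (\<xi> + 1) - F j \<xi> = (\<xi> + 1 - \<xi>) * F (Suc j) z"
    using \<xi>(1) by (intro MVT2 Suc.prems) auto
  then obtain z where z: "z > \<xi>" "z < \<xi> + 1" "G j \<xi> = F (Suc j) z" by (auto simp: G_def)
  have "fdiff (Suc j) (\<lambda>n. F 0 (real n)) x = fdiff j (\<lambda>n. G 0 (real n)) x"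
    unfolding fdiff_Suc' G_def by (simp add: add.commute)
  thus ?case using \<xi> z by (intro exI[of _ z]) auto
qed

definition ln_deriv :: "real \<Rightarrow> nat \<Rightarrow> real \<Rightarrow> real" where
  "ln_deriv z i y = (case i of 0 \<Rightarrow> ln (z + y) | Suc j \<Rightarrow> (-1) ^ j * fact j / (z + y) ^ Suc j)"

lemma ln_deriv_deriv:
  assumes "0 < z" "0 \<le> y"
  shows "((\<lambda>y. c * ln_deriv z i y) has_real_derivative c * ln_deriv z (Suc i) y) (at y)"
proof (cases i)
  case 0
  thus ?thesis using assms by (auto simp: ln_deriv_def intro!: derivative_eq_intros)
next
  case (Suc j)
  have nz: "z + y \<noteq> 0" using assms by simp
  have "((\<lambda>y. c * ((-1) ^ j * fact j * inverse ((z + y) ^ Suc j))) has_real_derivative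
     c * ((-1) ^ j * fact j * (- (inverse ((z + y) ^ Suc j) * (real (Suc j) * (z + y) ^ j) * inverse ((z + y) ^ Suc j))))) (at y)"
    by (intro DERIV_cmult, rule DERIV_inverse') (use nz in \<open>auto intro!: derivative_eq_intros simp del: power_Suc\<close>)
  moreover have "c * ((-1) ^ j * fact j * (- (inverse ((z + y) ^ Suc j) * (real (Suc j) * (z + y) ^ j) * inverse ((z + y) ^ Suc j))))
     = c * ((-1) ^ Suc j * fact (Suc j) / (z + y) ^ Suc (Suc j))"
  proof -
    define w where "w = z + y"
    show ?thesis using nz unfolding w_def[symmetric] by (simp add: field_simps)
  qed
  ultimately show ?thesis unfolding ln_deriv_def Suc by (simp add: divide_inverse mult.assoc del: power_Suc)
qed

lemma fdiff_ln:
  assumes "0 < z"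
  obtains \<xi> where "z + real x \<le> \<xi>" "\<xi> \<le> z + real (x + Suc j)"
    "fdiff (Suc j) (\<lambda>n. c * ln (z + real n)) x = c * ((-1) ^ j * fact j / \<xi> ^ Suc j)"
proof -
  have "\<exists>\<xi>. real x \<le> \<xi> \<and> \<xi> \<le> real (x + Suc j) \<and> fdiff (Suc j) (\<lambda>n. c * ln_deriv z 0 (real n)) x = c * ln_deriv z (Suc j) \<xi>"
    by (rule fdiff_mean_value[of "\<lambda>i y. c * ln_deriv z i y"]) (rule ln_deriv_deriv[OF assms])
  then obtain \<xi> where "real x \<le> \<xi>" "\<xi> \<le> real (x + Suc j)"
     "fdiff (Suc j) (\<lambda>n. c * ln (z + real n)) x = c * ((-1) ^ j * fact j / (z + \<xi>) ^ Suc j)"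
    by (auto simp: ln_deriv_def)
  thus ?thesis by (intro that[of "z + \<xi>"]) auto
qed

text \<open>The mean value theorem gives every difference of the logarithm an explicit size, so the
  hypotheses of the Weyl bound become numerical: \<open>up\<close> keeps increments below 1 after
  \<open>j\<close> differencings, and \<open>sm\<close> makes the difference of the next order
  smaller by a factor \<open>H\<close> than the lower bound \<open>l\<close>. The powers of 2 allow
  for arguments anywhere in \<open>[N, 2 * N]\<close>.\<close>

lemma norm_wsum_ln_le:
  fixes t z :: real
  assumes H: "H \<ge> 1" and t: "0 < t" and N: "0 < N" "N \<le> z" "z + real (Suc (Suc j) * H + Suc (Suc j)) \<le> 2 * N"
    and up: "t * fact j * real H ^ j \<le> N ^ Suc j"
    and sm: "real (Suc j) * 2 ^ Suc j * real H \<le> N"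
  shows "cmod (wsum (Suc j) H (\<lambda>x. t * ln (z + real x)))
    \<le> 8 * real H ^ Suc j * (t * (real H / (2 * N)) ^ Suc j) powr (- (1 / 4 ^ j))"
proof -
  \<comment> \<open>This sign makes the difference of order \<open>j + 1\<close> positive. For odd
    \<open>j\<close> it conjugates the sum, which leaves the modulus unchanged.\<close>
  define c where "c = (-1) ^ j * t"
  define f where "f x = c * ln (z + real x)" for x :: nat
  define l where "l = t * fact j / (2 * N) ^ Suc j"
  define L where "L = t * fact j / N ^ Suc j"
  have cabs: "c * ((-1) ^ j * y) = t * y" for y by (simp add: c_def flip: power_add mult_2)
  have z0: "0 < z" using N(1,2) by linarith
  note N1 = N(1)
  have l0: "0 < l" using t N1 by (simp add: l_def)
  have eq: "cmod (wsum (Suc j) H (\<lambda>x. t * ln (z + real x))) = cmod (wsum (Suc j) H f)"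
  proof (cases "even j")
    case True thus ?thesis by (simp add: f_def[abs_def] c_def)
  next
    case False
    hence "f = (\<lambda>x. - (t * ln (z + real x)))" by (simp add: f_def[abs_def] c_def)
    thus ?thesis using wsum_uminus[of "Suc j" H "\<lambda>x. t * ln (z + real x)"] by (simp del: wsum.simps)
  qed
  have rng: "real (x + Suc (Suc j)) \<le> real (Suc (Suc j) * H + Suc (Suc j))" if "x \<le> Suc j * H" for x
    unfolding of_nat_le_iff using that by simp
  have "cmod (wsum (Suc j) H f) \<le> 8 * real H ^ Suc j * (l * real H ^ Suc j) powr (- (1 / 4 ^ j))"
  proof (rule norm_wsum_weyl[OF H l0])
    fix x assume x: "x \<le> Suc j * H"
    obtain \<xi> where \<xi>: "z + real x \<le> \<xi>" "\<xi> \<le> z + real (x + Suc j)"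
      "fdiff (Suc j) f x = c * ((-1) ^ j * fact j / \<xi> ^ Suc j)"
      unfolding f_def[abs_def] using fdiff_ln[OF z0] by metis
    have x1: "N \<le> \<xi>" "\<xi> \<le> 2 * N" using \<xi> N rng[OF x] by auto
    have e: "fdiff (Suc j) f x = t * (fact j / \<xi> ^ Suc j)" using \<xi>(3) cabs[of "fact j / \<xi> ^ Suc j"] by (simp del: fdiff.simps)
    have "t * (fact j / (2 * N) ^ Suc j) \<le> t * (fact j / \<xi> ^ Suc j)"
      using t x1 N1 by (intro mult_left_mono divide_left_mono power_mono) auto
    moreover have "t * (fact j / \<xi> ^ Suc j) \<le> t * (fact j / N ^ Suc j)"
      using t x1 N1 by (intro mult_left_mono divide_left_mono power_mono) auto
    ultimately show "l \<le> fdiff (Suc j) f x \<and> fdiff (Suc j) f x \<le> L" unfolding e l_def L_def by simp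
    obtain \<eta> where \<eta>: "z + real x \<le> \<eta>" "\<eta> \<le> z + real (x + Suc (Suc j))"
      "fdiff (Suc (Suc j)) f x = c * ((-1) ^ Suc j * fact (Suc j) / \<eta> ^ Suc (Suc j))"
      unfolding f_def[abs_def] using fdiff_ln[OF z0] by metis
    have x2: "N \<le> \<eta>" using \<eta> N by auto
    have "\<bar>fdiff (Suc (Suc j)) f x\<bar> = t * (fact (Suc j) / \<eta> ^ Suc (Suc j))"
      unfolding \<eta>(3) using t x2 N1 by (simp add: c_def abs_mult power_abs)
    also have "\<dots> \<le> t * (fact (Suc j) / N ^ Suc (Suc j))"
      using t x2 N1 by (intro mult_left_mono divide_left_mono power_mono) auto
    also have "\<dots> = (t * fact j / N ^ Suc j) * (real (Suc j) / N)" by (simp add: field_simps)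
    also have "\<dots> \<le> (t * fact j / N ^ Suc j) * (1 / (2 ^ Suc j * real H))"
    proof (rule mult_left_mono)
      show "real (Suc j) / N \<le> 1 / (2 ^ Suc j * real H)"
        using sm N1 H by (simp add: field_simps)
    qed (use t N1 in auto)
    also have "\<dots> = l / real H" unfolding l_def power_mult_distrib by simp
    finally show "\<bar>fdiff (Suc (Suc j)) f x\<bar> \<le> l / real H" .
  next
    show "L * real H ^ j \<le> 1" using up N1 by (simp add: L_def)
  qed
  also have "(l * real H ^ Suc j) powr (- (1 / 4 ^ j)) \<le> (t * (real H / (2 * N)) ^ Suc j) powr (- (1 / 4 ^ j))"
  proof (rule powr_mono2')
    have "t * 1 \<le> t * fact j" using t by (intro mult_left_mono) auto
    hence "t * (real H / (2 * N)) ^ Suc j \<le> t * fact j * (real H / (2 * N)) ^ Suc j"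
      using N1 by (intro mult_right_mono) auto
    thus "t * (real H / (2 * N)) ^ Suc j \<le> l * real H ^ Suc j" by (simp add: l_def power_divide)
  qed (use t N1 H in auto)
  finally show ?thesis unfolding eq by (simp add: mult_left_mono)
qed

text \<open>Freezes \<open>d\<close> of the variables as a shift \<open>y <= d * H\<close> and sums
  trivially over them. Thus one fixed amplifier with \<open>J\<close> variables can use whichever
  Weyl order suits the size of \<open>t\<close>.\<close>

lemma norm_wsum_extend:
  assumes "\<And>y. y \<le> d * H \<Longrightarrow> cmod (wsum j H (\<lambda>x. f (x + y))) \<le> B"
  shows "cmod (wsum (d + j) H f) \<le> real H ^ d * B"
  using assms
proof (induction d arbitrary: f)
  case 0
  thus ?case using 0[of 0] by simp
next
  case (Suc d)
  have "cmod (wsum (Suc d + j) H f) \<le> (\<Sum>v\<in>{1..H}. cmod (wsum (d + j) H (\<lambda>x. f (x + v))))"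
    by (simp add: norm_sum)
  also have "\<dots> \<le> (\<Sum>v\<in>{1..H}. real H ^ d * B)"
  proof (intro sum_mono Suc.IH)
    fix v y assume v: "v \<in> {1..H}" and y: "y \<le> d * H"
    show "cmod (wsum j H (\<lambda>x. f (x + y + v))) \<le> B"
      using Suc.prems[of "y + v"] v y by (simp add: add.assoc)
  qed
  finally show ?case by simp
qed

text \<open>For \<open>1 <= t <= T\<close> the increments of \<open>t * ln n\<close> lie between
  \<open>t / (3 * T)\<close> and \<open>t / T <= 1\<close> and change by at most
  \<open>t / T^2\<close> per step. The Kusmin-Landau bound then gives
  \<open>12 * T / t + 36 * T / t\<close>; negative \<open>t\<close> follows by conjugation.\<close>

lemma norm_sum_cis_ln_le:
  assumes T: "T \<ge> 1" and t: "1 \<le> \<bar>t\<bar>" "\<bar>t\<bar> \<le> real T"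
  shows "cmod (\<Sum>n\<in>{T<..2*T}. cis (t * ln (real n))) \<le> 48 * real T / \<bar>t\<bar>"
proof -
  have main: "cmod (\<Sum>n\<in>{T<..2*T}. cis (t * ln (real n))) \<le> 48 * real T / t" if t: "1 \<le> t" "t \<le> real T" for t
  proof -
    define f where "f x = t * ln (0 + real x)" for x
    define T' where "T' = real T"
    have T1: "1 \<le> T'" using T by (simp add: T'_def)
    have f1: "\<exists>\<xi>. real x \<le> \<xi> \<and> \<xi> \<le> real x + 1 \<and> f (Suc x) - f x = t / \<xi>" if "x \<ge> 1" for x
    proof -
      obtain \<xi> where "1 + real (x - 1) \<le> \<xi>" "\<xi> \<le> 1 + real (x - 1 + Suc 0)"
        "fdiff (Suc 0) (\<lambda>n. t * ln (1 + real n)) (x - 1) = t * ((-1) ^ 0 * fact 0 / \<xi> ^ Suc 0)"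
        using fdiff_ln[of 1] by (metis zero_less_one)
      thus ?thesis using that unfolding f_def by (intro exI[of _ \<xi>]) (auto simp: of_nat_diff)
    qed
    have f2: "\<exists>\<xi>. real x \<le> \<xi> \<and> f (Suc (Suc x)) - f (Suc x) - (f (Suc x) - f x) = - (t / \<xi>^2)" if "x \<ge> 1" for x
    proof -
      obtain \<xi> where "1 + real (x - 1) \<le> \<xi>" "\<xi> \<le> 1 + real (x - 1 + Suc (Suc 0))"
        "fdiff (Suc (Suc 0)) (\<lambda>n. t * ln (1 + real n)) (x - 1) = t * ((-1) ^ Suc 0 * fact (Suc 0) / \<xi> ^ Suc (Suc 0))"
        using fdiff_ln[of 1] by (metis zero_less_one)
      thus ?thesis using that unfolding f_def by (intro exI[of _ \<xi>]) (auto simp: of_nat_diff power2_eq_square)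
    qed
    have "cmod (\<Sum>x\<in>{Suc T..Suc T+(T-1)}. cis (f x)) \<le> 4 / (t / (3 * T')) + real (T - 1) * (4 * (t / T'^2) / (t / (3 * T'))\<^sup>2)"
    proof (rule norm_sum_cis_le)
      fix x assume x: "x \<in> {Suc T..Suc T + (T - 1)}"
      then obtain \<xi> where \<xi>: "real x \<le> \<xi>" "\<xi> \<le> real x + 1" "f (Suc x) - f x = t / \<xi>" using f1[of x] by auto
      have "T' \<le> real x" "real x \<le> 2 * T'" using x T unfolding T'_def by auto
      hence x2: "T' \<le> \<xi>" "\<xi> \<le> 3 * T'" using \<xi> T1 by auto
      have "t / (3 * T') \<le> t / \<xi>" using x2 t T1 by (intro divide_left_mono) auto
      moreover have "t / \<xi> \<le> 1" using x2 t T1 by (auto simp: T'_def)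
      ultimately show "t / (3 * T') \<le> f (Suc x) - f x \<and> f (Suc x) - f x \<le> 1" unfolding \<xi>(3) by simp
    next
      fix x assume x: "x \<in> {Suc T..<Suc T + (T - 1)}"
      then obtain \<xi> where \<xi>: "real x \<le> \<xi>" "f (Suc (Suc x)) - f (Suc x) - (f (Suc x) - f x) = - (t / \<xi>^2)" using f2[of x] by auto
      have "T' \<le> real x" using x T unfolding T'_def by auto
      hence x2: "T' \<le> \<xi>" using \<xi> by auto
      have "t / \<xi>^2 \<le> t / T'^2" using x2 t T1 by (intro divide_left_mono power_mono) auto
      thus "\<bar>f (Suc (Suc x)) - f (Suc x) - (f (Suc x) - f x)\<bar> \<le> t / T'^2" unfolding \<xi>(2) using t by auto
    qed (use t T1 in auto)
    also have "real (T - 1) * (4 * (t / T'^2) / (t / (3 * T'))\<^sup>2) \<le> T' * (4 * (t / T'^2) / (t / (3 * T'))\<^sup>2)"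
      using t by (intro mult_right_mono) (auto simp: T'_def)
    also have "4 / (t / (3 * T')) + T' * (4 * (t / T'^2) / (t / (3 * T'))\<^sup>2) = 48 * T' / t"
      using t T1 by (simp add: field_simps power2_eq_square)
    also have "{Suc T..Suc T+(T-1)} = {T<..2*T}" using T by auto
    finally show ?thesis by (simp add: f_def T'_def)
  qed
  show ?thesis
  proof (cases "t \<ge> 0")
    case True thus ?thesis using main[of t] t by simp
  next
    case False
    have "(\<Sum>n\<in>{T<..2*T}. cis (t * ln (real n))) = cnj (\<Sum>n\<in>{T<..2*T}. cis ((-t) * ln (real n)))"
      by (simp add: cis_cnj)
    hence "cmod (\<Sum>n\<in>{T<..2*T}. cis (t * ln (real n))) = cmod (\<Sum>n\<in>{T<..2*T}. cis ((-t) * ln (real n)))"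
      by (simp only: complex_mod_cnj)
    thus ?thesis using main[of "-t"] t False by simp
  qed
qed

text \<open>Slices the frequencies so that a single Weyl order serves each slice; the ratio
  \<open>k^2\<close> of its endpoints is \<open>N / H\<close> for the parameters in use.\<close>

lemma odd_power_range:
  fixes k t :: real
  assumes "k ^ 3 \<le> t" "t \<le> k ^ (2 * J + 3)" "J \<ge> 1"
  shows "\<exists>j<J. k ^ (2 * j + 3) \<le> t \<and> t \<le> k ^ (2 * j + 5)"
  using assms(3,2)
proof (induction J rule: dec_induct)
  case base
  thus ?case using assms by (intro exI[of _ 0]) (auto simp: eval_nat_numeral)
next
  case (step J)
  show ?case
  proof (cases "t \<le> k ^ (2 * J + 3)")
    case True
    then obtain j where "j < J" "k ^ (2 * j + 3) \<le> t \<and> t \<le> k ^ (2 * j + 5)" using step by blast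
    thus ?thesis using less_SucI by blast
  next
    case False
    thus ?thesis using step.prems by (intro exI[of _ J]) (auto simp: algebra_simps)
  qed
qed

lemma norm_wsum_uminus_mult: "cmod (wsum j H (\<lambda>x. (- t) * g x)) = cmod (wsum j H (\<lambda>x. t * g x))"
  using wsum_uminus[of j H "\<lambda>x. t * g x"] by simp

text \<open>On the slice \<open>k^(2j+3) <= |t| <= k^(2j+5)\<close> the quantity
  \<open>|t| * (H / N)^(j+1)\<close> is at least \<open>k\<close>, the source of the saving, while
  \<open>|t| * H^j <= k^(6j+5)\<close> leaves one factor \<open>k\<close> below
  \<open>N^(j+1)\<close> to absorb \<open>fact j\<close>. The threshold on \<open>k\<close> absorbs
  the other constants depending on \<open>J\<close>; the exponent is that of the worst
  order.\<close>

lemma norm_wsum_ln_power_saving: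
  assumes J: "J \<ge> 1"
  shows "\<exists>C>0. \<forall>k::nat. \<forall>t. k \<ge> fact J + (J + 1) * 2 ^ (J + 1) \<longrightarrow>
     real k ^ 3 \<le> \<bar>t\<bar> \<longrightarrow> \<bar>t\<bar> \<le> real k ^ (2 * J + 3) \<longrightarrow>
     cmod (wsum J (k ^ 4) (\<lambda>x. t * ln (real (k ^ 6) + real x))) \<le> C * real (k ^ 4) ^ J * real k powr (- (1 / 4 ^ J))"
proof (intro exI[of _ "8 * (2 ^ J) powr (1 / 4 ^ J)"] conjI allI impI)
  show "0 < 8 * (2 ^ J :: real) powr (1 / 4 ^ J)" by simp
next
  fix k :: nat and t :: real
  assume k0: "k \<ge> fact J + (J + 1) * 2 ^ (J + 1)" and t: "real k ^ 3 \<le> \<bar>t\<bar>" "\<bar>t\<bar> \<le> real k ^ (2 * J + 3)"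
  have kf: "fact J \<le> k" and k2: "(J + 1) * 2 ^ (J + 1) \<le> k" using k0 by linarith+
  have k1: "1 \<le> k" using kf fact_ge_1[of J, where 'a = nat] by linarith
  obtain j where j: "j < J" "real k ^ (2 * j + 3) \<le> \<bar>t\<bar>" "\<bar>t\<bar> \<le> real k ^ (2 * j + 5)"
    using odd_power_range[OF t J] by blast
  define d where "d = J - Suc j"
  have dJ: "d + Suc j = J" using j by (simp add: d_def)
  define H where "H = k ^ 4"
  define N where "N = real k ^ 6"
  have kp: "0 < real k" using k1 by simp
  have H1: "1 \<le> H" using k1 by (simp add: H_def)
  have N0: "0 < N" using kp by (simp add: N_def)
  have t0: "0 < \<bar>t\<bar>" using j(2) kp by (meson less_le_trans zero_less_power)
  have "k \<le> k * k" using k1 by simp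
  have "(J + 1) * 2 ^ 1 \<le> (J + 1) * 2 ^ (J + 1)" by (intro mult_left_mono power_increasing) auto
  hence "2 * (J + 1) \<le> (J + 1) * 2 ^ (J + 1)" by (simp add: mult.commute)
  hence kJ: "2 * (J + 1) \<le> k ^ 2" using k2 \<open>k \<le> k * k\<close> unfolding power2_eq_square by linarith
  have sz: "(J + 1) * H + (J + 1) \<le> k ^ 6"
  proof -
    have "(J + 1) * H + (J + 1) \<le> (J + 1) * H + (J + 1) * H"
      using mult_le_mono2[OF H1, of "J + 1"] by (simp only: mult_1_right add_le_cancel_left)
    also have "\<dots> = (2 * (J + 1)) * k ^ 4" by (simp add: H_def algebra_simps)
    also have "\<dots> \<le> k ^ 2 * k ^ 4" using kJ by (rule mult_right_mono) simp
    also have "\<dots> = k ^ 6" by (simp flip: power_add)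
    finally show ?thesis .
  qed
  have bnd: "cmod (wsum (Suc j) H (\<lambda>x. \<bar>t\<bar> * ln (N + real (x + y)))) \<le>
      8 * real H ^ Suc j * (real k / 2 ^ J) powr (- (1 / 4 ^ J))" if y: "y \<le> d * H" for y
  proof -
    have "cmod (wsum (Suc j) H (\<lambda>x. \<bar>t\<bar> * ln ((N + real y) + real x))) \<le>
        8 * real H ^ Suc j * (\<bar>t\<bar> * (real H / (2 * N)) ^ Suc j) powr (- (1 / 4 ^ j))"
    proof (rule norm_wsum_ln_le[OF H1 t0 N0])
      show "N \<le> N + real y" by simp
      have "y + (Suc (Suc j) * H + Suc (Suc j)) \<le> d * H + (Suc (Suc j) * H + Suc (Suc j))" using y by simp
      also have "\<dots> = (J + 1) * H + Suc (Suc j)" using dJ[symmetric] by (simp add: algebra_simps)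
      also have "\<dots> \<le> (J + 1) * H + (J + 1)" using j by simp
      also have "\<dots> \<le> k ^ 6" by (rule sz)
      finally have "real (y + (Suc (Suc j) * H + Suc (Suc j))) \<le> real (k ^ 6)" unfolding of_nat_le_iff .
      thus "N + real y + real (Suc (Suc j) * H + Suc (Suc j)) \<le> 2 * N" by (simp add: N_def)
      have "fact j \<le> (fact J :: nat)" using j by (intro fact_mono) auto
      hence "(fact j :: nat) \<le> k" using kf by linarith
      hence fj: "fact j \<le> real k" by (metis of_nat_fact of_nat_le_iff)
      have "\<bar>t\<bar> * fact j * real H ^ j \<le> real k ^ (2 * j + 5) * real k * real H ^ j"
        using j(3) fj by (intro mult_right_mono mult_mono) auto
      also have "\<dots> = real k ^ (2 * j + 5 + 1 + 4 * j)"
        by (simp only: H_def of_nat_power power_add power_mult power_one_right)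
      also have "2 * j + 5 + 1 + 4 * j = 6 * Suc j" by simp
      finally show "\<bar>t\<bar> * fact j * real H ^ j \<le> N ^ Suc j" by (simp only: N_def power_mult)
      have "Suc j * 2 ^ Suc j \<le> (J + 1) * 2 ^ (J + 1)" using j by (intro mult_mono power_increasing) auto
      hence "Suc j * 2 ^ Suc j \<le> k ^ 2" using k2 \<open>k \<le> k * k\<close> unfolding power2_eq_square by linarith
      hence "Suc j * 2 ^ Suc j * k ^ 4 \<le> k ^ 2 * k ^ 4" by (rule mult_right_mono) simp
      also have "\<dots> = k ^ 6" by (simp flip: power_add)
      finally have "real (Suc j * 2 ^ Suc j * k ^ 4) \<le> real (k ^ 6)" unfolding of_nat_le_iff .
      thus "real (Suc j) * 2 ^ Suc j * real H \<le> N" by (simp only: N_def H_def of_nat_mult of_nat_power of_nat_numeral)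
    qed
    also have "(\<bar>t\<bar> * (real H / (2 * N)) ^ Suc j) powr (- (1 / 4 ^ j)) \<le> (real k / 2 ^ J) powr (- (1 / 4 ^ j))"
    proof (rule powr_mono2')
      have "real H / (2 * N) = 1 / (2 * real k ^ 2)" using kp by (simp add: H_def N_def field_simps flip: power_add)
      hence e: "(real H / (2 * N)) ^ Suc j = 1 / (2 ^ Suc j * real k ^ (2 * Suc j))"
        by (simp only: power_divide power_one power_mult_distrib power_mult)
      have "real k / 2 ^ J \<le> real k / 2 ^ Suc j" using j by (intro divide_left_mono power_increasing) auto
      also have "\<dots> = real k ^ (2 * j + 3) * (1 / (2 ^ Suc j * real k ^ (2 * Suc j)))"
        using kp by (simp add: field_simps power_add eval_nat_numeral)
      also have "\<dots> \<le> \<bar>t\<bar> * (1 / (2 ^ Suc j * real k ^ (2 * Suc j)))"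
        using j(2) by (intro mult_right_mono) auto
      finally show "real k / 2 ^ J \<le> \<bar>t\<bar> * (real H / (2 * N)) ^ Suc j" unfolding e .
    qed (use kp in auto)
    also have "(real k / 2 ^ J) powr (- (1 / 4 ^ j)) \<le> (real k / 2 ^ J) powr (- (1 / 4 ^ J))"
    proof (rule powr_mono)
      have "2 ^ J \<le> (J + 1) * 2 ^ (J + 1)" by simp
      hence "2 ^ J \<le> k" using k2 by linarith
      hence "real (2 ^ J) \<le> real k" unfolding of_nat_le_iff .
      thus "1 \<le> real k / 2 ^ J" by simp
      show "- (1 / 4 ^ j) \<le> - (1 / 4 ^ J :: real)" using j by (simp add: power_increasing frac_le)
    qed
    finally show ?thesis by (simp add: add_ac mult_left_mono)
  qed
  have "cmod (wsum J H (\<lambda>x. t * ln (N + real x))) = cmod (wsum J H (\<lambda>x. \<bar>t\<bar> * ln (N + real x)))"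
    using norm_wsum_uminus_mult[of J H t "\<lambda>x. ln (N + real x)"] by (cases "t \<ge> 0") auto
  also have "\<dots> \<le> real H ^ d * (8 * real H ^ Suc j * (real k / 2 ^ J) powr (- (1 / 4 ^ J)))"
    using norm_wsum_extend[of d H "Suc j", OF bnd] unfolding dJ .
  also have "\<dots> = 8 * real H ^ (d + Suc j) * (real k / 2 ^ J) powr (- (1 / 4 ^ J))"
    by (simp add: power_add mult_ac)
  also have "(real k / 2 ^ J) powr (- (1 / 4 ^ J)) = (2 ^ J) powr (1 / 4 ^ J) * real k powr (- (1 / 4 ^ J))"
    using kp by (simp add: powr_divide powr_minus field_simps)
  finally show "cmod (wsum J (k ^ 4) (\<lambda>x. t * ln (real (k ^ 6) + real x)))
      \<le> 8 * (2 ^ J) powr (1 / 4 ^ J) * real (k ^ 4) ^ J * real k powr (- (1 / 4 ^ J))"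
    unfolding dJ H_def N_def by (simp add: mult_ac)
qed

section \<open>Gaussian mixtures\<close>

text \<open>The characteristic function of the standard normal law, rescaled by
  \<open>sqrt (2 * a)\<close>.\<close>

lemma integral_gaussian_cos:
  fixes a x :: real
  assumes a: "0 < a"
  shows "has_bochner_integral lborel (\<lambda>t. exp (- (a * t\<^sup>2)) * cos (t * x)) (sqrt (pi / a) * exp (- (x\<^sup>2 / (4 * a))))"
proof -
  have ch: "has_bochner_integral lborel (\<lambda>u. std_normal_density u * cos (z * u)) (exp (- (z\<^sup>2) / 2))" for z
  proof -
    have int: "integrable lborel (\<lambda>u. std_normal_density u * cos (z * u))"
      by (rule Bochner_Integration.integrable_bound[of _ std_normal_density])
         (auto simp: abs_mult intro!: mult_left_le)
    have "complex_of_real (exp (- (z^2) / 2)) = (CLINT u|std_normal_distribution. iexp (z * u))"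
      using char_std_normal_distribution by (metis (no_types, lifting) char_def)
    also have "\<dots> = (CLINT u|lborel. std_normal_density u *\<^sub>R iexp (z * u))"
      by (subst integral_density) auto
    finally have "exp (- (z^2) / 2) = Re (CLINT u|lborel. std_normal_density u *\<^sub>R iexp (z * u))"
      by (metis Re_complex_of_real)
    also have "\<dots> = (\<integral>u. Re (std_normal_density u *\<^sub>R iexp (z * u)) \<partial>lborel)"
    proof (rule integral_Re[symmetric])
      show "complex_integrable lborel (\<lambda>u. std_normal_density u *\<^sub>R iexp (z * u))"
        by (rule Bochner_Integration.integrable_bound[of _ std_normal_density]) auto
    qed
    also have "\<dots> = (\<integral>u. std_normal_density u * cos (z * u) \<partial>lborel)" by (simp add: Re_exp)
    finally show ?thesis using int by (simp add: has_bochner_integral_iff)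
  qed
  define c where "c = sqrt (2 * a)"
  have c: "0 < c" "c\<^sup>2 = 2 * a" using a by (auto simp: c_def)
  have "has_bochner_integral lborel (\<lambda>t. std_normal_density (0 + c * t) * cos (x / c * (0 + c * t))) (exp (- ((x/c)\<^sup>2) / 2) /\<^sub>R \<bar>c\<bar>)"
    by (rule lborel_has_bochner_integral_real_affine_iff[THEN iffD1, OF _ ch]) (use c in auto)
  hence "has_bochner_integral lborel (\<lambda>t. sqrt (2 * pi) * (std_normal_density (0 + c * t) * cos (x / c * (0 + c * t)))) (sqrt (2 * pi) * (exp (- ((x/c)\<^sup>2) / 2) /\<^sub>R \<bar>c\<bar>))"
    by (rule has_bochner_integral_mult_right)
  moreover have "sqrt (2 * pi) * (std_normal_density (0 + c * t) * cos (x / c * (0 + c * t))) = exp (- (a * t\<^sup>2)) * cos (t * x)" for t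
    using c by (simp add: std_normal_density_def power_mult_distrib mult_ac)
  moreover have "sqrt (2 * pi) * (exp (- ((x/c)\<^sup>2) / 2) /\<^sub>R \<bar>c\<bar>) = sqrt (pi / a) * exp (- (x\<^sup>2 / (4 * a)))"
  proof -
    have "sqrt (2 * pi) / c = sqrt (pi / a)" unfolding c_def by (simp flip: real_sqrt_divide)
    moreover have "- ((x/c)\<^sup>2) / 2 = - (x\<^sup>2 / (4 * a))" by (simp add: power_divide c)
    moreover have "sqrt (2 * pi) * (E /\<^sub>R \<bar>c\<bar>) = (sqrt (2 * pi) / c) * E" for E :: real
      using c(1) by (simp add: field_simps)
    ultimately show ?thesis by (simp only:)
  qed
  ultimately show ?thesis by simp
qed

text \<open>The convolution of two centred normal laws, evaluated at \<open>x - x'\<close> after a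
  translation.\<close>

lemma integral_normal_density_mult:
  assumes s: "0 < \<sigma>" "0 < \<tau>"
  shows "has_bochner_integral lborel (\<lambda>y. normal_density x \<sigma> y * normal_density x' \<tau> y)
    (normal_density 0 (sqrt (\<sigma>\<^sup>2 + \<tau>\<^sup>2)) (x - x'))"
proof (rule has_bochner_integral_nn_integral)
  have "(\<integral>\<^sup>+y. ennreal (normal_density 0 \<sigma> ((x - x') - y) * normal_density 0 \<tau> y) \<partial>lborel) =
      ennreal (normal_density 0 (sqrt (\<sigma>\<^sup>2 + \<tau>\<^sup>2)) (x - x'))"
    by (rule fun_cong[OF conv_normal_density_zero_mean[OF s]])
  moreover have "(\<integral>\<^sup>+y. ennreal (normal_density 0 \<sigma> ((x - x') - y) * normal_density 0 \<tau> y) \<partial>lborel)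
     = (\<integral>\<^sup>+y. ennreal (normal_density 0 \<sigma> ((x - x') - (- x' + 1 * y)) * normal_density 0 \<tau> (- x' + 1 * y)) \<partial>lborel)"
    by (subst nn_integral_real_affine[of _ 1 "-x'"]) auto
  moreover have "normal_density 0 \<sigma> ((x - x') - (- x' + 1 * y)) * normal_density 0 \<tau> (- x' + 1 * y)
     = normal_density x \<sigma> y * normal_density x' \<tau> y" for y
    by (simp add: normal_density_def power2_commute)
  ultimately show "(\<integral>\<^sup>+y. ennreal (normal_density x \<sigma> y * normal_density x' \<tau> y) \<partial>lborel) =
      ennreal (normal_density 0 (sqrt (\<sigma>\<^sup>2 + \<tau>\<^sup>2)) (x - x'))" by simp
qed auto

lemma integral_gaussian_cos_normal_density:
  assumes s: "0 < s"
  shows "has_bochner_integral lborel (\<lambda>t. exp (- (s / 2 * t\<^sup>2)) * cos (t * x)) (2 * pi * normal_density 0 (sqrt s) x)"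
proof -
  have "sqrt (pi / (s / 2)) = 2 * pi / sqrt (2 * pi * s)"
  proof -
    have "sqrt (pi / (s / 2)) = sqrt ((2 * pi)^2 / (2 * pi * s))"
      using s by (simp add: field_simps power2_eq_square)
    also have "\<dots> = 2 * pi / sqrt (2 * pi * s)" unfolding real_sqrt_divide real_sqrt_abs by simp
    finally show ?thesis .
  qed
  thus ?thesis using integral_gaussian_cos[of "s/2" x] s by (simp add: normal_density_def)
qed

lemma norm_sum_cis_sq_cos:
  assumes "finite A"
  shows "(cmod (\<Sum>a\<in>A. cis (f a)))\<^sup>2 = (\<Sum>a\<in>A. \<Sum>b\<in>A. cos (f a - f b))"
  using arg_cong[OF norm_sum_cis_sq[OF assms, of f], of Re] by simp

text \<open>For finite mixtures Plancherel is a finite computation: both squares expand over pairs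
  \<open>(v, w)\<close>, and the overlap of two Gaussians and the Fourier integral of the product of
  their transforms are, up to \<open>2 * pi\<close>, the same normal density at
  \<open>x v - x w\<close>. The existential \<open>V\<close> delivers integrability and value
  together.\<close>

lemma gaussian_mixture_plancherel:
  fixes x :: "'a \<Rightarrow> real"
  assumes fin: "finite \<Omega>" and pos: "0 < \<delta>" "0 < \<Delta>"
  shows "\<exists>V. has_bochner_integral lborel (\<lambda>y. (\<Sum>w\<in>\<Omega>. normal_density (x w) \<delta> y - normal_density (x w) \<Delta> y)\<^sup>2) V \<and>
    has_bochner_integral lborel (\<lambda>t. (exp (- (\<delta>\<^sup>2 * t\<^sup>2 / 2)) - exp (- (\<Delta>\<^sup>2 * t\<^sup>2 / 2)))\<^sup>2 * (cmod (\<Sum>w\<in>\<Omega>. cis (t * x w)))\<^sup>2) (2 * pi * V)"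
proof -
  define n where "n s z = normal_density 0 (sqrt s) z" for s z
  define V where "V = (\<Sum>v\<in>\<Omega>. \<Sum>w\<in>\<Omega>. n (\<delta>\<^sup>2 + \<delta>\<^sup>2) (x v - x w) - n (\<delta>\<^sup>2 + \<Delta>\<^sup>2) (x v - x w)
     - n (\<Delta>\<^sup>2 + \<delta>\<^sup>2) (x v - x w) + n (\<Delta>\<^sup>2 + \<Delta>\<^sup>2) (x v - x w))"
  let ?N = normal_density
  have "has_bochner_integral lborel (\<lambda>y. \<Sum>v\<in>\<Omega>. \<Sum>w\<in>\<Omega>.
       ?N (x v) \<delta> y * ?N (x w) \<delta> y - ?N (x v) \<delta> y * ?N (x w) \<Delta> y
       - ?N (x v) \<Delta> y * ?N (x w) \<delta> y + ?N (x v) \<Delta> y * ?N (x w) \<Delta> y) V"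
    unfolding V_def n_def
    by (intro has_bochner_integral_sum has_bochner_integral_add has_bochner_integral_diff integral_normal_density_mult pos)
  moreover have "(\<Sum>w\<in>\<Omega>. ?N (x w) \<delta> y - ?N (x w) \<Delta> y)\<^sup>2 = (\<Sum>v\<in>\<Omega>. \<Sum>w\<in>\<Omega>.
       ?N (x v) \<delta> y * ?N (x w) \<delta> y - ?N (x v) \<delta> y * ?N (x w) \<Delta> y
       - ?N (x v) \<Delta> y * ?N (x w) \<delta> y + ?N (x v) \<Delta> y * ?N (x w) \<Delta> y)" for y
    unfolding power2_eq_square sum_product by (intro sum.cong refl) (simp add: algebra_simps)
  ultimately have 1: "has_bochner_integral lborel (\<lambda>y. (\<Sum>w\<in>\<Omega>. ?N (x w) \<delta> y - ?N (x w) \<Delta> y)\<^sup>2) V" by simp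
  define e where "e s t = exp (- (s / 2 * t\<^sup>2))" for s t :: real
  have s0: "0 < \<delta>\<^sup>2 + \<delta>\<^sup>2" "0 < \<delta>\<^sup>2 + \<Delta>\<^sup>2" "0 < \<Delta>\<^sup>2 + \<delta>\<^sup>2" "0 < \<Delta>\<^sup>2 + \<Delta>\<^sup>2" using pos by (auto intro: add_pos_pos)
  have "has_bochner_integral lborel (\<lambda>t. \<Sum>v\<in>\<Omega>. \<Sum>w\<in>\<Omega>.
       e (\<delta>\<^sup>2 + \<delta>\<^sup>2) t * cos (t * (x v - x w)) - e (\<delta>\<^sup>2 + \<Delta>\<^sup>2) t * cos (t * (x v - x w))
       - e (\<Delta>\<^sup>2 + \<delta>\<^sup>2) t * cos (t * (x v - x w)) + e (\<Delta>\<^sup>2 + \<Delta>\<^sup>2) t * cos (t * (x v - x w)))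
     (\<Sum>v\<in>\<Omega>. \<Sum>w\<in>\<Omega>. 2 * pi * n (\<delta>\<^sup>2 + \<delta>\<^sup>2) (x v - x w) - 2 * pi * n (\<delta>\<^sup>2 + \<Delta>\<^sup>2) (x v - x w)
     - 2 * pi * n (\<Delta>\<^sup>2 + \<delta>\<^sup>2) (x v - x w) + 2 * pi * n (\<Delta>\<^sup>2 + \<Delta>\<^sup>2) (x v - x w))"
    unfolding n_def e_def
    by (intro has_bochner_integral_sum has_bochner_integral_add has_bochner_integral_diff integral_gaussian_cos_normal_density s0)
  moreover have "(\<Sum>v\<in>\<Omega>. \<Sum>w\<in>\<Omega>. 2 * pi * n (\<delta>\<^sup>2 + \<delta>\<^sup>2) (x v - x w) - 2 * pi * n (\<delta>\<^sup>2 + \<Delta>\<^sup>2) (x v - x w)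
     - 2 * pi * n (\<Delta>\<^sup>2 + \<delta>\<^sup>2) (x v - x w) + 2 * pi * n (\<Delta>\<^sup>2 + \<Delta>\<^sup>2) (x v - x w)) = 2 * pi * V"
    unfolding V_def sum_distrib_left by (intro sum.cong refl) (simp add: ring_distribs)
  moreover have "(\<Sum>v\<in>\<Omega>. \<Sum>w\<in>\<Omega>.
       e (\<delta>\<^sup>2 + \<delta>\<^sup>2) t * cos (t * (x v - x w)) - e (\<delta>\<^sup>2 + \<Delta>\<^sup>2) t * cos (t * (x v - x w))
       - e (\<Delta>\<^sup>2 + \<delta>\<^sup>2) t * cos (t * (x v - x w)) + e (\<Delta>\<^sup>2 + \<Delta>\<^sup>2) t * cos (t * (x v - x w)))
     = (exp (- (\<delta>\<^sup>2 * t\<^sup>2 / 2)) - exp (- (\<Delta>\<^sup>2 * t\<^sup>2 / 2)))\<^sup>2 * (cmod (\<Sum>w\<in>\<Omega>. cis (t * x w)))\<^sup>2" for t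
  proof -
    have e: "e (a + b) t = exp (- (a * t\<^sup>2 / 2)) * exp (- (b * t\<^sup>2 / 2))" for a b
      unfolding e_def by (simp add: field_simps flip: exp_add)
    show ?thesis unfolding norm_sum_cis_sq_cos[OF fin] sum_distrib_left e
      by (intro sum.cong refl) (simp add: algebra_simps power2_eq_square)
  qed
  ultimately have "has_bochner_integral lborel (\<lambda>t. (exp (- (\<delta>\<^sup>2 * t\<^sup>2 / 2)) - exp (- (\<Delta>\<^sup>2 * t\<^sup>2 / 2)))\<^sup>2 * (cmod (\<Sum>w\<in>\<Omega>. cis (t * x w)))\<^sup>2) (2 * pi * V)"
    by simp
  with 1 show ?thesis by blast
qed

section \<open>Divisors and the eighth moment\<close>

lemma card_divisors_prime_power_mult_le:
  fixes p m a :: nat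
  assumes "prime p" "m > 0"
  shows "card {d. d dvd p ^ a * m} \<le> Suc a * card {d. d dvd m}"
proof -
  have "{d. d dvd p ^ a * m} \<subseteq> (\<lambda>(i, e). p ^ i * e) ` ({..a} \<times> {d. d dvd m})"
  proof
    fix d assume "d \<in> {d. d dvd p ^ a * m}"
    then obtain b c where bc: "d = b * c" "b dvd p ^ a" "c dvd m" using division_decomp by blast
    then obtain i where "i \<le> a" "b = p ^ i" using divides_primepow_nat[OF assms(1)] by blast
    thus "d \<in> (\<lambda>(i, e). p ^ i * e) ` ({..a} \<times> {d. d dvd m})" using bc by auto
  qed
  hence "card {d. d dvd p ^ a * m} \<le> card ({..a} \<times> {d. d dvd m})"
    by (rule surj_card_le[rotated]) (use assms in auto)
  thus ?thesis by (simp only: card_cartesian_product card_atMost)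
qed

text \<open>One prime power \<open>p^a\<close> is removed at a time. If
  \<open>p powr \<epsilon> >= 2\<close>, then \<open>a + 1 <= 2^a <= (p^a) powr \<epsilon>\<close>
  and nothing is lost; each of the boundedly many smaller primes costs at most a factor
  \<open>K\<close>.\<close>

lemma card_divisors_le_powr:
  fixes \<epsilon> :: real
  assumes e: "\<epsilon> > 0"
  shows "\<exists>C\<ge>1. \<forall>n::nat. n > 0 \<longrightarrow> real (card {d. d dvd n}) \<le> C * real n powr \<epsilon>"
proof -
  \<comment> \<open>Chosen so that \<open>1 + x <= exp x\<close> gives
    \<open>a + 1 <= K * 2 powr (a * \<epsilon>)\<close> for every \<open>a\<close>.\<close>
  define K where "K = 1 + 1 / (\<epsilon> * ln 2)"
  define B where "B = (2::real) powr (1 / \<epsilon>)"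
  define S where "S n = {p::nat. prime p \<and> p dvd n \<and> real p < B}" for n
  have K1: "1 \<le> K" using e by (simp add: K_def)
  have K: "real (Suc a) \<le> K * 2 powr (real a * \<epsilon>)" for a
  proof -
    have l: "0 < \<epsilon> * ln 2" using e by simp
    have "real (Suc a) \<le> K * (1 + real a * \<epsilon> * ln 2)"
    proof -
      define L where "L = \<epsilon> * ln 2"
      have "K * (1 + real a * \<epsilon> * ln 2) = (1 + 1 / L) * (1 + real a * L)" by (simp add: K_def L_def)
      also have "\<dots> = 1 + real a + real a * L + 1 / L" using l by (simp add: L_def[symmetric] field_simps)
      finally show ?thesis using l by (simp add: L_def)
    qed
    also have "\<dots> \<le> K * exp (real a * \<epsilon> * ln 2)"
      using K1 by (intro mult_left_mono exp_ge_add_one_self) auto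
    finally show ?thesis by (simp add: powr_def)
  qed
  have Sfin: "finite (S n)" for n
    by (rule finite_subset[of _ "{..nat \<lceil>B\<rceil>}"]) (auto simp: S_def, linarith)
  have main: "n > 0 \<Longrightarrow> real (card {d. d dvd n}) \<le> K ^ card (S n) * real n powr \<epsilon>" for n
  proof (induction n rule: less_induct)
    case (less n)
    show ?case
    proof (cases "n = 1")
      case True
      have "S 1 = {}" by (auto simp: S_def)
      thus ?thesis using True by simp
    next
      case False
      then obtain p where p: "prime p" "p dvd n" using prime_factor_nat by blast
      obtain m where m: "n = p ^ multiplicity p n * m" "\<not> p dvd m"
        by (rule multiplicity_decompose'[of n p]) (use less.prems p in auto)
      define a where "a = multiplicity p n"
      have n: "n = p ^ a * m" using m by (simp add: a_def)
      have a: "a \<ge> 1" using p m(2) n by (cases a) auto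
      have m0: "m > 0" using n less.prems by (cases m) auto
      have p2: "2 \<le> p" using p prime_ge_2_nat by blast
      have pa: "1 < p ^ a" using one_less_power[of p a] p2 a by simp
      have mn: "m < n" using pa m0 unfolding n by simp
      have "real (card {d. d dvd n}) \<le> real (Suc a * card {d. d dvd m})"
        unfolding n of_nat_le_iff by (rule card_divisors_prime_power_mult_le[OF p(1) m0])
      also have "\<dots> \<le> real (Suc a) * (K ^ card (S m) * real m powr \<epsilon>)"
        unfolding of_nat_mult by (intro mult_left_mono less.IH mn m0) auto
      also have "\<dots> \<le> (K ^ card (S n) * real (p ^ a) powr \<epsilon>) * real m powr \<epsilon>"
      proof -
        have "real (Suc a) * K ^ card (S m) \<le> K ^ card (S n) * real (p ^ a) powr \<epsilon>"
        proof (cases "real p < B")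
          case True
          have sub: "S m \<subseteq> S n - {p}" using m(2) by (auto simp: S_def n)
          have pS: "p \<in> S n" using p True by (simp add: S_def)
          have "card (S m) \<le> card (S n - {p})" by (rule card_mono[OF _ sub]) (use Sfin in auto)
          also have "\<dots> = card (S n) - 1" using pS by simp
          finally have c: "Suc (card (S m)) \<le> card (S n)" using pS Sfin by (metis Suc_diff_1 Suc_le_mono card_gt_0_iff empty_iff)
          have "real (Suc a) * K ^ card (S m) \<le> (K * 2 powr (real a * \<epsilon>)) * K ^ card (S m)"
            using K K1 by (intro mult_right_mono) auto
          also have "\<dots> = K ^ Suc (card (S m)) * 2 powr (real a * \<epsilon>)" by simp
          also have "\<dots> \<le> K ^ card (S n) * real p powr (real a * \<epsilon>)"
            using c K1 p2 e by (intro mult_mono power_increasing powr_mono2) auto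
          also have "real p powr (real a * \<epsilon>) = real (p ^ a) powr \<epsilon>"
            using p2 by (simp add: powr_powr flip: powr_realpow)
          finally show ?thesis .
        next
          case False
          have sub: "S m \<subseteq> S n" by (auto simp: S_def n)
          have c: "card (S m) \<le> card (S n)" by (rule card_mono[OF Sfin sub])
          have "2 = B powr \<epsilon>" using e by (simp add: B_def powr_powr)
          also have "\<dots> \<le> real p powr \<epsilon>" using False e by (intro powr_mono2) (auto simp: B_def)
          finally have "2 ^ a \<le> (real p powr \<epsilon>) ^ a" by (rule power_mono) simp
          also have "\<dots> = real (p ^ a) powr \<epsilon>"
            using p2 by (simp add: powr_powr mult.commute flip: powr_realpow)
          finally have 2: "2 ^ a \<le> real (p ^ a) powr \<epsilon>" .
          have "Suc a \<le> 2 ^ a" by (intro Suc_leI less_exp)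
          hence "real (Suc a) \<le> real (2 ^ a)" unfolding of_nat_le_iff .
          hence "real (Suc a) \<le> real (p ^ a) powr \<epsilon>" using 2 by simp
          hence "real (Suc a) * K ^ card (S m) \<le> real (p ^ a) powr \<epsilon> * K ^ card (S n)"
            using c K1 by (intro mult_mono power_increasing) auto
          thus ?thesis by (simp add: mult.commute)
        qed
        thus ?thesis by (simp add: mult_right_mono mult.assoc[symmetric] del: of_nat_Suc of_nat_power)
      qed
      also have "\<dots> = K ^ card (S n) * real n powr \<epsilon>"
        using p2 m0 unfolding n by (simp add: powr_mult)
      finally show ?thesis .
    qed
  qed
  have cS: "card (S n) \<le> card {..nat \<lceil>B\<rceil>}" for n
    by (rule card_mono) (auto simp: S_def, linarith)
  show ?thesis
  proof (intro exI[of _ "K ^ card {..nat \<lceil>B\<rceil>}"] conjI allI impI)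
    show "1 \<le> K ^ card {..nat \<lceil>B\<rceil>}" using K1 by (rule one_le_power)
    fix n :: nat assume "n > 0"
    from main[OF this] show "real (card {d. d dvd n}) \<le> K ^ card {..nat \<lceil>B\<rceil>} * real n powr \<epsilon>"
      by (rule order_trans) (intro mult_right_mono power_increasing cS K1, auto)
  qed
qed

section \<open>The fourth power of a Dirichlet polynomial\<close>

definition quads :: "nat \<Rightarrow> (nat \<times> nat \<times> nat \<times> nat) set" where
  "quads T = {T<..2*T} \<times> {T<..2*T} \<times> {T<..2*T} \<times> {T<..2*T}"

definition qprod :: "nat \<times> nat \<times> nat \<times> nat \<Rightarrow> nat" where
  "qprod = (\<lambda>(a, b, c, d). a * b * c * d)"

lemma finite_quads [simp]: "finite (quads T)" by (simp add: quads_def)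

lemma card_quads [simp]: "card (quads T) = T ^ 4"
  by (simp add: quads_def power4_eq_xxxx mult.assoc)

lemma card_qprod_fibre_le:
  "card {q \<in> quads T. qprod q = n} \<le> card {d. d dvd n} ^ 4"
proof (cases "n = 0")
  case True
  have "{q \<in> quads T. qprod q = n} = {}" using True by (auto simp: quads_def qprod_def)
  thus ?thesis by (simp only: card.empty)
next
  case False
  hence fin: "finite {d. d dvd n}" by simp
  have "{q \<in> quads T. qprod q = n} \<subseteq> {d. d dvd n} \<times> {d. d dvd n} \<times> {d. d dvd n} \<times> {d. d dvd n}"
    by (auto simp: qprod_def)
  hence "card {q \<in> quads T. qprod q = n} \<le> card ({d. d dvd n} \<times> {d. d dvd n} \<times> {d. d dvd n} \<times> {d. d dvd n})"
    by (rule card_mono[rotated]) (use fin in auto)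
  thus ?thesis by (simp only: card_cartesian_product power4_eq_xxxx mult.assoc)
qed

lemma sum_cis_power4:
  "(\<Sum>n\<in>{T<..2*T}. cis (t * ln (real n))) ^ 4 = (\<Sum>q\<in>quads T. cis (t * ln (real (qprod q))))"
proof -
  let ?f = "\<lambda>n. cis (t * ln (real n))"
  have "(\<Sum>n\<in>{T<..2*T}. ?f n) ^ 4 = (\<Sum>n\<in>{T<..2*T}. ?f n) * ((\<Sum>n\<in>{T<..2*T}. ?f n) * ((\<Sum>n\<in>{T<..2*T}. ?f n) * (\<Sum>n\<in>{T<..2*T}. ?f n)))"
    by (simp add: power4_eq_xxxx mult.assoc)
  also have "\<dots> = (\<Sum>(a,b,c,d)\<in>quads T. ?f a * (?f b * (?f c * ?f d)))"
    unfolding quads_def sum.cartesian_product[symmetric] by (simp only: sum_product) (simp only: sum_distrib_left)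
  also have "\<dots> = (\<Sum>q\<in>quads T. cis (t * ln (real (qprod q))))"
    by (rule sum.cong) (auto simp: quads_def qprod_def cis_mult ln_mult algebra_simps)
  finally show ?thesis .
qed

text \<open>The constant is \<open>1024 = 4 * 16^2\<close>: products of quadruples are at most
  \<open>16 * T^4\<close>, so the logarithms of two such integers differ by at least
  \<open>|m - n| / (16 * T^4)\<close>; the Gaussian transform squares this and multiplies by
  \<open>T^8 / 4\<close>.\<close>

lemma summable_exp_square: "summable (\<lambda>i::nat. exp (- ((real i)\<^sup>2 / 1024)))"
proof (rule summable_comparison_test')
  show "summable (\<lambda>i::nat. exp 1 * exp (-1/16) ^ i :: real)"
    by (intro summable_mult summable_geometric) simp
  show "norm (exp (- ((real i)\<^sup>2 / 1024))) \<le> exp 1 * exp (-1/16) ^ i" if "i \<ge> 0" for i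
  proof -
    have "0 \<le> (real i / 32 - 1)\<^sup>2" by simp
    also have "\<dots> = (real i)\<^sup>2 / 1024 - real i / 16 + 1" by (simp add: power2_eq_square algebra_simps)
    finally have "exp (- ((real i)\<^sup>2 / 1024)) \<le> exp (1 + real i * (-1/16))" by simp
    also have "\<dots> = exp 1 * exp (-1/16) ^ i" by (simp only: exp_add exp_of_nat_mult)
    finally show ?thesis by simp
  qed
qed

lemma sum_exp_square_diff_le:
  assumes "finite S"
  shows "(\<Sum>m\<in>S. exp (- ((real n - real m)\<^sup>2 / 1024))) \<le> 2 * (\<Sum>i::nat. exp (- ((real i)\<^sup>2 / 1024)))"
proof -
  define g where "g i = exp (- ((real i)\<^sup>2 / 1024))" for i :: nat
  have sub: "(\<Sum>m\<in>A. exp (- ((real n - real m)\<^sup>2 / 1024))) \<le> suminf g"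
    if "finite A" "inj_on h A" "\<And>m. m \<in> A \<Longrightarrow> (real (h m))\<^sup>2 = (real n - real m)\<^sup>2" for A h
  proof -
    have "(\<Sum>m\<in>A. exp (- ((real n - real m)\<^sup>2 / 1024))) = (\<Sum>m\<in>A. g (h m))"
      by (rule sum.cong) (simp_all add: g_def that)
    also have "\<dots> = sum g (h ` A)" using that by (simp add: sum.reindex)
    also have "\<dots> \<le> suminf g"
      using summable_exp_square that by (intro sum_le_suminf) (auto simp: g_def[abs_def])
    finally show ?thesis .
  qed
  let ?e = "\<lambda>m. exp (- ((real n - real m)\<^sup>2 / 1024))"
  have "(\<Sum>m\<in>S. ?e m) = (\<Sum>m\<in>{m\<in>S. m \<le> n}. ?e m) + (\<Sum>m\<in>{m\<in>S. n < m}. ?e m)"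
    using assms by (subst sum.union_disjoint[symmetric]) (auto intro!: sum.cong)
  also have "\<dots> \<le> suminf g + suminf g"
  proof (rule add_mono)
    show "(\<Sum>m\<in>{m\<in>S. m \<le> n}. ?e m) \<le> suminf g"
      by (rule sub[of _ "\<lambda>m. n - m"]) (use assms in \<open>auto simp: of_nat_diff inj_on_def\<close>)
    show "(\<Sum>m\<in>{m\<in>S. n < m}. ?e m) \<le> suminf g"
      by (rule sub[of _ "\<lambda>m. m - n"]) (use assms in \<open>auto simp: of_nat_diff inj_on_def power2_commute\<close>)
  qed
  finally show ?thesis by (simp add: g_def[abs_def])
qed

lemma abs_ln_diff_ge:
  fixes m n M :: real
  assumes "0 < m" "0 < n" "m \<le> M" "n \<le> M"
  shows "\<bar>n - m\<bar> / M \<le> \<bar>ln n - ln m\<bar>"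
proof -
  have *: "(n - m) / M \<le> ln n - ln m" if "0 < m" "m \<le> n" "n \<le> M" for m n
  proof -
    have "(n - m) / M \<le> (n - m) / n" using that by (intro divide_left_mono) auto
    also have "\<dots> = 1 - m / n" using that by (simp add: field_simps)
    also have "\<dots> \<le> - ln (m / n)" using ln_le_minus_one[of "m / n"] that by auto
    also have "\<dots> = ln n - ln m" using that by (simp add: ln_div)
    finally show ?thesis .
  qed
  show ?thesis
  proof (cases "m \<le> n")
    case True thus ?thesis using *[of m n] assms by simp
  next
    case False
    hence "n \<le> m" by simp
    hence "ln n \<le> ln m" using assms by simp
    thus ?thesis using *[of n m] assms \<open>n \<le> m\<close> by simp
  qed
qed

lemma qprod_bounds:
  assumes "q \<in> quads T"
  shows "0 < qprod q" "qprod q \<le> 16 * T ^ 4"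
proof -
  obtain a b c d where q: "q = (a, b, c, d)" by (cases q)
  have b: "a \<le> 2*T" "b \<le> 2*T" "c \<le> 2*T" "d \<le> 2*T" "0 < a" "0 < b" "0 < c" "0 < d"
    using assms by (auto simp: q quads_def)
  show "0 < qprod q" using b by (simp add: q qprod_def)
  have "a * b * c * d \<le> (2*T) * (2*T) * (2*T) * (2*T)" using b by (intro mult_mono) auto
  thus "qprod q \<le> 16 * T ^ 4" by (simp add: q qprod_def power4_eq_xxxx)
qed

text \<open>The weight has width \<open>T^4\<close>, so its transform sees only pairs of quadruples
  whose log-products differ by O(\<open>T^-4\<close>). Products are integers up to
  \<open>16 * T^4\<close>, so up to a convergent Gaussian tail these pairs are diagonal, and
  \<open>r\<close> bounds their multiplicity. The weight is the square of the transform of the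
  narrow Gaussian with \<delta> = \<open>1 / T^4\<close>.\<close>

lemma dirichlet_eighth_moment:
  assumes T: "T \<ge> 1" and r: "\<And>n. 0 < n \<Longrightarrow> n \<le> 16 * T ^ 4 \<Longrightarrow> real (card {q \<in> quads T. qprod q = n}) \<le> r"
  shows "\<exists>I. has_bochner_integral lborel (\<lambda>t. exp (- (t\<^sup>2 / real T ^ 8)) * cmod (\<Sum>n\<in>{T<..2*T}. cis (t * ln (real n))) ^ 8) I \<and>
    I \<le> 2 * sqrt pi * (\<Sum>i::nat. exp (- ((real i)\<^sup>2 / 1024))) * r * real T ^ 8"
proof -
  define Q where "Q = quads T"
  define N where "N = (\<Sum>i::nat. exp (- ((real i)\<^sup>2 / 1024)))"
  define T' where "T' = real T"
  have T0: "0 < T'" using T by (simp add: T'_def)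
  define l where "l q = ln (real (qprod q))" for q
  define I where "I = (\<Sum>p\<in>Q. \<Sum>q\<in>Q. sqrt pi * T' ^ 4 * exp (- ((l p - l q)\<^sup>2 * T' ^ 8 / 4)))"
  have N0: "0 \<le> N" unfolding N_def by (intro suminf_nonneg summable_exp_square) simp
  have "1 \<le> T ^ 4" using T by simp
  hence "1 \<le> 16 * T ^ 4" by linarith
  hence r0: "0 \<le> r" by (intro order_trans[OF of_nat_0_le_iff r[of 1]]) auto
  have sq: "sqrt (pi / (1 / T' ^ 8)) = sqrt pi * T' ^ 4"
  proof -
    have "pi / (1 / T' ^ 8) = pi * (T' ^ 4)\<^sup>2" by (simp flip: power_mult)
    thus ?thesis by (simp only: real_sqrt_mult real_sqrt_abs) (use T0 in simp)
  qed
  have "has_bochner_integral lborel (\<lambda>t. \<Sum>p\<in>Q. \<Sum>q\<in>Q. exp (- (1 / T' ^ 8 * t\<^sup>2)) * cos (t * (l p - l q)))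
      (\<Sum>p\<in>Q. \<Sum>q\<in>Q. sqrt (pi / (1 / T' ^ 8)) * exp (- ((l p - l q)\<^sup>2 / (4 * (1 / T' ^ 8)))))"
    by (intro has_bochner_integral_sum integral_gaussian_cos) (use T0 in auto)
  moreover have "(\<Sum>p\<in>Q. \<Sum>q\<in>Q. exp (- (1 / T' ^ 8 * t\<^sup>2)) * cos (t * (l p - l q)))
     = exp (- (t\<^sup>2 / real T ^ 8)) * cmod (\<Sum>n\<in>{T<..2*T}. cis (t * ln (real n))) ^ 8" for t
  proof -
    have "cmod (\<Sum>n\<in>{T<..2*T}. cis (t * ln (real n))) ^ 8 = (cmod ((\<Sum>n\<in>{T<..2*T}. cis (t * ln (real n))) ^ 4))\<^sup>2"
      by (simp add: norm_power flip: power_mult)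
    also have "\<dots> = (cmod (\<Sum>q\<in>Q. cis (t * l q)))\<^sup>2" unfolding sum_cis_power4 Q_def l_def ..
    also have "\<dots> = (\<Sum>p\<in>Q. \<Sum>q\<in>Q. cos (t * l p - t * l q))"
      by (rule norm_sum_cis_sq_cos) (simp add: Q_def)
    finally show ?thesis by (simp add: sum_distrib_left right_diff_distrib T'_def)
  qed
  ultimately have int: "has_bochner_integral lborel (\<lambda>t. exp (- (t\<^sup>2 / real T ^ 8)) * cmod (\<Sum>n\<in>{T<..2*T}. cis (t * ln (real n))) ^ 8) I"
    unfolding I_def sq by simp
  have inner: "(\<Sum>q\<in>Q. exp (- ((l p - l q)\<^sup>2 * T' ^ 8 / 4))) \<le> 2 * N * r" if p: "p \<in> Q" for p
  proof -
    let ?e = "\<lambda>m. exp (- ((real (qprod p) - real m)\<^sup>2 / 1024))"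
    have "(\<Sum>q\<in>Q. exp (- ((l p - l q)\<^sup>2 * T' ^ 8 / 4))) \<le> (\<Sum>q\<in>Q. ?e (qprod q))"
    proof (rule sum_mono)
      fix q assume q: "q \<in> Q"
      have b: "0 < qprod p" "qprod p \<le> 16 * T ^ 4" "0 < qprod q" "qprod q \<le> 16 * T ^ 4"
        using qprod_bounds p q unfolding Q_def by auto
      have b': "real (qprod p) \<le> 16 * T' ^ 4" "real (qprod q) \<le> 16 * T' ^ 4"
        using of_nat_mono[OF b(2), where 'a = real] of_nat_mono[OF b(4), where 'a = real] by (auto simp: T'_def)
      have "\<bar>real (qprod p) - real (qprod q)\<bar> / (16 * T' ^ 4) \<le> \<bar>l p - l q\<bar>"
        unfolding l_def using b b' by (intro abs_ln_diff_ge) auto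
      hence "(\<bar>real (qprod p) - real (qprod q)\<bar> / (16 * T' ^ 4))\<^sup>2 \<le> (\<bar>l p - l q\<bar>)\<^sup>2"
        using T0 by (intro power_mono) auto
      hence "(real (qprod p) - real (qprod q))\<^sup>2 / (256 * T' ^ 8) \<le> (l p - l q)\<^sup>2"
        by (simp add: power_divide power_mult_distrib flip: power_mult)
      hence "(real (qprod p) - real (qprod q))\<^sup>2 / (256 * T' ^ 8) * (T' ^ 8 / 4) \<le> (l p - l q)\<^sup>2 * (T' ^ 8 / 4)"
        using T0 by (intro mult_right_mono) auto
      thus "exp (- ((l p - l q)\<^sup>2 * T' ^ 8 / 4)) \<le> ?e (qprod q)" using T0 by simp
    qed
    also have "\<dots> = (\<Sum>m\<in>qprod ` Q. \<Sum>q\<in>{q \<in> Q. qprod q = m}. ?e (qprod q))"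
      by (rule sum.image_gen) (simp add: Q_def)
    also have "\<dots> = (\<Sum>m\<in>qprod ` Q. real (card {q \<in> Q. qprod q = m}) * ?e m)"
      by (rule sum.cong) auto
    also have "\<dots> \<le> (\<Sum>m\<in>qprod ` Q. r * ?e m)"
      using r qprod_bounds by (intro sum_mono mult_right_mono) (auto simp: Q_def)
    also have "\<dots> = r * (\<Sum>m\<in>qprod ` Q. ?e m)" by (simp add: sum_distrib_left)
    also have "\<dots> \<le> r * (2 * N)"
      unfolding N_def using r0 by (intro mult_left_mono sum_exp_square_diff_le) (auto simp: Q_def)
    finally show ?thesis by (simp add: mult_ac)
  qed
  have "I = sqrt pi * T' ^ 4 * (\<Sum>p\<in>Q. \<Sum>q\<in>Q. exp (- ((l p - l q)\<^sup>2 * T' ^ 8 / 4)))"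
    by (simp add: I_def sum_distrib_left)
  also have "\<dots> \<le> sqrt pi * T' ^ 4 * (\<Sum>p\<in>Q. 2 * N * r)"
    using T0 by (intro mult_left_mono sum_mono inner) auto
  also have "\<dots> = 2 * sqrt pi * N * r * (T' ^ 4 * T' ^ 4)" by (simp add: Q_def T'_def)
  also have "T' ^ 4 * T' ^ 4 = T' ^ 8" by (simp flip: power_add)
  finally show ?thesis using int unfolding N_def T'_def by blast
qed

section \<open>The exceptional set\<close>

lemma has_bochner_integral_inverse_1_plus_square:
  "has_bochner_integral lborel (\<lambda>x::real. inverse (1 + x\<^sup>2)) pi"
proof -
  have e: "einterval (-\<infinity>) \<infinity> = (UNIV :: real set)" by (auto simp: einterval_def)
  have 1: "integrable lborel (\<lambda>x::real. inverse (1 + x^2))"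
    using integrable_inverse_1_plus_square by (simp add: set_integrable_def e)
  have 2: "integral\<^sup>L lborel (\<lambda>x::real. inverse (1 + x^2)) = pi"
    using LBINT_inverse_1_plus_square
    by (simp add: interval_lebesgue_integral_def set_lebesgue_integral_def e)
  show ?thesis using 1 2 by (simp add: has_bochner_integral_iff)
qed

section \<open>The approximating fractions and their Fourier transform\<close>

definition tuples :: "nat \<Rightarrow> nat \<Rightarrow> nat list set" where
  "tuples J H = {xs. set xs \<subseteq> {1..H} \<and> length xs = J}"

lemma finite_tuples [simp]: "finite (tuples J H)"
  unfolding tuples_def by (rule finite_lists_length_eq) simp

lemma card_tuples [simp]: "card (tuples J H) = H ^ J"
  unfolding tuples_def by (subst card_lists_length_eq) auto

lemma sum_list_tuples_le: "xs \<in> tuples J H \<Longrightarrow> sum_list xs \<le> J * H"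
proof -
  assume "xs \<in> tuples J H"
  hence "\<And>x. x \<in> set xs \<Longrightarrow> x \<le> H" "length xs = J" by (auto simp: tuples_def)
  thus ?thesis using sum_list_mono[of xs "\<lambda>x. x" "\<lambda>_. H"] by (simp add: sum_list_triv)
qed

text \<open>Each list is one choice of the \<open>J\<close> summands of the amplifier, so the
  recursive sum is its Fourier sum.\<close>

lemma wsum_eq_sum_tuples: "wsum J H f = (\<Sum>xs\<in>tuples J H. cis (f (sum_list xs)))"
proof (induction J arbitrary: f)
  case 0
  have "tuples 0 H = {[]}" by (auto simp: tuples_def)
  thus ?case by simp
next
  case (Suc J)
  have "(\<Sum>xs\<in>tuples (Suc J) H. cis (f (sum_list xs))) = (\<Sum>(xs, y)\<in>tuples J H \<times> {1..H}. cis (f (sum_list (y # xs))))"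
    unfolding tuples_def lists_length_Suc_eq
    by (subst sum.reindex) (auto simp: inj_on_def split_def intro!: sum.cong)
  also have "\<dots> = (\<Sum>xs\<in>tuples J H. \<Sum>y\<in>{1..H}. cis (f (sum_list (y # xs))))"
    by (rule sum.cartesian_product[symmetric])
  also have "\<dots> = (\<Sum>y\<in>{1..H}. \<Sum>xs\<in>tuples J H. cis (f (sum_list (y # xs))))" by (rule sum.swap)
  also have "\<dots> = wsum (Suc J) H f" by (simp add: Suc add.commute)
  finally show ?case ..
qed

text \<open>The logarithm of the approximating fraction \<open>(N + \<Sum>xs) c d / (N a b)\<close>.\<close>
definition log_frac :: "real \<Rightarrow> (nat \<times> nat \<times> nat \<times> nat) \<times> nat list \<Rightarrow> real" where
  "log_frac N = (\<lambda>((a, b, c, d), xs). ln (real c) + ln (real d) - ln (real a) - ln (real b)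
     + (ln (N + real (sum_list xs)) - ln N))"

text \<open>The logarithm is additive in independent variables, so the sum factors: \<open>c\<close>
  and \<open>d\<close> each give the Dirichlet sum, \<open>a\<close> and \<open>b\<close> its
  conjugate, and \<open>- ln N\<close> a unimodular factor.\<close>

lemma norm_sum_cis_log_frac:
  "cmod (\<Sum>w\<in>quads T \<times> tuples J H. cis (t * log_frac N w)) =
     cmod (\<Sum>n\<in>{T<..2*T}. cis (t * ln (real n))) ^ 4 * cmod (wsum J H (\<lambda>x. t * ln (N + real x)))"
proof -
  let ?f = "\<lambda>n::nat. cis (t * ln (real n))" and ?A = "{T<..2*T}"
  let ?g = "\<lambda>xs. cis (t * ln (N + real (sum_list xs)))"
  let ?D = "\<Sum>n\<in>?A. ?f n"
  have "(\<Sum>w\<in>quads T \<times> tuples J H. cis (t * log_frac N w)) =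
     (\<Sum>q\<in>quads T. \<Sum>xs\<in>tuples J H. cis (t * log_frac N (q, xs)))"
    unfolding sum.cartesian_product by simp
  also have "\<dots> = (\<Sum>q\<in>quads T. \<Sum>xs\<in>tuples J H. (case q of (a,b,c,d) \<Rightarrow> cnj (?f a) * (cnj (?f b) * (?f c * ?f d)))
     * (cis (- (t * ln N)) * ?g xs))"
    by (intro sum.cong refl)
       (auto simp: log_frac_def cis_cnj cis_mult algebra_simps intro!: arg_cong[of _ _ cis])
  also have "\<dots> = (\<Sum>(a,b,c,d)\<in>quads T. cnj (?f a) * (cnj (?f b) * (?f c * ?f d))) * (\<Sum>xs\<in>tuples J H. cis (- (t * ln N)) * ?g xs)"
    by (rule sum_product[symmetric])
  also have "(\<Sum>xs\<in>tuples J H. cis (- (t * ln N)) * ?g xs) = cis (- (t * ln N)) * wsum J H (\<lambda>x. t * ln (N + real x))"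
    unfolding wsum_eq_sum_tuples by (rule sum_distrib_left[symmetric])
  also have "(\<Sum>(a,b,c,d)\<in>quads T. cnj (?f a) * (cnj (?f b) * (?f c * ?f d))) = (\<Sum>n\<in>?A. cnj (?f n)) * ((\<Sum>n\<in>?A. cnj (?f n)) * (?D * ?D))"
    unfolding quads_def sum.cartesian_product[symmetric] by (simp only: sum_product) (simp only: sum_distrib_left)
  also have "(\<Sum>n\<in>?A. cnj (?f n)) = cnj ?D" by (rule cnj_sum[symmetric])
  finally show ?thesis by (simp only: norm_mult complex_mod_cnj norm_cis mult_1_left power4_eq_xxxx mult.assoc)
qed

text \<open>\<open>D\<close> and \<open>u\<close> stand for the normalised Dirichlet and amplifier
  sums. Each part of the majorant has a known integral: the first is integrable by itself and small
  through \<open>k^6\<close>, the second is \<open>B^2\<close> times the integrand of the eighth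
  moment. The constant \<open>10^17\<close> covers the \<open>4 * 10^16\<close> of the extreme
  range, where \<open>T^16\<close> brings in \<open>10^16\<close>.\<close>

lemma gaussian_mixture_pointwise_bound:
  fixes t :: real
  assumes K: "K \<ge> 3" and k: "k \<ge> 1" and T: "T = 10 * k ^ K" and J: "J = 5 * K"
    and U: "\<And>t. real k ^ 3 \<le> \<bar>t\<bar> \<Longrightarrow> \<bar>t\<bar> \<le> real k ^ (2 * J + 3) \<Longrightarrow> u t \<le> B"
    and U1: "\<And>t. 0 \<le> u t" "\<And>t. u t \<le> 1" and B: "0 \<le> B"
    and D: "\<And>t. 1 \<le> \<bar>t\<bar> \<Longrightarrow> \<bar>t\<bar> \<le> real T \<Longrightarrow> D t \<le> 48 / \<bar>t\<bar>"
    and D1: "\<And>t. 0 \<le> D t" "\<And>t. D t \<le> 1"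
  shows "(exp (- ((1 / real T ^ 4)\<^sup>2 * t\<^sup>2 / 2)) - exp (- ((1 / real k ^ 3)\<^sup>2 * t\<^sup>2 / 2)))\<^sup>2 * (D t ^ 4 * u t)\<^sup>2
    \<le> 10 ^ 17 / real k ^ 6 * inverse (1 + t\<^sup>2) + B\<^sup>2 * (exp (- (t\<^sup>2 / real T ^ 8)) * D t ^ 8)"
proof -
  define \<kappa> where "\<kappa> = real k"
  define E where "E = exp (- ((1 / real T ^ 4)\<^sup>2 * t\<^sup>2 / 2))"
  define F where "F = exp (- ((1 / real k ^ 3)\<^sup>2 * t\<^sup>2 / 2))"
  define R where "R = inverse (1 + t\<^sup>2)"
  have k1: "1 \<le> \<kappa>" using k by (simp add: \<kappa>_def)
  have Tk: "real T = 10 * \<kappa> ^ K" by (simp add: T \<kappa>_def)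
  have kK: "\<kappa> ^ 3 \<le> \<kappa> ^ K" using K k1 by (rule power_increasing)
  have T3: "\<kappa> ^ 3 \<le> real T" unfolding Tk using kK k1 by (smt (verit) one_le_power)
  have T0: "0 < real T" unfolding Tk using k1 by simp
  have T34: "\<kappa> ^ 3 \<le> real T ^ 4"
  proof -
    have "1 \<le> \<kappa> ^ 3" using k1 by simp
    hence "1 \<le> real T" using T3 by linarith
    hence "real T ^ 1 \<le> real T ^ 4" by (intro power_increasing) auto
    thus ?thesis using T3 by (simp only: power_one_right)
  qed
  have EE: "E\<^sup>2 = exp (- (t\<^sup>2 / real T ^ 8))"
    unfolding E_def by (simp add: power_divide flip: exp_of_nat_mult power_mult)
  have E1: "0 < E" "E \<le> 1" and F1: "0 < F" by (auto simp: E_def F_def)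
  have FE: "F \<le> E"
  proof -
    have "1 / real T ^ 4 \<le> 1 / \<kappa> ^ 3" using T34 k1 by (intro frac_le) auto
    hence "(1 / real T ^ 4)\<^sup>2 \<le> (1 / \<kappa> ^ 3)\<^sup>2" using T0 by (intro power_mono) auto
    hence "(1 / real T ^ 4)\<^sup>2 * t\<^sup>2 \<le> (1 / \<kappa> ^ 3)\<^sup>2 * t\<^sup>2" by (intro mult_right_mono) auto
    thus ?thesis by (simp add: E_def F_def \<kappa>_def)
  qed
  have wE: "(E - F)\<^sup>2 \<le> E\<^sup>2" using FE F1 by (intro power_mono) auto
  have w1: "(E - F)\<^sup>2 \<le> 1" using wE E1 by (smt (verit) power_le_one)
  have Q: "(D t ^ 4 * u t)\<^sup>2 = D t ^ 8 * (u t)\<^sup>2" by (simp add: power_mult_distrib flip: power_mult)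
  have u2: "(u t)\<^sup>2 \<le> 1" using U1 by (simp add: power_le_one)
  have D8: "D t ^ 8 \<le> 1" using D1 by (simp add: power_le_one)
  have Q1: "(D t ^ 4 * u t)\<^sup>2 \<le> 1" unfolding Q using u2 D8 by (intro mult_le_one) auto
  have R0: "0 < R" by (simp add: R_def add_pos_nonneg)
  have third: "0 \<le> B\<^sup>2 * (E\<^sup>2 * D t ^ 8)" using D1 by simp
  have firstnn: "0 \<le> 10 ^ 17 / \<kappa> ^ 6 * R" using R0 k1 by simp
  have Rt: "1 / t\<^sup>2 \<le> 2 * R" if "1 \<le> \<bar>t\<bar>"
  proof -
    have "1 \<le> t\<^sup>2" using that by (metis abs_le_square_iff abs_one one_power2)
    hence "2 / (2 * t\<^sup>2) \<le> 2 / (1 + t\<^sup>2)" by (intro frac_le) (auto intro: add_pos_nonneg)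
    thus ?thesis unfolding R_def inverse_eq_divide by simp
  qed
  have "(E - F)\<^sup>2 * (D t ^ 4 * u t)\<^sup>2 \<le> 10 ^ 17 / \<kappa> ^ 6 * R + B\<^sup>2 * (E\<^sup>2 * D t ^ 8)"
  proof -
    consider "\<bar>t\<bar> \<le> \<kappa>" | "\<kappa> < \<bar>t\<bar>" "\<bar>t\<bar> \<le> real T" | "real T < \<bar>t\<bar>" "\<bar>t\<bar> \<le> \<kappa> ^ (2 * J + 3)" | "\<kappa> ^ (2 * J + 3) < \<bar>t\<bar>"
      by linarith
    thus ?thesis
    proof cases
      \<comment> \<open>Here \<open>E - F <= t^2 / (2 * k^6) <= 1 / (2 * k^4)\<close>. The square
        leaves \<open>k^-8\<close>, of which \<open>k^-2\<close> pays for
        \<open>1 + t^2 <= 2 * k^2\<close>.\<close>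
      case 1
      have t2: "t\<^sup>2 \<le> \<kappa>\<^sup>2" using 1 k1 by (metis abs_le_square_iff abs_of_nonneg order_trans zero_le_one)
      have "1 + - ((1 / \<kappa> ^ 3)\<^sup>2 * t\<^sup>2 / 2) \<le> F" unfolding F_def \<kappa>_def by (rule exp_ge_add_one_self)
      hence "E - F \<le> (1 / \<kappa> ^ 3)\<^sup>2 * t\<^sup>2 / 2" using E1 by linarith
      also have "\<dots> \<le> (1 / \<kappa> ^ 3)\<^sup>2 * \<kappa>\<^sup>2 / 2" using t2 by (intro divide_right_mono mult_left_mono) auto
      also have "\<dots> = 1 / (2 * \<kappa> ^ 4)" using k1 by (simp add: field_simps flip: power_mult power_add)
      finally have "(E - F)\<^sup>2 \<le> (1 / (2 * \<kappa> ^ 4))\<^sup>2" using FE by (intro power_mono) auto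
      also have "\<dots> = 1 / (4 * \<kappa> ^ 8)" by (simp add: power_divide power_mult_distrib flip: power_mult)
      finally have a: "(E - F)\<^sup>2 \<le> 1 / (4 * \<kappa> ^ 8)" .
      have "1 + t\<^sup>2 \<le> 2 * \<kappa>\<^sup>2" using t2 one_le_power[OF k1, of 2] by linarith
      hence "1 / (2 * \<kappa>\<^sup>2) \<le> R" unfolding R_def inverse_eq_divide by (intro frac_le) (auto intro: add_pos_nonneg)
      hence "(1 / (2 * \<kappa>\<^sup>2)) * (10 ^ 17 / \<kappa> ^ 6) \<le> R * (10 ^ 17 / \<kappa> ^ 6)" using k1 by (intro mult_right_mono) auto
      moreover have "1 / (4 * \<kappa> ^ 8) \<le> (1 / (2 * \<kappa>\<^sup>2)) * (10 ^ 17 / \<kappa> ^ 6)"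
        using k1 by (simp add: divide_simps flip: power_add)
      ultimately have "(E - F)\<^sup>2 \<le> 10 ^ 17 / \<kappa> ^ 6 * R" using a by (simp add: mult.commute)
      moreover have "(E - F)\<^sup>2 * (D t ^ 4 * u t)\<^sup>2 \<le> (E - F)\<^sup>2 * 1" using Q1 by (intro mult_left_mono) auto
      ultimately show ?thesis using third by linarith
    next
      \<comment> \<open>Of the eight factors \<open>1 / |t|\<close>, six give \<open>k^-6\<close>
        and two give integrability.\<close>
      case 2
      have t1: "1 \<le> \<bar>t\<bar>" using 2 k1 by linarith
      have "(E - F)\<^sup>2 * (D t ^ 4 * u t)\<^sup>2 \<le> 1 * (D t ^ 8 * 1)"
        unfolding Q using w1 u2 D1 by (intro mult_mono) auto
      also have "\<dots> \<le> (48 / \<bar>t\<bar>) ^ 8" using D[OF t1 2(2)] D1 by (simp add: power_mono)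
      also have "\<dots> = 48 ^ 8 * (1 / \<bar>t\<bar> ^ 6) * (1 / t\<^sup>2)" by (simp add: power_divide power_add[of "\<bar>t\<bar>" 6 2, simplified])
      also have "\<dots> \<le> 48 ^ 8 * (1 / \<kappa> ^ 6) * (2 * R)"
        using 2 k1 Rt[OF t1] R0 by (intro mult_mono frac_le power_mono) auto
      also have "\<dots> = (2 * 48 ^ 8) / \<kappa> ^ 6 * R" by simp
      also have "\<dots> \<le> 10 ^ 17 / \<kappa> ^ 6 * R" using k1 R0 by (intro mult_right_mono divide_right_mono) auto
      finally show ?thesis using third by linarith
    next
      case 3
      have "u t \<le> B" using 3 T3 unfolding \<kappa>_def by (intro U) linarith+
      hence "(u t)\<^sup>2 \<le> B\<^sup>2" using U1 by (intro power_mono) auto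
      hence "(E - F)\<^sup>2 * (D t ^ 4 * u t)\<^sup>2 \<le> E\<^sup>2 * (D t ^ 8 * B\<^sup>2)"
        unfolding Q using wE D1 by (intro mult_mono) auto
      also have "\<dots> = B\<^sup>2 * (E\<^sup>2 * D t ^ 8)" by simp
      finally show ?thesis using firstnn by linarith
    next
      \<comment> \<open>Beyond the Weyl range the Gaussian decay
        \<open>E^2 <= 2 * T^16 / t^4\<close> suffices: by \<open>J = 5 * K\<close>,
        \<open>t^2\<close> exceeds \<open>k^(20 * K + 6)\<close>, whereas \<open>T^16\<close> is of
        order \<open>k^(16 * K)\<close>.\<close>
      case 4
      have p1: "1 \<le> \<kappa> ^ (2 * J + 3)" using k1 by (rule one_le_power)
      have t1: "1 \<le> \<bar>t\<bar>" using 4 p1 by linarith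
      define s where "s = t\<^sup>2 / real T ^ 8"
      have t20: "0 < t\<^sup>2" using t1 by auto
      have s0: "0 < s" using t20 T0 by (simp add: s_def)
      have "s\<^sup>2 / 2 \<le> exp s" using exp_lower_Taylor_quadratic[of s] s0 by simp
      hence "E\<^sup>2 \<le> 2 / s\<^sup>2" unfolding EE s_def[symmetric] using s0 by (simp add: exp_minus field_simps)
      also have "\<dots> = (2 * real T ^ 16 / t\<^sup>2) * (1 / t\<^sup>2)"
        using t20 T0 by (simp add: s_def power_divide power2_eq_square flip: power_add)
      also have "\<dots> \<le> (2 * real T ^ 16 / \<kappa> ^ (4 * J + 6)) * (2 * R)"
      proof (intro mult_mono frac_le)
        have "(\<kappa> ^ (2 * J + 3))\<^sup>2 \<le> \<bar>t\<bar>\<^sup>2" using 4 p1 by (intro power_mono) auto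
        thus "\<kappa> ^ (4 * J + 6) \<le> t\<^sup>2" by (simp flip: power_mult)
      qed (use Rt[OF t1] T0 k1 t20 in auto)
      also have "real T ^ 16 = 10 ^ 16 * \<kappa> ^ (16 * K)" unfolding Tk by (simp add: power_mult_distrib mult.commute flip: power_mult)
      also have "2 * (10 ^ 16 * \<kappa> ^ (16 * K)) / \<kappa> ^ (4 * J + 6) * (2 * R) = 4 * 10 ^ 16 * (\<kappa> ^ (16 * K) / \<kappa> ^ (20 * K)) / \<kappa> ^ 6 * R"
        by (simp add: J power_add)
      also have "\<dots> \<le> 4 * 10 ^ 16 * 1 / \<kappa> ^ 6 * R"
        using k1 R0 by (intro mult_right_mono divide_right_mono mult_left_mono) (auto intro!: power_increasing)
      also have "\<dots> \<le> 10 ^ 17 / \<kappa> ^ 6 * R" using k1 R0 by (intro mult_right_mono divide_right_mono) auto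
      finally have "E\<^sup>2 \<le> 10 ^ 17 / \<kappa> ^ 6 * R" .
      moreover have "(E - F)\<^sup>2 * (D t ^ 4 * u t)\<^sup>2 \<le> E\<^sup>2 * 1" using wE Q1 by (intro mult_mono) auto
      ultimately show ?thesis using third by linarith
    qed
  qed
  thus ?thesis unfolding EE unfolding E_def F_def R_def \<kappa>_def .
qed

text \<open>Solve for the last variable. Given \<open>a, b, c, xs\<close>, the real value
  \<open>E\<close> of \<open>d\<close> that would hit \<open>y\<close> exactly lies between
  \<open>1.19 * T\<close> and \<open>1.7 * T\<close>, because \<open>a, b, c\<close> are confined to
  \<open>(13 * M, 14 * M]\<close>, \<open>exp y <= 10/9\<close>, and the amplifier changes the
  fraction by a factor of at most \<open>101/100\<close>. The \<open>L\<close> integers ending at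
  the floor of \<open>E\<close> stay in \<open>(T, 2 * T]\<close> and all work. With
  \<open>L >= T * \<Delta> / 4\<close> and \<open>M = T / 10\<close> this produces the constant
  4000.\<close>

lemma card_log_frac_near_ge:
  fixes y \<Delta> N :: real
  assumes M: "M \<ge> 2" and T: "T = 10 * M" and y: "0 \<le> y" "y \<le> 1/10" and D: "\<Delta> \<le> 1/10" "8 \<le> real T * \<Delta>"
    and N: "0 < N" "100 * real (J * H) \<le> N"
  shows "\<Delta> / 4000 * (real T ^ 4 * real H ^ J) \<le> real (card {w \<in> quads T \<times> tuples J H. \<bar>y - log_frac N w\<bar> \<le> \<Delta>})"
proof -
  define A where "A = {13*M<..14*M}"
  define P where "P = (A \<times> A \<times> A) \<times> tuples J H"
  define E where "E = (\<lambda>((a, b, c), xs). exp y * (real a * real b / real c) * (N / (N + real (sum_list xs))))"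
  define L where "L = nat \<lceil>real T * \<Delta> / 4\<rceil>"
  define S where "S = (SIGMA p:P. {nat \<lfloor>E p\<rfloor> - L<..nat \<lfloor>E p\<rfloor>})"
  define h :: "((nat \<times> nat \<times> nat) \<times> nat list) \<times> nat \<Rightarrow> (nat \<times> nat \<times> nat \<times> nat) \<times> nat list"
    where "h = (\<lambda>(((a, b, c), xs), d). ((a, b, c, d), xs))"
  define T' where "T' = real T"
  have T20: "20 \<le> T'" using M by (simp add: T'_def T)
  have TM: "T' = 10 * real M" by (simp add: T'_def T)
  have D0: "0 < \<Delta>" using D(2) T20 unfolding T'_def[symmetric] by (smt (verit) mult_nonneg_nonpos)
  have ey: "1 \<le> exp y" "exp y \<le> 10/9"
  proof -
    show "1 \<le> exp y" using y by simp
    have "1 + - y \<le> exp (- y)" by (rule exp_ge_add_one_self)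
    hence "9/10 \<le> exp (- y)" using y by simp
    hence "exp y * (9/10) \<le> exp y * exp (- y)" by (intro mult_left_mono) auto
    thus "exp y \<le> 10/9" by (simp flip: exp_add)
  qed
  have Lb: "T' * \<Delta> / 4 \<le> real L" "real L \<le> T' * \<Delta> / 4 + 1"
    using D(2) unfolding L_def T'_def by linarith+
  have TD: "T' * \<Delta> \<le> T' / 10" "8 \<le> T' * \<Delta>" using D T20 unfolding T'_def[symmetric] by auto
  have Eb: "119/100 * T' \<le> E p" "E p \<le> 17/10 * T'" if "p \<in> P" for p
  proof -
    obtain a b c xs where p: "p = ((a, b, c), xs)" by (metis prod.exhaust)
    have xs: "xs \<in> tuples J H" using that by (simp add: p P_def)
    have s: "100 * real (sum_list xs) \<le> N" "0 \<le> real (sum_list xs)"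
      using of_nat_mono[OF sum_list_tuples_le[OF xs], where 'a = real] N by auto
    have abc: "13 * real M \<le> real a" "real a \<le> 14 * real M" "13 * real M \<le> real b" "real b \<le> 14 * real M" "13 * real M \<le> real c" "real c \<le> 14 * real M"
      using that by (auto simp: p P_def A_def)
    have M0: "0 < real M" using M by simp
    have c0: "0 < real c" using abc M0 by linarith
    have r: "100/101 \<le> N / (N + real (sum_list xs))" "N / (N + real (sum_list xs)) \<le> 1"
      using s N by (auto simp: field_simps)
    have "(13 * real M) * (13 * real M) / (14 * real M) \<le> real a * real b / real c"
      using abc M0 c0 by (intro frac_le mult_mono) auto
    hence q1: "169/14 * real M \<le> real a * real b / real c" using M0 by simp
    have "real a * real b / real c \<le> (14 * real M) * (14 * real M) / (13 * real M)"
      using abc M0 c0 by (intro frac_le mult_mono) auto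
    hence q2: "real a * real b / real c \<le> 196/13 * real M" using M0 by simp
    have "1 * (169/14 * real M) * (100/101) \<le> E p" unfolding E_def p prod.case
      using ey q1 r M0 by (intro mult_mono) auto
    thus "119/100 * T' \<le> E p" using TM M0 by simp
    have "E p \<le> (10/9) * (196/13 * real M) * 1" unfolding E_def p prod.case
      using ey q2 r M0 c0 N s by (intro mult_mono) auto
    thus "E p \<le> 17/10 * T'" using TM M0 by simp
  qed
  have LE: "L \<le> nat \<lfloor>E p\<rfloor>" if "p \<in> P" for p
  proof -
    have "real L \<le> E p" using Lb TD Eb[OF that] T20 by linarith
    thus ?thesis by linarith
  qed
  have sub: "h ` S \<subseteq> {w \<in> quads T \<times> tuples J H. \<bar>y - log_frac N w\<bar> \<le> \<Delta>}"
  proof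
    fix w assume "w \<in> h ` S"
    then obtain a b c xs d where w: "w = ((a, b, c, d), xs)" and pP: "((a, b, c), xs) \<in> P"
      and d: "d \<in> {nat \<lfloor>E ((a, b, c), xs)\<rfloor> - L<..nat \<lfloor>E ((a, b, c), xs)\<rfloor>}"
      by (auto simp: S_def h_def)
    define e where "e = E ((a, b, c), xs)"
    have eb: "119/100 * T' \<le> e" "e \<le> 17/10 * T'" using Eb[OF pP] by (auto simp: e_def)
    have xs: "xs \<in> tuples J H" using pP by (simp add: P_def)
    have abc: "a \<in> A" "b \<in> A" "c \<in> A" using pP by (auto simp: P_def)
    have d1: "real d \<le> e" "e < real d + real L"
      using d LE[OF pP] eb T20 unfolding e_def[symmetric] by (auto, linarith+)
    have dT: "T' < real d" using d1 eb Lb TD T20 by linarith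
    have d2: "d \<in> {T<..2*T}"
    proof -
      have "real d \<le> 2 * T'" using d1 eb T20 by linarith
      thus ?thesis using dT unfolding T'_def by auto
    qed
    have inq: "(a, b, c, d) \<in> quads T" using abc d2 by (auto simp: quads_def A_def T)
    have pos: "0 < real a" "0 < real b" "0 < real c" using abc M by (auto simp: A_def)
    have Np: "0 < N + real (sum_list xs)" using N by (simp add: add_pos_nonneg)
    have e0: "0 < e" using eb T20 by linarith
    have d0: "0 < real d" using dT T20 by linarith
    have lne: "ln e = y + (ln (real a) + ln (real b) - ln (real c)) + (ln N - ln (N + real (sum_list xs)))"
      unfolding e_def E_def prod.case using pos N Np by (simp add: ln_mult ln_div)
    have "y - log_frac N w = ln e - ln (real d)" unfolding lne w log_frac_def by simp
    moreover have "ln (real d) \<le> ln e" using d1 d0 by simp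
    moreover have "ln e - ln (real d) \<le> \<Delta>"
    proof -
      have "ln e - ln (real d) = ln (e / real d)" using e0 d0 by (simp add: ln_div)
      also have "\<dots> \<le> e / real d - 1" using e0 d0 by (intro ln_le_minus_one) auto
      also have "\<dots> = (e - real d) / real d" using d0 by (simp add: field_simps)
      also have "\<dots> \<le> (T' * \<Delta>) / T'" using d1 dT Lb TD T20 by (intro frac_le) linarith+
      also have "\<dots> = \<Delta>" using T20 by simp
      finally show ?thesis .
    qed
    ultimately show "w \<in> {w \<in> quads T \<times> tuples J H. \<bar>y - log_frac N w\<bar> \<le> \<Delta>}"
      using inq xs w by simp
  qed
  have inj: "inj_on h S" by (auto simp: inj_on_def h_def)
  have finP: "finite P" by (simp add: P_def A_def)
  have "card S = (\<Sum>p\<in>P. card {nat \<lfloor>E p\<rfloor> - L<..nat \<lfloor>E p\<rfloor>})"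
    unfolding S_def using finP by simp
  also have "\<dots> = (\<Sum>p\<in>P. L)" using LE by (intro sum.cong) auto
  also have "\<dots> = M ^ 3 * H ^ J * L" by (simp add: P_def A_def card_cartesian_product power3_eq_cube)
  finally have cS: "card S = M ^ 3 * H ^ J * L" .
  have "\<Delta> / 4000 * (real T ^ 4 * real H ^ J) = real M ^ 3 * real H ^ J * (T' * \<Delta> / 4)"
    unfolding T'_def[symmetric] TM by (simp add: power_mult_distrib power4_eq_xxxx power3_eq_cube)
  also have "\<dots> \<le> real M ^ 3 * real H ^ J * real L" using Lb by (intro mult_left_mono) auto
  also have "\<dots> = real (card (h ` S))" using cS card_image[OF inj] by simp
  also have "\<dots> \<le> real (card {w \<in> quads T \<times> tuples J H. \<bar>y - log_frac N w\<bar> \<le> \<Delta>})"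
    unfolding of_nat_le_iff by (rule card_mono[OF _ sub]) simp
  finally show ?thesis .
qed

section \<open>Measure of the exceptional set\<close>

lemma normal_density_ge_near:
  assumes "0 < \<Delta>" "\<bar>y - z\<bar> \<le> \<Delta>"
  shows "1 / (6 * \<Delta>) \<le> normal_density z \<Delta> y"
proof -
  have "(y - z)\<^sup>2 \<le> \<Delta>\<^sup>2" using assms by (metis abs_le_square_iff abs_of_pos)
  hence "- (1/2) \<le> - (y - z)\<^sup>2 / (2 * \<Delta>\<^sup>2)" using assms by (simp add: field_simps)
  hence "exp (- (1/2)) \<le> exp (- (y - z)\<^sup>2 / (2 * \<Delta>\<^sup>2))" by simp
  moreover have "1 + - (1/2) \<le> exp (- (1/2) :: real)" by (rule exp_ge_add_one_self)
  ultimately have e: "1/2 \<le> exp (- (y - z)\<^sup>2 / (2 * \<Delta>\<^sup>2))" by linarith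
  have "sqrt (2 * pi * \<Delta>\<^sup>2) \<le> sqrt (9 * \<Delta>\<^sup>2)"
    using pi_less_4 by (intro real_sqrt_le_mono mult_right_mono) auto
  also have "\<dots> = 3 * \<Delta>" using assms by (simp add: real_sqrt_mult)
  finally have s: "1 / (3 * \<Delta>) \<le> 1 / sqrt (2 * pi * \<Delta>\<^sup>2)" using assms by (intro frac_le) auto
  have "1 / (3 * \<Delta>) * (1/2) \<le> 1 / sqrt (2 * pi * \<Delta>\<^sup>2) * exp (- (y - z)\<^sup>2 / (2 * \<Delta>\<^sup>2))"
    using s e assms by (intro mult_mono) auto
  thus ?thesis by (simp add: normal_density_def)
qed

lemma normal_density_le_far:
  assumes "0 < \<delta>" "0 \<le> k" "k * \<delta> \<le> \<bar>y - z\<bar>"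
  shows "normal_density z \<delta> y \<le> 1 / \<delta> * exp (- (k\<^sup>2 / 2))"
proof -
  have "(k * \<delta>)\<^sup>2 \<le> (y - z)\<^sup>2" using assms by (metis abs_le_square_iff abs_mult abs_of_nonneg less_imp_le)
  hence e: "exp (- (y - z)\<^sup>2 / (2 * \<delta>\<^sup>2)) \<le> exp (- (k\<^sup>2 / 2))" using assms by (simp add: field_simps)
  have "sqrt (1 * \<delta>\<^sup>2) \<le> sqrt (2 * pi * \<delta>\<^sup>2)"
    using pi_gt3 by (intro real_sqrt_le_mono mult_right_mono) auto
  hence "1 / sqrt (2 * pi * \<delta>\<^sup>2) \<le> 1 / \<delta>" using assms by (intro frac_le) auto
  thus ?thesis unfolding normal_density_def using e assms by (intro mult_mono) auto
qed

text \<open>The radius is \<open>k\<close> standard deviations of the narrow Gaussian \<delta> =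
  \<open>1 / T^4\<close>, \<open>T = 10 * k ^ K\<close>. On this set the narrow smoothing therefore
  carries a factor \<open>exp (- k^2 / 2)\<close>, which beats every power of
  \<open>k\<close>.\<close>

definition bad_set :: "nat \<Rightarrow> nat \<Rightarrow> real set" where
  "bad_set K k = {y \<in> {0..1/10}. \<forall>w \<in> quads (10 * k ^ K) \<times> tuples (5 * K) (k ^ 4).
     real k / real (10 * k ^ K) ^ 4 < \<bar>y - log_frac (real (k ^ 6)) w\<bar>}"

lemma bad_set_measurable [measurable]: "bad_set K k \<in> sets borel"
proof -
  define W where "W = quads (10 * k ^ K) \<times> tuples (5 * K) (k ^ 4)"
  have "bad_set K k = {0..1/10} \<inter> (\<Inter>w\<in>W. {y. real k / real (10 * k ^ K) ^ 4 < \<bar>y - log_frac (real (k ^ 6)) w\<bar>})"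
    by (auto simp: bad_set_def W_def)
  moreover have "open (\<Inter>w\<in>W. {y. real k / real (10 * k ^ K) ^ 4 < \<bar>y - log_frac (real (k ^ 6)) w\<bar>})"
    by (intro open_INT ballI open_Collect_less continuous_intros) (simp add: W_def)
  ultimately show ?thesis by (simp add: borel_closed borel_open sets.Int)
qed

lemma has_bochner_integral_mono:
  fixes f g :: "'a \<Rightarrow> real"
  assumes "has_bochner_integral M f a" "has_bochner_integral M g b" "\<And>x. f x \<le> g x"
  shows "a \<le> b"
  using assms integral_mono[of M f g] by (simp add: has_bochner_integral_iff)

text \<open>Chebyshev's inequality for the difference of the two smoothings of \<open>n\<close>
  points. On the bad set the wide one is at least \<open>n / 24000\<close> (at least
  \<open>\<Delta> / 4000 * n\<close> points, each contributing \<open>1 / (6 * \<Delta>)\<close> or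
  more) and the narrow one at most \<open>n / 48000\<close> by \<open>tail\<close>. So the
  difference is at least \<open>n / 48000\<close> in modulus, and its square integral
  \<open>V\<close> controls the measure.\<close>

lemma measure_bad_set_le:
  assumes K: "K \<ge> 4" and k: "k \<ge> 10" and kK: "500 * K \<le> k"
    and tail: "real (10 * k ^ K) ^ 4 * exp (- ((real k)\<^sup>2 / 2)) \<le> 1 / 48000"
    and U: "\<And>t. real k ^ 3 \<le> \<bar>t\<bar> \<Longrightarrow> \<bar>t\<bar> \<le> real k ^ (2 * (5 * K) + 3) \<Longrightarrow>
       cmod (wsum (5 * K) (k ^ 4) (\<lambda>x. t * ln (real (k ^ 6) + real x))) \<le> B * real (k ^ 4) ^ (5 * K)"
    and B: "0 \<le> B"
    and r: "\<And>n. 0 < n \<Longrightarrow> n \<le> 16 * (10 * k ^ K) ^ 4 \<Longrightarrow> real (card {d. d dvd n}) ^ 4 \<le> r"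
  shows "measure lborel (bad_set K k) \<le> 48000\<^sup>2 * (10 ^ 17 * pi / real k ^ 6
     + B\<^sup>2 * (2 * sqrt pi * (\<Sum>i::nat. exp (- ((real i)\<^sup>2 / 1024))) * r))"
proof -
  define T where "T = 10 * k ^ K"
  define J where "J = 5 * K"
  define H where "H = k ^ 4"
  define N where "N = real (k ^ 6)"
  define \<delta> where "\<delta> = 1 / real T ^ 4"
  define \<Delta> where "\<Delta> = 1 / real k ^ 3"
  define \<Omega> where "\<Omega> = quads T \<times> tuples J H"
  define n where "n = real T ^ 4 * real H ^ J"
  define G where "G = bad_set K k"
  define c where "c = 2 * sqrt pi * (\<Sum>i::nat. exp (- ((real i)\<^sup>2 / 1024)))"
  have k1: "1 \<le> k" using k by simp
  have kp: "0 < real k" using k1 by simp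
  have T1: "1 \<le> T" using k1 by (simp add: T_def)
  have T0: "0 < real T" using T1 by simp
  have H0: "0 < real H" using k1 by (simp add: H_def)
  have n0: "0 < n" using T0 H0 by (simp add: n_def)
  have pos: "0 < \<delta>" "0 < \<Delta>" using T0 kp by (auto simp: \<delta>_def \<Delta>_def)
  have cardO: "real (card \<Omega>) = n" by (simp add: \<Omega>_def n_def card_cartesian_product)
  have finO: "finite \<Omega>" by (simp add: \<Omega>_def)
  define x where "x = log_frac N"
  obtain V where V: "has_bochner_integral lborel (\<lambda>y. (\<Sum>w\<in>\<Omega>. normal_density (x w) \<delta> y - normal_density (x w) \<Delta> y)\<^sup>2) V"
    and V2: "has_bochner_integral lborel (\<lambda>t. (exp (- (\<delta>\<^sup>2 * t\<^sup>2 / 2)) - exp (- (\<Delta>\<^sup>2 * t\<^sup>2 / 2)))\<^sup>2 * (cmod (\<Sum>w\<in>\<Omega>. cis (t * x w)))\<^sup>2) (2 * pi * V)"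
    using gaussian_mixture_plancherel[OF finO pos, of x] by blast
  define D where "D t = cmod (\<Sum>n\<in>{T<..2*T}. cis (t * ln (real n))) / real T" for t
  define u where "u t = cmod (wsum J H (\<lambda>x. t * ln (N + real x))) / real H ^ J" for t
  have chi: "cmod (\<Sum>w\<in>\<Omega>. cis (t * x w)) = n * (D t ^ 4 * u t)" for t
    using T0 H0 unfolding \<Omega>_def x_def norm_sum_cis_log_frac n_def D_def u_def
    by (simp add: power_divide)
  have "real (card {q \<in> quads T. qprod q = m}) \<le> r" if m: "0 < m" "m \<le> 16 * T ^ 4" for m
  proof -
    have "real (card {q \<in> quads T. qprod q = m}) \<le> real (card {d. d dvd m} ^ 4)"
      unfolding of_nat_le_iff by (rule card_qprod_fibre_le)
    also have "\<dots> \<le> r" using r[OF m(1)] m(2) unfolding T_def by simp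
    finally show ?thesis .
  qed
  from dirichlet_eighth_moment[OF T1 this] obtain I where
    I: "has_bochner_integral lborel (\<lambda>t. exp (- (t\<^sup>2 / real T ^ 8)) * cmod (\<Sum>n\<in>{T<..2*T}. cis (t * ln (real n))) ^ 8) I"
    and Ile: "I \<le> c * r * real T ^ 8" unfolding c_def by blast
  have I2: "has_bochner_integral lborel (\<lambda>t. exp (- (t\<^sup>2 / real T ^ 8)) * D t ^ 8) (I / real T ^ 8)"
    using has_bochner_integral_divide_zero[OF I, of "real T ^ 8"] by (simp add: D_def power_divide)
  have bound: "has_bochner_integral lborel (\<lambda>t. n\<^sup>2 * (10 ^ 17 / real k ^ 6 * inverse (1 + t\<^sup>2) + B\<^sup>2 * (exp (- (t\<^sup>2 / real T ^ 8)) * D t ^ 8)))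
     (n\<^sup>2 * (10 ^ 17 / real k ^ 6 * pi + B\<^sup>2 * (I / real T ^ 8)))"
    by (intro has_bochner_integral_mult_right has_bochner_integral_add has_bochner_integral_inverse_1_plus_square I2)
  have Dle: "D t \<le> 1" for t
  proof -
    have "cmod (\<Sum>n\<in>{T<..2*T}. cis (t * ln (real n))) \<le> (\<Sum>n\<in>{T<..2*T}. 1)"
      by (rule order_trans[OF norm_sum]) simp
    thus ?thesis using T0 by (simp add: D_def)
  qed
  have pw: "(exp (- (\<delta>\<^sup>2 * t\<^sup>2 / 2)) - exp (- (\<Delta>\<^sup>2 * t\<^sup>2 / 2)))\<^sup>2 * (cmod (\<Sum>w\<in>\<Omega>. cis (t * x w)))\<^sup>2
     \<le> n\<^sup>2 * (10 ^ 17 / real k ^ 6 * inverse (1 + t\<^sup>2) + B\<^sup>2 * (exp (- (t\<^sup>2 / real T ^ 8)) * D t ^ 8))" for t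
  proof -
    have "(exp (- ((1 / real T ^ 4)\<^sup>2 * t\<^sup>2 / 2)) - exp (- ((1 / real k ^ 3)\<^sup>2 * t\<^sup>2 / 2)))\<^sup>2 * (D t ^ 4 * u t)\<^sup>2
      \<le> 10 ^ 17 / real k ^ 6 * inverse (1 + t\<^sup>2) + B\<^sup>2 * (exp (- (t\<^sup>2 / real T ^ 8)) * D t ^ 8)"
    proof (rule gaussian_mixture_pointwise_bound[OF _ k1 T_def J_def _ _ _ B])
      show "3 \<le> K" using K by simp
      show "u t \<le> B" if "real k ^ 3 \<le> \<bar>t\<bar>" "\<bar>t\<bar> \<le> real k ^ (2 * J + 3)" for t
        using U[of t] that H0 unfolding u_def J_def H_def N_def by (simp add: divide_le_eq)
      show "0 \<le> u t" for t using H0 by (simp add: u_def)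
      show "u t \<le> 1" for t using H0 norm_wsum_le[of J H "\<lambda>x. t * ln (N + real x)"] by (simp add: u_def)
      show "0 \<le> D t" for t by (simp add: D_def)
      show "D t \<le> 1" for t by (rule Dle)
      show "D t \<le> 48 / \<bar>t\<bar>" if t: "1 \<le> \<bar>t\<bar>" "\<bar>t\<bar> \<le> real T" for t
      proof -
        have "D t \<le> (48 * real T / \<bar>t\<bar>) / real T" unfolding D_def
          using norm_sum_cis_ln_le[OF T1 t] T0 by (intro divide_right_mono) auto
        thus ?thesis using T0 by simp
      qed
    qed
    hence "n\<^sup>2 * ((exp (- (\<delta>\<^sup>2 * t\<^sup>2 / 2)) - exp (- (\<Delta>\<^sup>2 * t\<^sup>2 / 2)))\<^sup>2 * (D t ^ 4 * u t)\<^sup>2)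
      \<le> n\<^sup>2 * (10 ^ 17 / real k ^ 6 * inverse (1 + t\<^sup>2) + B\<^sup>2 * (exp (- (t\<^sup>2 / real T ^ 8)) * D t ^ 8))"
      unfolding \<delta>_def \<Delta>_def by (intro mult_left_mono) auto
    thus ?thesis unfolding chi by (simp add: power_mult_distrib mult_ac)
  qed
  have "2 * pi * V \<le> n\<^sup>2 * (10 ^ 17 / real k ^ 6 * pi + B\<^sup>2 * (I / real T ^ 8))"
    by (rule has_bochner_integral_mono[OF V2 bound pw])
  also have "\<dots> \<le> n\<^sup>2 * (10 ^ 17 / real k ^ 6 * pi + B\<^sup>2 * (c * r))"
    using Ile T0 by (intro mult_left_mono add_left_mono) (auto simp: divide_le_eq)
  finally have V3: "2 * pi * V \<le> n\<^sup>2 * (10 ^ 17 / real k ^ 6 * pi + B\<^sup>2 * (c * r))" .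
  have lower: "(n / 48000)\<^sup>2 * indicator G y \<le> (\<Sum>w\<in>\<Omega>. normal_density (x w) \<delta> y - normal_density (x w) \<Delta> y)\<^sup>2" for y
  proof (cases "y \<in> G")
    case True
    hence y: "0 \<le> y" "y \<le> 1/10" and far: "\<And>w. w \<in> \<Omega> \<Longrightarrow> real k * \<delta> \<le> \<bar>y - x w\<bar>"
      unfolding G_def bad_set_def \<Omega>_def x_def \<delta>_def T_def J_def H_def N_def by (auto simp: less_imp_le)
    have a: "(\<Sum>w\<in>\<Omega>. normal_density (x w) \<delta> y) \<le> n / 48000"
    proof -
      have "(\<Sum>w\<in>\<Omega>. normal_density (x w) \<delta> y) \<le> (\<Sum>w\<in>\<Omega>. 1 / \<delta> * exp (- ((real k)\<^sup>2 / 2)))"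
        using far pos by (intro sum_mono normal_density_le_far) auto
      also have "\<dots> = n * (real T ^ 4 * exp (- ((real k)\<^sup>2 / 2)))" by (simp add: cardO \<delta>_def)
      also have "\<dots> \<le> n * (1 / 48000)" using tail n0 unfolding T_def by (intro mult_left_mono) auto
      finally show ?thesis by simp
    qed
    have b: "n / 24000 \<le> (\<Sum>w\<in>\<Omega>. normal_density (x w) \<Delta> y)"
    proof -
      define S where "S = {w \<in> \<Omega>. \<bar>y - x w\<bar> \<le> \<Delta>}"
      have "\<Delta> / 4000 * n \<le> real (card S)" unfolding S_def n_def \<Omega>_def x_def
      proof (rule card_log_frac_near_ge[where M = "k ^ K"])
        show "2 \<le> k ^ K"
        proof -
          have "k ^ 1 \<le> k ^ K" using K k1 by (intro power_increasing) auto
          thus ?thesis using k by simp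
        qed
        have "10 ^ 3 \<le> real k ^ 3" using k by (intro power_mono) auto
        thus "\<Delta> \<le> 1 / 10" unfolding \<Delta>_def by (intro frac_le) auto
        have "real k ^ 3 \<le> real k ^ K" using K k1 by (intro power_increasing) auto
        hence "8 * real k ^ 3 \<le> 10 * real k ^ K" using zero_le_power[of "real k" K] kp by linarith
        hence "8 * real k ^ 3 \<le> real T" by (simp add: T_def)
        thus "8 \<le> real T * \<Delta>" using kp by (simp add: \<Delta>_def field_simps)
        show "0 < N" using kp by (simp add: N_def)
        have "100 * (J * H) = (500 * K) * k ^ 4" by (simp add: J_def H_def)
        also have "\<dots> \<le> k * k ^ 4" using kK by (rule mult_right_mono) simp
        also have "\<dots> = k ^ 5" by (simp add: eval_nat_numeral)
        also have "\<dots> \<le> k ^ 6" using k1 by (intro power_increasing) auto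
        finally have "real (100 * (J * H)) \<le> real (k ^ 6)" unfolding of_nat_le_iff .
        thus "100 * real (J * H) \<le> N" by (simp add: N_def)
      qed (use y T_def in auto)
      hence "(\<Delta> / 4000 * n) * (1 / (6 * \<Delta>)) \<le> real (card S) * (1 / (6 * \<Delta>))"
        using pos by (intro mult_right_mono) auto
      hence "n / 24000 \<le> (\<Sum>w\<in>S. 1 / (6 * \<Delta>))" using pos by simp
      also have "\<dots> \<le> (\<Sum>w\<in>S. normal_density (x w) \<Delta> y)"
        using pos by (intro sum_mono normal_density_ge_near) (auto simp: S_def)
      also have "\<dots> \<le> (\<Sum>w\<in>\<Omega>. normal_density (x w) \<Delta> y)"
        using finO by (intro sum_mono2) (auto simp: S_def)
      finally show ?thesis .
    qed
    have "n / 48000 \<le> - (\<Sum>w\<in>\<Omega>. normal_density (x w) \<delta> y - normal_density (x w) \<Delta> y)"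
      using a b by (simp add: sum_subtractf)
    hence "(n / 48000)\<^sup>2 \<le> (- (\<Sum>w\<in>\<Omega>. normal_density (x w) \<delta> y - normal_density (x w) \<Delta> y))\<^sup>2"
      using n0 by (intro power_mono) auto
    thus ?thesis using True by simp
  qed simp
  have Gfin: "emeasure lborel G < \<infinity>"
  proof -
    have "emeasure lborel G \<le> emeasure lborel {0..1/10::real}"
      unfolding G_def by (intro emeasure_mono) (auto simp: bad_set_def)
    also have "\<dots> < \<infinity>" by simp
    finally show ?thesis .
  qed
  have Gint: "has_bochner_integral lborel (\<lambda>y. (n / 48000)\<^sup>2 * indicator G y) ((n / 48000)\<^sup>2 * measure lborel G)"
    using Gfin by (intro has_bochner_integral_mult_right has_bochner_integral_real_indicator) (auto simp: G_def)
  have "(n / 48000)\<^sup>2 * measure lborel G \<le> V"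
    by (rule has_bochner_integral_mono[OF Gint V lower])
  hence "measure lborel G \<le> 48000\<^sup>2 * (V / n\<^sup>2)" using n0 by (simp add: field_simps power_divide)
  also have "V / n\<^sup>2 \<le> 10 ^ 17 / real k ^ 6 * pi + B\<^sup>2 * (c * r)"
  proof -
    have "0 \<le> V" using Gint has_bochner_integral_mono[OF Gint V lower] n0
      by (meson measure_nonneg mult_nonneg_nonneg order_trans zero_le_power2)
    hence "1 * V \<le> 2 * pi * V" using pi_gt3 by (intro mult_right_mono) auto
    hence "V \<le> n\<^sup>2 * (10 ^ 17 / real k ^ 6 * pi + B\<^sup>2 * (c * r))" using V3 by linarith
    thus ?thesis using n0 by (simp add: divide_le_eq mult.commute)
  qed
  finally show ?thesis unfolding G_def c_def by simp
qed

lemma power_exp_tail: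
  "\<exists>k0. \<forall>k\<ge>k0. real (10 * k ^ K) ^ 4 * exp (- ((real k)\<^sup>2 / 2)) \<le> 1 / 48000"
proof -
  have "((\<lambda>k. real k ^ (4 * K) / exp (real k)) \<longlongrightarrow> 0) sequentially"
    by (rule filterlim_compose[OF tendsto_power_div_exp_0 filterlim_real_sequentially])
  hence "eventually (\<lambda>k. real k ^ (4 * K) / exp (real k) < 1 / 480000000) sequentially"
    by (rule order_tendstoD) simp
  then obtain k0 where k0: "\<And>k. k \<ge> k0 \<Longrightarrow> real k ^ (4 * K) / exp (real k) < 1 / 480000000"
    by (auto simp: eventually_sequentially)
  show ?thesis
  proof (intro exI[of _ "max k0 2"] allI impI)
    fix k assume k: "max k0 2 \<le> k"
    have "2 * real k \<le> real k * real k" using k by (intro mult_right_mono) auto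
    hence e: "exp (- ((real k)\<^sup>2 / 2)) \<le> exp (- real k)" by (simp add: power2_eq_square)
    have "real (10 * k ^ K) ^ 4 * exp (- ((real k)\<^sup>2 / 2)) \<le> real (10 * k ^ K) ^ 4 * exp (- real k)"
      using e by (intro mult_left_mono) auto
    also have "\<dots> = 10000 * (real k ^ (4 * K) / exp (real k))"
      by (simp add: power_mult_distrib exp_minus divide_inverse mult.commute flip: power_mult)
    also have "\<dots> \<le> 1 / 48000" using k0[of k] k by simp
    finally show "real (10 * k ^ K) ^ 4 * exp (- ((real k)\<^sup>2 / 2)) \<le> 1 / 48000" .
  qed
qed

lemma measure_bad_set_power_saving:
  assumes K: "K \<ge> 4"
  shows "\<exists>C g k0. 0 < g \<and> (\<forall>k\<ge>k0. measure lborel (bad_set K k) \<le> C * real k powr (- g))"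
proof -
  define J where "J = 5 * K"
  have J: "J \<ge> 1" using K by (simp add: J_def)
  define g :: real where "g = 1 / 4 ^ J"
  have g0: "0 < g" "g \<le> 1" by (auto simp: g_def)
  obtain C1 where C1: "C1 > 0" and U: "\<And>k t. k \<ge> fact J + (J + 1) * 2 ^ (J + 1) \<Longrightarrow>
     real k ^ 3 \<le> \<bar>t\<bar> \<Longrightarrow> \<bar>t\<bar> \<le> real k ^ (2 * J + 3) \<Longrightarrow>
     cmod (wsum J (k ^ 4) (\<lambda>x. t * ln (real (k ^ 6) + real x))) \<le> C1 * real (k ^ 4) ^ J * real k powr (- g)"
    using norm_wsum_ln_power_saving[OF J] unfolding g_def by blast
  \<comment> \<open>As \<open>n <= 160000 * k^(4 * K)\<close>, this makes \<open>n powr e\<close> of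
    order \<open>k powr (g / 4)\<close>. The fourth power of the divisor function then costs
    \<open>k powr g\<close>, and \<open>B^2 * r\<close> keeps \<open>k powr (- g)\<close> out of
    \<open>k powr (- 2 * g)\<close>.\<close>
  define e where "e = g / (16 * real K)"
  have e0: "0 < e" using g0 K by (simp add: e_def)
  obtain Cd where Cd: "Cd \<ge> 1" and dv: "\<And>n::nat. n > 0 \<Longrightarrow> real (card {d. d dvd n}) \<le> Cd * real n powr e"
    using card_divisors_le_powr[OF e0] by blast
  obtain k1 where tail: "\<And>k. k \<ge> k1 \<Longrightarrow> real (10 * k ^ K) ^ 4 * exp (- ((real k)\<^sup>2 / 2)) \<le> 1 / 48000"
    using power_exp_tail[of K] by blast
  define R where "R = Cd ^ 4 * (160000 powr e) ^ 4"
  define c where "c = 2 * sqrt pi * (\<Sum>i::nat. exp (- ((real i)\<^sup>2 / 1024)))"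
  define k0 where "k0 = fact J + (J + 1) * 2 ^ (J + 1) + k1 + 10 + 500 * K"
  show ?thesis
  proof (rule exI[of _ "48000\<^sup>2 * (10 ^ 17 * pi + C1\<^sup>2 * (c * R))"], rule exI[of _ g], rule exI[of _ k0],
      intro conjI allI impI g0)
    fix k assume k: "k0 \<le> k"
    have kk: "k \<ge> fact J + (J + 1) * 2 ^ (J + 1)" "k \<ge> k1" "k \<ge> 10" "500 * K \<le> k"
      using k unfolding k0_def by linarith+
    have kp: "0 < real k" "1 \<le> real k" using kk by auto
    define r where "r = R * real k powr g"
    define B where "B = C1 * real k powr (- g)"
    have "measure lborel (bad_set K k) \<le> 48000\<^sup>2 * (10 ^ 17 * pi / real k ^ 6
     + B\<^sup>2 * (2 * sqrt pi * (\<Sum>i::nat. exp (- ((real i)\<^sup>2 / 1024))) * r))"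
    proof (rule measure_bad_set_le[OF K kk(3,4) tail[OF kk(2)]])
      fix t assume t: "real k ^ 3 \<le> \<bar>t\<bar>" "\<bar>t\<bar> \<le> real k ^ (2 * (5 * K) + 3)"
      show "cmod (wsum (5 * K) (k ^ 4) (\<lambda>x. t * ln (real (k ^ 6) + real x))) \<le> B * real (k ^ 4) ^ (5 * K)"
        using U[OF kk(1), of t] t unfolding J_def B_def by (simp only: mult_ac)
    next
      show "0 \<le> B" using C1 by (simp add: B_def)
    next
      fix n :: nat assume n: "0 < n" "n \<le> 16 * (10 * k ^ K) ^ 4"
      have "real n \<le> real (16 * (10 * k ^ K) ^ 4)" using n(2) unfolding of_nat_le_iff .
      also have "\<dots> = 160000 * real k ^ (4 * K)" by (simp add: power_mult_distrib mult.commute flip: power_mult)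
      finally have nle: "real n \<le> 160000 * real k ^ (4 * K)" .
      have "real (card {d. d dvd n}) \<le> Cd * real n powr e" by (rule dv[OF n(1)])
      also have "\<dots> \<le> Cd * (160000 * real k ^ (4 * K)) powr e"
        using nle Cd e0 by (intro mult_left_mono powr_mono2) auto
      also have "(160000 * real k ^ (4 * K)) powr e = 160000 powr e * real k powr (g / 4)"
      proof -
        have "(real k ^ (4 * K)) powr e = real k powr (real (4 * K) * e)"
          using kp by (simp add: powr_powr flip: powr_realpow)
        also have "real (4 * K) * e = g / 4" using K by (simp add: e_def)
        finally show ?thesis using kp by (simp add: powr_mult)
      qed
      finally have "real (card {d. d dvd n}) ^ 4 \<le> (Cd * (160000 powr e * real k powr (g / 4))) ^ 4"
        by (rule power_mono) simp
      also have "\<dots> = R * (real k powr (g / 4)) ^ 4" by (simp add: R_def power_mult_distrib)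
      also have "(real k powr (g / 4)) ^ 4 = real k powr g" using kp by (simp add: powr_powr flip: powr_realpow)
      finally show "real (card {d. d dvd n}) ^ 4 \<le> r" by (simp add: r_def)
    qed
    also have "\<dots> = 48000\<^sup>2 * (10 ^ 17 * pi / real k ^ 6 + (C1\<^sup>2 * (c * R)) * real k powr (- g))"
    proof -
      have "B\<^sup>2 * r = C1\<^sup>2 * R * ((real k powr (- g))\<^sup>2 * real k powr g)"
        by (simp add: B_def r_def power_mult_distrib)
      also have "(real k powr (- g))\<^sup>2 * real k powr g = real k powr (- g)"
        using kp by (simp add: power2_eq_square flip: powr_add)
      finally have "B\<^sup>2 * (c * r) = (C1\<^sup>2 * (c * R)) * real k powr (- g)"
        by (metis (no_types, opaque_lifting) mult.assoc mult.left_commute)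
      thus ?thesis unfolding c_def by simp
    qed
    also have "\<dots> \<le> 48000\<^sup>2 * (10 ^ 17 * pi * real k powr (- g) + (C1\<^sup>2 * (c * R)) * real k powr (- g))"
    proof (intro mult_left_mono add_right_mono)
      have "1 / real k ^ 6 = real k powr (- 6)" using kp by (simp add: powr_minus_divide)
      also have "\<dots> \<le> real k powr (- g)" using kp g0 by (intro powr_mono) auto
      finally have "10 ^ 17 * pi * (1 / real k ^ 6) \<le> 10 ^ 17 * pi * real k powr (- g)" by (intro mult_left_mono) auto
      thus "10 ^ 17 * pi / real k ^ 6 \<le> 10 ^ 17 * pi * real k powr (- g)" by simp
    qed auto
    finally show "measure lborel (bad_set K k) \<le> 48000\<^sup>2 * (10 ^ 17 * pi + C1\<^sup>2 * (c * R)) * real k powr (- g)"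
      by (simp only: mult.assoc distrib_right)
  qed
qed

text \<open>Restricting to \<open>k = 2^i\<close> makes \<open>k powr (- g)\<close> summable however
  small \<open>g\<close> is. The gaps between these scales cost a factor depending only on
  \<open>K\<close>, which later goes into the constant.\<close>

lemma AE_eventually_not_bad:
  assumes K: "K \<ge> 4"
  shows "AE y in lborel. eventually (\<lambda>i. y \<notin> bad_set K (2 ^ i)) sequentially"
proof -
  obtain C g k0 where g: "0 < g" and b: "\<And>k. k \<ge> k0 \<Longrightarrow> measure lborel (bad_set K k) \<le> C * real k powr (- g)"
    using measure_bad_set_power_saving[OF K] by blast
  have "AE y in lborel. eventually (\<lambda>i. y \<in> space lborel - bad_set K (2 ^ i)) sequentially"
  proof (rule borel_cantelli_AE1)
    show "bad_set K (2 ^ i) \<in> sets lborel" for i by simp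
    show "emeasure lborel (bad_set K (2 ^ i)) < \<infinity>" for i
    proof -
      have "emeasure lborel (bad_set K (2 ^ i)) \<le> emeasure lborel {0..1/10::real}"
        by (intro emeasure_mono) (auto simp: bad_set_def)
      also have "\<dots> < \<infinity>" by simp
      finally show ?thesis .
    qed
    show "summable (\<lambda>i. measure lborel (bad_set K (2 ^ i)))"
    proof (rule summable_comparison_test')
      show "summable (\<lambda>i. C * (2 powr (- g)) ^ i)"
        using g by (intro summable_mult summable_geometric) (simp add: powr_less_one)
      fix i assume i: "i \<ge> k0"
      have "i \<le> 2 ^ i" using less_exp[of i] by simp
      hence "measure lborel (bad_set K (2 ^ i)) \<le> C * real (2 ^ i) powr (- g)" using i by (intro b) linarith
      also have "real (2 ^ i) powr (- g) = (2 powr (- g)) ^ i"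
      proof -
        have "real (2 ^ i) powr (- g) = (2 powr real i) powr (- g)" by (simp add: powr_realpow)
        also have "\<dots> = (2 powr (- g)) powr real i" by (simp add: powr_powr mult.commute)
        also have "\<dots> = (2 powr (- g)) ^ i" by (rule powr_realpow) simp
        finally show ?thesis .
      qed
      finally show "norm (measure lborel (bad_set K (2 ^ i))) \<le> C * (2 powr (- g)) ^ i" by simp
    qed
  qed
  thus ?thesis by simp
qed

section \<open>Approximation by ratios of products\<close>

text \<open>Products appear on both sides because each will become a difference of two squares. The
  slack \<open>C\<close> in the sizes makes the property stable under a change of scale by a bounded
  factor and under rational multiples of \<alpha>.\<close>

definition prod_approx :: "real \<Rightarrow> bool" where
  "prod_approx \<alpha> \<longleftrightarrow> (\<forall>\<epsilon>>0. \<exists>C>0. \<forall>M\<ge>1. \<exists>a b c d :: nat.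
     a \<ge> 1 \<and> b \<ge> 1 \<and> c \<ge> 1 \<and> d \<ge> 1 \<and>
     real a \<le> C * M \<and> real b \<le> C * M \<and> real c \<le> C * M \<and> real d \<le> C * M \<and>
     \<bar>\<alpha> * (real a * real b) - real c * real d\<bar> \<le> C * M powr (-2 + \<epsilon>))"

lemma abs_exp_diff_le:
  fixes x y :: real
  assumes "y \<le> 1/10" "\<bar>y - x\<bar> \<le> 1/2"
  shows "\<bar>exp y - exp x\<bar> \<le> 4 * \<bar>y - x\<bar>"
proof -
  have "exp y \<le> exp (1/2)" using assms by simp
  also have "exp (1/2) \<le> 1 + 2 * (1/2 :: real)" using exp_bound_lemma[of "1/2 :: real"] by simp
  finally have ey: "exp y \<le> 2" by simp
  define E where "E = exp (x - y)"
  define D where "D = \<bar>y - x\<bar>"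
  have "E \<le> 1 + 2 * D" using exp_bound_lemma[of "x - y"] assms by (simp add: abs_minus_commute E_def D_def)
  moreover have "1 + (x - y) \<le> E" unfolding E_def by (rule exp_ge_add_one_self)
  moreover have "y - x \<le> D" "0 \<le> D" by (auto simp: D_def)
  ultimately have "\<bar>1 - E\<bar> \<le> 2 * D" by (intro abs_leI) linarith+
  hence "\<bar>1 - exp (x - y)\<bar> \<le> 2 * \<bar>y - x\<bar>" unfolding E_def D_def .
  moreover have "exp y - exp x = exp y * (1 - exp (x - y))" by (simp add: right_diff_distrib flip: exp_add)
  ultimately have "\<bar>exp y - exp x\<bar> \<le> exp y * (2 * \<bar>y - x\<bar>)" by (simp add: abs_mult)
  also have "\<dots> \<le> 2 * (2 * \<bar>y - x\<bar>)" using ey by (intro mult_right_mono) auto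
  finally show ?thesis by simp
qed

lemma exp_log_frac:
  assumes "0 < N" "w = ((a, b, c, d), xs)" "0 < a" "0 < b" "0 < c" "0 < d"
  shows "exp (log_frac N w) * (N * real a * real b) = (N + real (sum_list xs)) * real c * real d"
proof -
  have "0 < N + real (sum_list xs)" using assms by (simp add: add_pos_nonneg)
  thus ?thesis using assms by (simp add: log_frac_def exp_add exp_diff)
qed

text \<open>Clearing the denominator of \<open>u / N\<close> turns the quadruple into
  \<open>k^6 * a\<close>, \<open>b\<close>, \<open>u * c\<close>, \<open>d\<close>. A logarithmic
  error \<open>k / T^4\<close> becomes at most
  \<open>N * (2 * T)^2 * 4 * k / T^4 = 16 * k^7 / T^2\<close>, and
  \<open>T^2 = 100 * k^(2 * K)\<close>.\<close>

lemma approx_of_not_bad: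
  assumes k: "k \<ge> 1" and K: "K \<ge> 4" and kK: "5 * K \<le> k" and y: "0 \<le> y" "y \<le> 1/10" "y \<notin> bad_set K k"
  shows "\<exists>a b c d :: nat. a \<ge> 1 \<and> b \<ge> 1 \<and> c \<ge> 1 \<and> d \<ge> 1 \<and>
     real a \<le> 40 * real k ^ (K + 6) \<and> real b \<le> 40 * real k ^ (K + 6) \<and>
     real c \<le> 40 * real k ^ (K + 6) \<and> real d \<le> 40 * real k ^ (K + 6) \<and>
     \<bar>exp y * (real a * real b) - real c * real d\<bar> \<le> real k ^ 7 / real k ^ (2 * K)"
proof -
  define T where "T = 10 * k ^ K"
  define N where "N = real (k ^ 6)"
  obtain w where w: "w \<in> quads T \<times> tuples (5 * K) (k ^ 4)" "\<bar>y - log_frac N w\<bar> \<le> real k / real T ^ 4"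
    using y unfolding bad_set_def T_def N_def by (auto simp: not_less)
  obtain a b c d xs where wd: "w = ((a, b, c, d), xs)" by (metis prod.exhaust)
  have kp: "1 \<le> real k" using k by simp
  have abcd: "1 \<le> a" "a \<le> 2 * T" "1 \<le> b" "b \<le> 2 * T" "1 \<le> c" "c \<le> 2 * T" "1 \<le> d" "d \<le> 2 * T"
    using w(1) by (auto simp: wd quads_def)
  have xs: "xs \<in> tuples (5 * K) (k ^ 4)" using w(1) by (simp add: wd)
  define u where "u = k ^ 6 + sum_list xs"
  have N0: "0 < N" using kp by (simp add: N_def)
  have "1 \<le> T" using one_le_power[OF k, of K] unfolding T_def by linarith
  hence T1: "1 \<le> real T" by simp
  have kT: "real k \<le> real k ^ K" using kp K self_le_power[of "real k" K] by simp
  have T2k: "2 * real k \<le> real T" 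
  proof -
    have "2 * real k \<le> 10 * real k ^ K" using kT kp by linarith
    thus ?thesis by (simp add: T_def)
  qed
  have small: "real k / real T ^ 4 \<le> 1/2"
  proof -
    have "real T ^ 1 \<le> real T ^ 4" using T1 by (intro power_increasing) auto
    hence "2 * real k \<le> real T ^ 4" using T2k by (simp only: power_one_right)
    thus ?thesis using T1 by (simp add: field_simps)
  qed
  have ule: "u \<le> 2 * k ^ 6"
  proof -
    have "sum_list xs \<le> 5 * K * k ^ 4" by (rule sum_list_tuples_le[OF xs])
    also have "\<dots> \<le> k * k ^ 4" using kK by (rule mult_right_mono) simp
    also have "\<dots> = k ^ 5" by (simp add: eval_nat_numeral)
    also have "\<dots> \<le> k ^ 6" using k by (intro power_increasing) auto
    finally show ?thesis by (simp add: u_def)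
  qed
  have kp6: "1 \<le> k ^ 6" using k by simp
  have u1: "1 \<le> u" using kp6 by (simp add: u_def)
  have ex: "exp (log_frac N w) * (N * real a * real b) = real u * real c * real d"
    using exp_log_frac[OF N0 wd] abcd by (simp add: u_def N_def)
  have "\<bar>exp y - exp (log_frac N w)\<bar> \<le> 4 * (real k / real T ^ 4)"
  proof -
    have "\<bar>y - log_frac N w\<bar> \<le> 1/2" using w(2) small by linarith
    from abs_exp_diff_le[OF y(2) this] show ?thesis
      by (rule order_trans) (use w(2) in \<open>intro mult_left_mono\<close>, simp_all)
  qed
  hence "(N * real a * real b) * \<bar>exp y - exp (log_frac N w)\<bar> \<le> (N * real (2 * T) * real (2 * T)) * (4 * (real k / real T ^ 4))"
    using N0 abcd by (intro mult_mono) (auto simp del: of_nat_mult)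
  also have "\<dots> = 16 * real k ^ 7 / real T ^ 2"
    using T1 by (simp add: N_def power4_eq_xxxx power2_eq_square eval_nat_numeral)
  also have "\<dots> \<le> real k ^ 7 / real k ^ (2 * K)"
  proof -
    have "real T ^ 2 = 100 * real k ^ (2 * K)" by (simp add: T_def power_mult_distrib mult.commute flip: power_mult)
    thus ?thesis using kp by (simp add: field_simps)
  qed
  also have "(N * real a * real b) * \<bar>exp y - exp (log_frac N w)\<bar> = \<bar>exp y * (N * real a * real b) - exp (log_frac N w) * (N * real a * real b)\<bar>"
  proof -
    define P where "P = N * real a * real b"
    have "0 \<le> P" using N0 by (simp add: P_def)
    moreover have "exp y * P - exp (log_frac N w) * P = P * (exp y - exp (log_frac N w))"
      by (simp add: right_diff_distrib mult.commute)
    ultimately show ?thesis unfolding P_def[symmetric] by (simp add: abs_mult)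
  qed
  finally have err: "\<bar>exp y * (real (k ^ 6 * a) * real b) - real (u * c) * real d\<bar> \<le> real k ^ 7 / real k ^ (2 * K)"
    unfolding ex by (simp add: N_def mult.assoc)
  have bnd: "x \<le> 2 * k ^ 6 * (2 * T) \<Longrightarrow> real x \<le> 40 * real k ^ (K + 6)" for x
  proof -
    assume "x \<le> 2 * k ^ 6 * (2 * T)"
    hence "real x \<le> real (2 * k ^ 6 * (2 * T))" unfolding of_nat_le_iff .
    also have "\<dots> = 40 * real k ^ (K + 6)" by (simp add: T_def power_add mult_ac)
    finally show ?thesis .
  qed
  have "k ^ 6 * a \<le> 2 * k ^ 6 * (2 * T)" using abcd by (intro mult_mono) auto
  moreover have "u * c \<le> 2 * k ^ 6 * (2 * T)" using abcd ule by (intro mult_mono) auto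
  moreover have "1 * b \<le> 2 * k ^ 6 * (2 * T)" "1 * d \<le> 2 * k ^ 6 * (2 * T)" using abcd kp6 by (intro mult_mono; linarith)+
  ultimately show ?thesis
    using err abcd u1 kp6 by (intro exI[of _ "k ^ 6 * a"] exI[of _ b] exI[of _ "u * c"] exI[of _ d] conjI bnd) auto
qed

lemma prod_approx_exp:
  assumes y: "0 \<le> y" "y \<le> 1/10" and ev: "\<And>K. K \<ge> 4 \<Longrightarrow> eventually (\<lambda>i. y \<notin> bad_set K (2 ^ i)) sequentially"
  shows "prod_approx (exp y)"
  unfolding prod_approx_def
proof (intro allI impI)
  fix \<epsilon> :: real assume e: "0 < \<epsilon>"
  \<comment> \<open>The error \<open>k^7 / k^(2 * K)\<close> is \<open>k^19\<close> times the
    inverse square of the size \<open>k^(K+6)\<close>; for this \<open>K\<close> the factor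
    \<open>k^19\<close> is at most the \<epsilon>-th power of that size.\<close>
  define K where "K = nat \<lceil>19 / \<epsilon>\<rceil> + 4"
  have K4: "K \<ge> 4" by (simp add: K_def)
  have "19 / \<epsilon> \<le> real K" unfolding K_def using e by (simp, linarith)
  hence Ke: "19 \<le> \<epsilon> * real (K + 6)" using e by (simp add: field_simps)
  obtain i1 where i1: "\<And>i. i \<ge> i1 \<Longrightarrow> y \<notin> bad_set K (2 ^ i)"
    using ev[OF K4] by (auto simp: eventually_sequentially)
  define i0 where "i0 = i1 + 5 * K"
  \<comment> \<open>For \<open>k = 2^i\<close> the size \<open>k^(K+6)\<close> is
    \<open>b^i\<close>, so the available sizes form a geometric progression of ratio
    \<open>b\<close>.\<close>
  define b where "b = (2::nat) ^ (K + 6)"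
  have b2: "b \<ge> 2" unfolding b_def by (simp add: power_add)
  define M0 where "M0 = 40 * real b ^ i0"
  \<comment> \<open>The three summands cover the size bounds, the comparison
    \<open>M <= 40 * b * b^i\<close> with the scale just below \<open>M\<close>, and the range
    \<open>M < M0\<close>, where the quadruple 1, 1, 1, 1 is taken.\<close>
  define C where "C = 40 + (40 * real b)\<^sup>2 + \<bar>exp y - 1\<bar> * M0\<^sup>2"
  have b0: "1 \<le> real b" using b2 by simp
  have M01: "1 \<le> M0" unfolding M0_def using one_le_power[OF b0, of i0] by linarith
  have C1: "40 \<le> C" "(40 * real b)\<^sup>2 \<le> C" "\<bar>exp y - 1\<bar> * M0\<^sup>2 \<le> C" by (auto simp: C_def)
  show "\<exists>C>0. \<forall>M\<ge>1. \<exists>a b c d :: nat. a \<ge> 1 \<and> b \<ge> 1 \<and> c \<ge> 1 \<and> d \<ge> 1 \<and>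
     real a \<le> C * M \<and> real b \<le> C * M \<and> real c \<le> C * M \<and> real d \<le> C * M \<and>
     \<bar>exp y * (real a * real b) - real c * real d\<bar> \<le> C * M powr (-2 + \<epsilon>)"
  proof (intro exI[of _ C] conjI allI impI)
    show "0 < C" using C1 by linarith
    fix M :: real assume M: "1 \<le> M"
    have pe: "M powr (-2) \<le> M powr (-2 + \<epsilon>)" using M e by (intro powr_mono) auto
    have CM: "40 * M \<le> C * M" using C1 M by (intro mult_right_mono) auto
    show "\<exists>a b c d :: nat. a \<ge> 1 \<and> b \<ge> 1 \<and> c \<ge> 1 \<and> d \<ge> 1 \<and>
     real a \<le> C * M \<and> real b \<le> C * M \<and> real c \<le> C * M \<and> real d \<le> C * M \<and>
     \<bar>exp y * (real a * real b) - real c * real d\<bar> \<le> C * M powr (-2 + \<epsilon>)"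
    proof (cases "M < M0")
      case True
      have "M\<^sup>2 \<le> M0\<^sup>2" using True M by (intro power_mono) auto
      hence "\<bar>exp y - 1\<bar> * M\<^sup>2 \<le> C" using C1(3) by (smt (verit) mult_left_mono)
      hence "\<bar>exp y - 1\<bar> \<le> C * M powr (-2)" using M by (simp add: powr_minus_divide field_simps)
      also have "\<dots> \<le> C * M powr (-2 + \<epsilon>)" using pe C1(1) by (intro mult_left_mono) auto
      finally have "\<bar>exp y - 1\<bar> \<le> C * M powr (-2 + \<epsilon>)" .
      moreover have "1 \<le> C * M" using CM M by linarith
      ultimately show ?thesis by (intro exI[of _ 1]) auto
    next
      case False
      define m where "m = nat \<lfloor>M / 40\<rfloor>"
      have Mb: "40 * real b ^ i0 \<le> M" using False by (simp add: M0_def)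
      have m1: "1 \<le> m"
      proof -
        have "1 \<le> M / 40" using Mb one_le_power[OF b0, of i0] by linarith
        thus ?thesis unfolding m_def by linarith
      qed
      obtain i where i: "b ^ i \<le> m" "m < b ^ (i + 1)" using ex_power_ivl1[OF b2 m1] by auto
      have "real (b ^ i) \<le> real m" using i(1) unfolding of_nat_le_iff .
      also have "real m \<le> M / 40" using M unfolding m_def by linarith
      finally have lo: "40 * real (b ^ i) \<le> M" by simp
      have hi: "M < 40 * real (b ^ (i + 1))"
      proof -
        have "M / 40 < real m + 1" unfolding m_def using M by linarith
        also have "\<dots> \<le> real (b ^ (i + 1))" using i(2) by linarith
        finally show ?thesis by simp
      qed
      have ii: "i0 \<le> i"
      proof (rule ccontr)
        assume "\<not> i0 \<le> i"
        hence "real b ^ (i + 1) \<le> real b ^ i0" using b0 by (intro power_increasing) auto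
        thus False using hi Mb by simp
      qed
      define k where "k = (2::nat) ^ i"
      have bk: "real (b ^ i) = real k ^ (K + 6)" by (simp add: b_def k_def mult.commute flip: power_mult)
      have kp: "1 \<le> real k" by (simp add: k_def)
      have "i < 2 ^ i" by (rule less_exp)
      hence kK: "5 * K \<le> k" using ii unfolding k_def i0_def by linarith
      obtain a' b' c' d' :: nat where q: "a' \<ge> 1" "b' \<ge> 1" "c' \<ge> 1" "d' \<ge> 1"
        "real a' \<le> 40 * real k ^ (K + 6)" "real b' \<le> 40 * real k ^ (K + 6)"
        "real c' \<le> 40 * real k ^ (K + 6)" "real d' \<le> 40 * real k ^ (K + 6)"
        "\<bar>exp y * (real a' * real b') - real c' * real d'\<bar> \<le> real k ^ 7 / real k ^ (2 * K)"
        using approx_of_not_bad[of k K y] kp K4 kK y i1[of i] ii unfolding k_def i0_def by auto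
      have sz: "40 * real k ^ (K + 6) \<le> C * M"
      proof -
        have "40 * real k ^ (K + 6) \<le> M" using lo bk by simp
        also have "\<dots> \<le> C * M" using CM M by linarith
        finally show ?thesis .
      qed
      have "real k ^ 7 / real k ^ (2 * K) \<le> C * M powr (-2 + \<epsilon>)"
      proof -
        define B where "B = real k ^ (K + 6)"
        have B0: "0 < B" "1 \<le> B" using kp by (auto simp: B_def)
        have MB: "M \<le> 40 * real b * B" "40 * B \<le> M"
          using hi lo bk by (simp_all add: B_def)
        have "real k ^ 7 / real k ^ (2 * K) = real k powr 19 * B powr (-2)"
        proof -
          have "B powr (-2) = 1 / real k ^ (2 * (K + 6))"
            using B0 by (simp add: powr_minus_divide B_def mult.commute flip: power_mult)
          hence "real k powr 19 * B powr (-2) = real k ^ 19 / real k ^ (2 * K + 12)"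
            using kp by (simp add: algebra_simps)
          also have "\<dots> = real k ^ 7 / real k ^ (2 * K)"
            using kp by (simp add: power_add field_simps flip: power_add)
          finally show ?thesis ..
        qed
        also have "\<dots> \<le> B powr \<epsilon> * ((40 * real b)\<^sup>2 * M powr (-2))"
        proof (rule mult_mono)
          have "real k powr 19 \<le> real k powr (\<epsilon> * real (K + 6))" using kp Ke by (intro powr_mono) auto
          also have "\<dots> = (real k powr real (K + 6)) powr \<epsilon>" by (simp add: powr_powr mult.commute)
          also have "real k powr real (K + 6) = B" unfolding B_def by (rule powr_realpow) (use kp in simp)
          finally show "real k powr 19 \<le> B powr \<epsilon>" .
          have "M\<^sup>2 \<le> (40 * real b * B)\<^sup>2" using MB M by (intro power_mono) auto
          thus "B powr (-2) \<le> (40 * real b)\<^sup>2 * M powr (-2)"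
            using B0 M by (simp add: powr_minus_divide field_simps power_mult_distrib)
        qed auto
        also have "\<dots> \<le> M powr \<epsilon> * ((40 * real b)\<^sup>2 * M powr (-2))"
          using B0 MB e by (intro mult_right_mono powr_mono2) auto
        also have "\<dots> = (40 * real b)\<^sup>2 * M powr (-2 + \<epsilon>)"
          using M by (simp only: powr_add mult_ac)
        also have "\<dots> \<le> C * M powr (-2 + \<epsilon>)" using C1 by (intro mult_right_mono) auto
        finally show ?thesis .
      qed
      thus ?thesis using q sz
        by (intro exI[of _ a'] exI[of _ b'] exI[of _ c'] exI[of _ d'] conjI) linarith+
    qed
  qed
qed

text \<open>Replacing \<open>a\<close> by \<open>q * a\<close> and \<open>c\<close> by
  \<open>p * c\<close> multiplies the error exactly by \<open>p\<close>; both factors go into the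
  constant.\<close>

lemma prod_approx_scale:
  assumes "prod_approx \<alpha>" "p \<ge> 1" "q \<ge> 1"
  shows "prod_approx (real p / real q * \<alpha>)"
  unfolding prod_approx_def
proof (intro allI impI)
  fix \<epsilon> :: real assume "0 < \<epsilon>"
  then obtain C where C: "C > 0" and ap: "\<And>M. M \<ge> 1 \<Longrightarrow> \<exists>a b c d :: nat.
     a \<ge> 1 \<and> b \<ge> 1 \<and> c \<ge> 1 \<and> d \<ge> 1 \<and>
     real a \<le> C * M \<and> real b \<le> C * M \<and> real c \<le> C * M \<and> real d \<le> C * M \<and>
     \<bar>\<alpha> * (real a * real b) - real c * real d\<bar> \<le> C * M powr (-2 + \<epsilon>)"
    using assms(1) unfolding prod_approx_def by blast
  define P Q where "P = real p" and "Q = real q"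
  have PQ: "1 \<le> P" "1 \<le> Q" using assms by (auto simp: P_def Q_def)
  define C' where "C' = (P * Q) * C"
  have PQ1: "P \<le> P * Q" "Q \<le> P * Q" "1 \<le> P * Q" using PQ mult_mono[of 1 P 1 Q] by auto
  have CC: "C \<le> C'" "P * C \<le> C'" "Q * C \<le> C'" unfolding C'_def using C PQ1 by (auto intro: mult_right_mono)
  show "\<exists>C>0. \<forall>M\<ge>1. \<exists>a b c d :: nat. a \<ge> 1 \<and> b \<ge> 1 \<and> c \<ge> 1 \<and> d \<ge> 1 \<and>
     real a \<le> C * M \<and> real b \<le> C * M \<and> real c \<le> C * M \<and> real d \<le> C * M \<and>
     \<bar>real p / real q * \<alpha> * (real a * real b) - real c * real d\<bar> \<le> C * M powr (-2 + \<epsilon>)"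
  proof (intro exI[of _ C'] conjI allI impI)
    show "0 < C'" using C CC by linarith
    fix M :: real assume M: "1 \<le> M"
    obtain a b c d :: nat where q: "a \<ge> 1" "b \<ge> 1" "c \<ge> 1" "d \<ge> 1"
      "real a \<le> C * M" "real b \<le> C * M" "real c \<le> C * M" "real d \<le> C * M"
      "\<bar>\<alpha> * (real a * real b) - real c * real d\<bar> \<le> C * M powr (-2 + \<epsilon>)" using ap[OF M] by blast
    have CM: "C * M \<le> C' * M" "P * C * M \<le> C' * M" "Q * C * M \<le> C' * M"
      using CC M by (auto intro: mult_right_mono)
    have "\<bar>P / Q * \<alpha> * ((Q * real a) * real b) - (P * real c) * real d\<bar> = P * \<bar>\<alpha> * (real a * real b) - real c * real d\<bar>"
    proof -
      have "P / Q * \<alpha> * ((Q * real a) * real b) - (P * real c) * real d = P * (\<alpha> * (real a * real b) - real c * real d)"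
        using PQ by (simp add: field_simps)
      thus ?thesis using PQ by (simp add: abs_mult)
    qed
    also have "\<dots> \<le> P * (C * M powr (-2 + \<epsilon>))" using q PQ by (intro mult_left_mono) auto
    also have "\<dots> \<le> C' * M powr (-2 + \<epsilon>)" using CC mult_right_mono[of "P * C" C' "M powr (-2 + \<epsilon>)"] by simp
    finally have err: "\<bar>P / Q * \<alpha> * ((Q * real a) * real b) - (P * real c) * real d\<bar> \<le> C' * M powr (-2 + \<epsilon>)" .
    have "Q * real a \<le> Q * (C * M)" "P * real c \<le> P * (C * M)" using q PQ by (auto intro: mult_left_mono)
    hence s: "Q * real a \<le> C' * M" "P * real c \<le> C' * M" using CM by (auto simp: mult.assoc)
    show "\<exists>a b c d :: nat. a \<ge> 1 \<and> b \<ge> 1 \<and> c \<ge> 1 \<and> d \<ge> 1 \<and>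
     real a \<le> C' * M \<and> real b \<le> C' * M \<and> real c \<le> C' * M \<and> real d \<le> C' * M \<and>
     \<bar>real p / real q * \<alpha> * (real a * real b) - real c * real d\<bar> \<le> C' * M powr (-2 + \<epsilon>)"
      using err s q CM assms(2,3) unfolding P_def Q_def
      by (intro exI[of _ "q * a"] exI[of _ b] exI[of _ "p * c"] exI[of _ d]) auto
  qed
qed

text \<open>The exceptional \<open>y\<close> in \<open>[0, 1/10]\<close> form a null set, and its
  images under the countably many differentiable maps taking \<open>y\<close> to
  \<open>p / q * exp y\<close> are null. They cover every exceptional \<alpha>, since some rational
  lies strictly between \<open>\<alpha> * exp (-1/10)\<close> and \<alpha>.\<close>

lemma AE_prod_approx: "AE \<alpha> in lborel. \<alpha> > 0 \<longrightarrow> prod_approx \<alpha>"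
proof -
  define Z where "Z = {y. \<not> (0 \<le> y \<and> y \<le> 1/10 \<longrightarrow> prod_approx (exp y))}"
  have "AE y in lborel. \<forall>K\<in>{4..}. eventually (\<lambda>i. y \<notin> bad_set K (2 ^ i)) sequentially"
    by (subst AE_ball_countable) (auto intro: AE_eventually_not_bad)
  hence "AE y in lborel. 0 \<le> y \<and> y \<le> 1/10 \<longrightarrow> prod_approx (exp y)"
    by eventually_elim (auto intro!: prod_approx_exp)
  \<comment> \<open>In the completed measure null sets are the \<open>negligible\<close> sets, to
    which the theorem on differentiable images applies.\<close>
  hence "AE y in lebesgue. 0 \<le> y \<and> y \<le> 1/10 \<longrightarrow> prod_approx (exp y)" by (rule AE_completion)
  then obtain N where N: "negligible N" "Z \<subseteq> N"
    unfolding eventually_ae_filter_negligible Z_def by blast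
  have Z: "negligible Z" using negligible_subset[OF N] .
  define W where "W = (\<Union>(p, q)\<in>{1::nat..} \<times> {1::nat..}. (\<lambda>y. real p / real q * exp y) ` Z)"
  have "negligible W" unfolding W_def
  proof (rule negligible_countable_Union, safe)
    show "countable ((\<lambda>(p, q). (\<lambda>y. real p / real q * exp y) ` Z) ` ({1::nat..} \<times> {1::nat..}))"
      by (intro countable_image) auto
    fix p q :: nat
    have "((\<lambda>y. real p / real q * exp y) has_real_derivative real p / real q * exp x) (at x within Z)" for x
      by (intro DERIV_cmult DERIV_subset[OF DERIV_exp]) simp
    thus "negligible ((\<lambda>y. real p / real q * exp y) ` Z)"
      by (intro negligible_differentiable_image_negligible[OF order_refl Z])
         (auto simp: differentiable_on_def real_differentiable_def)
  qed
  moreover have "{\<alpha>. \<not> (\<alpha> > 0 \<longrightarrow> prod_approx \<alpha>)} \<subseteq> W"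
  proof clarsimp
    fix \<alpha> :: real assume a: "0 < \<alpha>" "\<not> prod_approx \<alpha>"
    have "\<alpha> * exp (-1/10) < \<alpha> * 1" using a by (intro mult_strict_left_mono) auto
    then obtain r where r: "r \<in> \<rat>" "\<alpha> * exp (-1/10) < r" "r < \<alpha>" using Rats_dense_in_real by auto
    have "0 < \<alpha> * exp (-1/10)" using a by simp
    hence r0: "0 < r" using r by linarith
    obtain p q :: nat where pq: "q \<noteq> 0" "\<bar>r\<bar> = real p / real q" using Rats_abs_nat_div_natE[OF r(1)] by metis
    have pq1: "p \<ge> 1" "q \<ge> 1" "r = real p / real q" using pq r0 by (auto simp: Suc_le_eq intro: gr0I)
    define y where "y = ln (\<alpha> / r)"
    have "\<alpha> = r * exp y" using a r0 by (simp add: y_def)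
    hence ye: "\<alpha> = real p / real q * exp y" unfolding pq1(3) .
    have y0: "0 \<le> y" using a r r0 by (simp add: y_def)
    have "\<alpha> / r \<le> exp (1/10)"
    proof -
      have "\<alpha> * exp (-1/10) * exp (1/10) \<le> r * exp (1/10)" using r by (intro mult_right_mono) auto
      hence "\<alpha> \<le> r * exp (1/10)" by (simp add: mult.assoc flip: exp_add)
      thus ?thesis using r0 by (simp add: field_simps)
    qed
    hence "y \<le> ln (exp (1/10))" unfolding y_def using a r0 by (subst ln_le_cancel_iff) auto
    hence y1: "y \<le> 1/10" by simp
    have "\<not> prod_approx (exp y)" using prod_approx_scale[of "exp y" p q] pq1(1,2) a ye by metis
    hence "y \<in> Z" using y0 y1 by (simp add: Z_def)
    thus "\<alpha> \<in> W" unfolding W_def using ye pq1 by auto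
  qed
  ultimately have "AE \<alpha> in lebesgue. \<alpha> > 0 \<longrightarrow> prod_approx \<alpha>"
    unfolding eventually_ae_filter_negligible by blast
  thus ?thesis unfolding AE_completion_iff .
qed

section \<open>Small gaps\<close>

text \<open>The pairs lie in the box \<open>m <= sqrt (X / \<alpha>)\<close>,
  \<open>n <= sqrt X\<close>. As \<open>m\<close> and \<open>n\<close> start at 1, its area bounds
  the count without a boundary term.\<close>

lemma card_spec_set_le:
  assumes a: "0 < \<alpha>" and X: "0 \<le> X"
  shows "finite {z \<in> spec_set \<alpha>. z \<le> X}" "real (card {z \<in> spec_set \<alpha>. z \<le> X}) \<le> X / sqrt \<alpha>"
proof -
  define A B where "A = nat \<lfloor>sqrt (X / \<alpha>)\<rfloor>" and "B = nat \<lfloor>sqrt X\<rfloor>"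
  have sub: "{z \<in> spec_set \<alpha>. z \<le> X} \<subseteq> (\<lambda>(m, n). \<alpha> * (real m)\<^sup>2 + (real n)\<^sup>2) ` ({1..A} \<times> {1..B})"
  proof
    fix z assume "z \<in> {z \<in> spec_set \<alpha>. z \<le> X}"
    then obtain m n :: nat where mn: "m \<ge> 1" "n \<ge> 1" "z = \<alpha> * (real m)\<^sup>2 + (real n)\<^sup>2" "z \<le> X"
      by (auto simp: spec_set_def)
    have "0 \<le> \<alpha> * (real m)\<^sup>2" "0 \<le> (real n)\<^sup>2" using a by auto
    hence "\<alpha> * (real m)\<^sup>2 \<le> X" "(real n)\<^sup>2 \<le> X" using mn by linarith+
    hence "(real m)\<^sup>2 \<le> X / \<alpha>" "(real n)\<^sup>2 \<le> X" using a by (auto simp: field_simps)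
    hence "real m \<le> sqrt (X / \<alpha>)" "real n \<le> sqrt X" by (auto intro: real_le_rsqrt)
    hence "m \<le> A" "n \<le> B" unfolding A_def B_def by linarith+
    thus "z \<in> (\<lambda>(m, n). \<alpha> * (real m)\<^sup>2 + (real n)\<^sup>2) ` ({1..A} \<times> {1..B})" using mn by force
  qed
  show "finite {z \<in> spec_set \<alpha>. z \<le> X}" by (rule finite_subset[OF sub]) simp
  have "card {z \<in> spec_set \<alpha>. z \<le> X} \<le> card ({1..A} \<times> {1..B})"
    by (rule surj_card_le[OF _ sub]) simp
  hence "real (card {z \<in> spec_set \<alpha>. z \<le> X}) \<le> real A * real B"
    by (metis card_atLeastAtMost card_cartesian_product diff_Suc_1 of_nat_le_iff of_nat_mult)
  also have "\<dots> \<le> sqrt (X / \<alpha>) * sqrt X"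
  proof (rule mult_mono)
    have "0 \<le> sqrt (X / \<alpha>)" "0 \<le> sqrt X" using a X by auto
    thus "real A \<le> sqrt (X / \<alpha>)" "real B \<le> sqrt X" unfolding A_def B_def by linarith+
  qed (use a X in auto)
  also have "\<dots> = X / sqrt \<alpha>" using X by (simp add: real_sqrt_divide)
  finally show "real (card {z \<in> spec_set \<alpha>. z \<le> X}) \<le> X / sqrt \<alpha>" .
qed

lemma spec_set_nonneg: "0 < \<alpha> \<Longrightarrow> z \<in> spec_set \<alpha> \<Longrightarrow> 0 \<le> z"
  by (auto simp: spec_set_def)

lemma finite_spec_set_less:
  assumes "0 < \<alpha>" "x \<in> spec_set \<alpha>"
  shows "finite {z \<in> spec_set \<alpha>. z < x}"
  by (rule finite_subset[OF _ card_spec_set_le(1)[OF assms(1) spec_set_nonneg[OF assms]]]) auto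

text \<open>The number of smaller elements increases strictly along
  \<open>spec_set \<alpha>\<close>, so the description behind \<open>THE\<close> has a single
  solution.\<close>

lemma spec_lambda_eqI:
  assumes a: "0 < \<alpha>" and x: "x \<in> spec_set \<alpha>" "card {z \<in> spec_set \<alpha>. z < x} = k - 1"
  shows "spec_lambda \<alpha> k = x"
  unfolding spec_lambda_def
proof (rule the_equality)
  show "x \<in> spec_set \<alpha> \<and> card {y \<in> spec_set \<alpha>. y < x} = k - 1" using x by simp
next
  fix x' assume x': "x' \<in> spec_set \<alpha> \<and> card {y \<in> spec_set \<alpha>. y < x'} = k - 1"
  have lt: "card {z \<in> spec_set \<alpha>. z < u} < card {z \<in> spec_set \<alpha>. z < v}"
    if "u \<in> spec_set \<alpha>" "v \<in> spec_set \<alpha>" "u < v" for u v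
    by (rule psubset_card_mono[OF finite_spec_set_less[OF a that(2)]]) (use that in auto)
  show "x' = x"
    using lt[of x x'] lt[of x' x] x x' by (cases x x' rule: linorder_cases) auto
qed

text \<open>Other elements may lie between \<open>x\<close> and \<open>y\<close>, so
  \<open>x\<close> is compared with its successor \<open>s <= y\<close>. The gap
  \<open>s - x\<close> has index \<open>i < N\<close> because \<open>y\<close>, \<open>x\<close> and
  the \<open>i - 1\<close> elements below \<open>x\<close> are all at most \<open>y\<close>.\<close>

lemma delta_min_le_diff:
  assumes a: "0 < \<alpha>" and x: "x \<in> spec_set \<alpha>" and y: "y \<in> spec_set \<alpha>" and xy: "x < y"
    and N: "card {z \<in> spec_set \<alpha>. z \<le> y} \<le> N"
  shows "delta_min \<alpha> N \<le> y - x"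
proof -
  define L where "L = {z \<in> spec_set \<alpha>. z < x}"
  define i where "i = card L + 1"
  define U where "U = {z \<in> spec_set \<alpha>. x < z \<and> z \<le> y}"
  have finy: "finite {z \<in> spec_set \<alpha>. z \<le> y}"
    by (rule card_spec_set_le(1)[OF a spec_set_nonneg[OF a y]])
  have finU: "finite U" unfolding U_def by (rule finite_subset[OF _ finy]) auto
  have finL: "finite L" unfolding L_def by (rule finite_spec_set_less[OF a x])
  have yU: "y \<in> U" using y xy by (simp add: U_def)
  define s where "s = Min U"
  have sU: "s \<in> U" unfolding s_def using finU yU by (intro Min_in) auto
  have smin: "s \<le> z" if "z \<in> U" for z unfolding s_def using finU that by (rule Min_le)
  have s: "s \<in> spec_set \<alpha>" "x < s" "s \<le> y" using sU by (auto simp: U_def)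
  have "{z \<in> spec_set \<alpha>. z < s} = insert x L"
  proof (intro equalityI subsetI)
    fix z assume z: "z \<in> {z \<in> spec_set \<alpha>. z < s}"
    show "z \<in> insert x L"
    proof (rule ccontr)
      assume "z \<notin> insert x L"
      hence "z \<in> U" using z s by (auto simp: L_def U_def)
      thus False using smin z by fastforce
    qed
  qed (use x s in \<open>auto simp: L_def\<close>)
  moreover have "x \<notin> L" by (simp add: L_def)
  ultimately have "card {z \<in> spec_set \<alpha>. z < s} = i + 1 - 1" using finL by (simp add: i_def)
  hence 1: "spec_lambda \<alpha> (i + 1) = s" by (rule spec_lambda_eqI[OF a s(1)])
  have 2: "spec_lambda \<alpha> i = x" by (rule spec_lambda_eqI[OF a x]) (simp add: i_def L_def)
  have "insert y (insert x L) \<subseteq> {z \<in> spec_set \<alpha>. z \<le> y}" using x y xy by (auto simp: L_def)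
  hence "card (insert y (insert x L)) \<le> card {z \<in> spec_set \<alpha>. z \<le> y}" by (rule card_mono[OF finy])
  moreover have "card (insert y (insert x L)) = i + 1" using finL xy by (auto simp: L_def i_def)
  ultimately have "i < N" using N by linarith
  hence "delta_min \<alpha> N \<le> spec_lambda \<alpha> (i + 1) - spec_lambda \<alpha> i"
    unfolding delta_min_def by (intro Min_le) (auto simp: i_def)
  thus ?thesis using 1 2 s by simp
qed

text \<open>If \<open>p * q = 4 * a * b\<close>, then
  \<open>(q + p)^2 - (q - p)^2 = 16 * a * b\<close>, and \<open>p < q\<close> makes the second
  square positive. With 4 in place of 16 this can fail: 4 is not a difference of two positive
  squares. The factor 16 offers a second splitting, \<open>2 * b\<close> and \<open>2 * a\<close>,
  when \<open>a = 4 * b\<close>.\<close>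

lemma sixteen_mult_eq_diff_squares:
  fixes a b :: nat
  assumes "a \<ge> 1" "b \<ge> 1" "real a \<le> R" "real b \<le> R"
  shows "\<exists>m n :: nat. m \<ge> 1 \<and> n \<ge> 1 \<and> real m \<le> 8 * R \<and> real n \<le> 8 * R \<and>
    (real m)\<^sup>2 - (real n)\<^sup>2 = 16 * (real a * real b)"
proof -
  have *: "\<exists>m n :: nat. m \<ge> 1 \<and> n \<ge> 1 \<and> real m \<le> 8 * R \<and> real n \<le> 8 * R \<and>
    (real m)\<^sup>2 - (real n)\<^sup>2 = 16 * (real a * real b)"
    if pq: "p < q" "real p * real q = 4 * (real a * real b)" "real p \<le> 4 * R" "real q \<le> 4 * R" for p q :: nat
  proof (rule exI[of _ "q + p"], rule exI[of _ "q - p"], intro conjI)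
    have "(real (q + p))\<^sup>2 - (real (q - p))\<^sup>2 = 4 * (real p * real q)"
      using pq(1) by (simp add: of_nat_diff power2_eq_square algebra_simps)
    thus "(real (q + p))\<^sup>2 - (real (q - p))\<^sup>2 = 16 * (real a * real b)" using pq(2) by simp
  qed (use pq in \<open>auto simp: of_nat_diff\<close>)
  consider "a < 4 * b" | "4 * b < a" | "a = 4 * b" by linarith
  thus ?thesis
  proof cases
    case 1 thus ?thesis using assms by (intro *[of a "4 * b"]) auto
  next
    case 2 thus ?thesis using assms by (intro *[of "4 * b" a]) auto
  next
    case 3 thus ?thesis using assms by (intro *[of "2 * b" "2 * a"]) auto
  qed
qed

lemma delta_min_bound:
  assumes a: "0 < \<alpha>" and irr: "\<alpha> \<notin> \<rat>" and ap: "prod_approx \<alpha>" and e: "0 < \<epsilon>"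
  shows "\<exists>C>0. \<forall>N::nat. N \<ge> 2 \<longrightarrow> delta_min \<alpha> N \<le> C * real N powr (-1 + \<epsilon>)"
proof -
  \<comment> \<open>\<open>M^2\<close> will be proportional to \<open>N\<close>, so an exponent
    \<open>2 * \<epsilon>\<close> in \<open>M\<close> becomes \<epsilon> in
    \<open>N\<close>.\<close>
  have "0 < 2 * \<epsilon>" using e by simp
  then obtain C where C: "C > 0" and apC: "\<And>M. M \<ge> 1 \<Longrightarrow> \<exists>a b c d :: nat.
     a \<ge> 1 \<and> b \<ge> 1 \<and> c \<ge> 1 \<and> d \<ge> 1 \<and>
     real a \<le> C * M \<and> real b \<le> C * M \<and> real c \<le> C * M \<and> real d \<le> C * M \<and>
     \<bar>\<alpha> * (real a * real b) - real c * real d\<bar> \<le> C * M powr (-2 + 2 * \<epsilon>)"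
    using ap unfolding prod_approx_def by blast
  \<comment> \<open>At scale \<open>M\<close> all constructed values are at most
    \<open>(\<alpha> + 1) * (8 * C * M)^2\<close>, and at most \<open>\<kappa> * M^2\<close>
    elements of the spectrum lie below that; \<open>M\<close> is later chosen to make this equal to
    \<open>N\<close>.\<close>
  define \<kappa> where "\<kappa> = (\<alpha> + 1) * (8 * C)\<^sup>2 / sqrt \<alpha>"
  have k0: "0 < \<kappa>" using a C by (simp add: \<kappa>_def)
  \<comment> \<open>The first gap handles the finitely many \<open>N < \<kappa>\<close>.\<close>
  define D where "D = \<bar>spec_lambda \<alpha> 2 - spec_lambda \<alpha> 1\<bar>"
  define C' where "C' = 16 * C * \<kappa> powr (1 - \<epsilon>) + D * \<kappa> + 1"
  have pos: "0 < 16 * C * \<kappa> powr (1 - \<epsilon>)" "0 \<le> D * \<kappa>" using C k0 by (auto simp: D_def)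
  show ?thesis
  proof (intro exI[of _ C'] conjI allI impI)
    show "0 < C'" using pos by (simp add: C'_def)
    fix N :: nat assume N: "2 \<le> N"
    have N0: "0 < real N" using N by simp
    show "delta_min \<alpha> N \<le> C' * real N powr (-1 + \<epsilon>)"
    proof (cases "real N < \<kappa>")
      case True
      have "delta_min \<alpha> N \<le> spec_lambda \<alpha> (1 + 1) - spec_lambda \<alpha> 1"
        unfolding delta_min_def using N by (intro Min_le) auto
      also have "\<dots> \<le> D" by (simp add: D_def numeral_2_eq_2)
      also have "D \<le> D * (\<kappa> * real N powr (-1))"
      proof -
        have "1 \<le> \<kappa> * real N powr (-1)" using True N0 by (simp add: powr_minus_divide)
        thus ?thesis using mult_left_mono[of 1 "\<kappa> * real N powr (-1)" D] by (simp add: D_def)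
      qed
      also have "\<dots> = (D * \<kappa>) * real N powr (-1)" by simp
      also have "\<dots> \<le> C' * real N powr (-1 + \<epsilon>)"
        using pos e N by (intro mult_mono powr_mono) (auto simp: C'_def)
      finally show ?thesis .
    next
      case False
      define M where "M = sqrt (real N / \<kappa>)"
      have NK: "1 \<le> real N / \<kappa>" using False k0 by simp
      have M1: "1 \<le> M" using NK by (simp add: M_def)
      have M2: "M\<^sup>2 = real N / \<kappa>" using NK by (simp add: M_def)
      obtain a' b c d :: nat where q: "a' \<ge> 1" "b \<ge> 1" "c \<ge> 1" "d \<ge> 1"
        "real a' \<le> C * M" "real b \<le> C * M" "real c \<le> C * M" "real d \<le> C * M"
        "\<bar>\<alpha> * (real a' * real b) - real c * real d\<bar> \<le> C * M powr (-2 + 2 * \<epsilon>)"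
        using apC[OF M1] by blast
      obtain m1 m2 where m: "m1 \<ge> 1" "m2 \<ge> 1" "real m1 \<le> 8 * (C * M)" "real m2 \<le> 8 * (C * M)"
        "(real m1)\<^sup>2 - (real m2)\<^sup>2 = 16 * (real a' * real b)"
        using sixteen_mult_eq_diff_squares[OF q(1,2,5,6)] by blast
      obtain n1 n2 where n: "n1 \<ge> 1" "n2 \<ge> 1" "real n1 \<le> 8 * (C * M)" "real n2 \<le> 8 * (C * M)"
        "(real n1)\<^sup>2 - (real n2)\<^sup>2 = 16 * (real c * real d)"
        using sixteen_mult_eq_diff_squares[OF q(3,4,7,8)] by blast
      \<comment> \<open>The indices are crossed, \<open>m1\<close> with \<open>n2\<close> and
        \<open>m2\<close> with \<open>n1\<close>, so that \<open>x - y\<close> is \<alpha> times one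
        difference of squares minus the other.\<close>
      define x where "x = \<alpha> * (real m1)\<^sup>2 + (real n2)\<^sup>2"
      define y where "y = \<alpha> * (real m2)\<^sup>2 + (real n1)\<^sup>2"
      have xS: "x \<in> spec_set \<alpha>" and yS: "y \<in> spec_set \<alpha>"
        unfolding spec_set_def x_def y_def using m n by blast+
      have diff: "x - y = 16 * (\<alpha> * (real a' * real b) - real c * real d)"
      proof -
        have "x - y = \<alpha> * ((real m1)\<^sup>2 - (real m2)\<^sup>2) - ((real n1)\<^sup>2 - (real n2)\<^sup>2)"
          by (simp add: x_def y_def algebra_simps)
        thus ?thesis unfolding m(5) n(5) by (simp add: algebra_simps)
      qed
      have ne: "x \<noteq> y"
      proof
        assume "x = y"
        hence "\<alpha> * (real a' * real b) = real c * real d" using diff by simp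
        hence "\<alpha> = (real c * real d) / (real a' * real b)" using q by (simp add: field_simps)
        also have "\<dots> \<in> \<rat>" by (intro Rats_divide Rats_mult Rats_of_nat)
        finally show False using irr by simp
      qed
      have sz: "\<alpha> * (real u)\<^sup>2 + (real v)\<^sup>2 \<le> (\<alpha> + 1) * (8 * (C * M))\<^sup>2"
        if "real u \<le> 8 * (C * M)" "real v \<le> 8 * (C * M)" for u v
      proof -
        have "(real u)\<^sup>2 \<le> (8 * (C * M))\<^sup>2" "(real v)\<^sup>2 \<le> (8 * (C * M))\<^sup>2"
          by (intro power_mono that of_nat_0_le_iff)+
        hence "\<alpha> * (real u)\<^sup>2 \<le> \<alpha> * (8 * (C * M))\<^sup>2" "(real v)\<^sup>2 \<le> 1 * (8 * (C * M))\<^sup>2"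
          using a by (auto intro: mult_left_mono)
        thus ?thesis by (simp only: distrib_right)
      qed
      have cnt: "card {z \<in> spec_set \<alpha>. z \<le> v} \<le> N" if v: "0 \<le> v" "v \<le> (\<alpha> + 1) * (8 * (C * M))\<^sup>2" for v
      proof -
        have "real (card {z \<in> spec_set \<alpha>. z \<le> v}) \<le> v / sqrt \<alpha>" by (rule card_spec_set_le(2)[OF a v(1)])
        also have "\<dots> \<le> (\<alpha> + 1) * (8 * (C * M))\<^sup>2 / sqrt \<alpha>" using v a by (intro divide_right_mono) auto
        also have "\<dots> = \<kappa> * M\<^sup>2" by (simp add: \<kappa>_def power_mult_distrib)
        also have "\<dots> = real N" using k0 by (simp add: M2)
        finally show ?thesis by simp
      qed
      have "delta_min \<alpha> N \<le> \<bar>x - y\<bar>"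
      proof (cases "x < y")
        case True
        have "delta_min \<alpha> N \<le> y - x"
          by (rule delta_min_le_diff[OF a xS yS True cnt[OF spec_set_nonneg[OF a yS]]])
             (unfold y_def, rule sz[OF m(4) n(3)])
        thus ?thesis using True by simp
      next
        case False
        hence yx: "y < x" using ne by simp
        have "delta_min \<alpha> N \<le> x - y"
          by (rule delta_min_le_diff[OF a yS xS yx cnt[OF spec_set_nonneg[OF a xS]]])
             (unfold x_def, rule sz[OF m(3) n(4)])
        thus ?thesis using yx by simp
      qed
      also have "\<bar>x - y\<bar> \<le> 16 * (C * M powr (-2 + 2 * \<epsilon>))" unfolding diff using q(9) by (simp add: abs_mult)
      also have "M powr (-2 + 2 * \<epsilon>) = (M\<^sup>2) powr (-1 + \<epsilon>)"
        using M1 by (simp add: powr_powr ring_distribs flip: powr_numeral)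
      also have "\<dots> = \<kappa> powr (1 - \<epsilon>) * real N powr (-1 + \<epsilon>)"
      proof -
        have "(real N / \<kappa>) powr (-1 + \<epsilon>) = real N powr (-1 + \<epsilon>) / \<kappa> powr (-1 + \<epsilon>)"
          using N0 k0 by (simp add: powr_divide)
        also have "\<kappa> powr (-1 + \<epsilon>) = 1 / \<kappa> powr (1 - \<epsilon>)" using powr_minus_divide[of \<kappa> "1 - \<epsilon>"] by simp
        finally show ?thesis unfolding M2 by (simp add: mult.commute)
      qed
      also have "16 * (C * (\<kappa> powr (1 - \<epsilon>) * real N powr (-1 + \<epsilon>))) \<le> C' * real N powr (-1 + \<epsilon>)"
      proof -
        have "(16 * C * \<kappa> powr (1 - \<epsilon>)) * real N powr (-1 + \<epsilon>) \<le> C' * real N powr (-1 + \<epsilon>)"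
          using pos by (intro mult_right_mono) (auto simp: C'_def)
        thus ?thesis by (simp only: mult.assoc)
      qed
      finally show ?thesis .
    qed
  qed
qed

theorem theorem1p2:
  shows "AE \<alpha> in lborel. \<alpha> > 0 \<longrightarrow> \<alpha> \<notin> \<rat> \<longrightarrow>
    (\<forall>\<epsilon>::real. \<epsilon> > 0 \<longrightarrow> (\<exists>C::real. C > 0 \<and>
       (\<forall>N::nat. N \<ge> 2 \<longrightarrow> delta_min \<alpha> N \<le> C * real N powr (-1 + \<epsilon>))))"
  using AE_prod_approx by eventually_elim (use delta_min_bound in blast)

end
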